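(* Let $\Delta$ be a $(d-1)$-dimensional complex with isolated singularities of depth $d-1$. Set $h'_i=\dim_k k(\Delta,\Theta)_i$. Then for sufficiently generic $\Theta=\{\theta_1,\dots,\theta_d\}$, $$h'_d=\beta_{d-1}(\Delta),\quad h'_{d-1}=h_{d-1}(\Delta)+\dim_k\big(\mathcal{K}_{d-2}^{\theta_1}(\Delta)\cap\dots\cap\mathcal{K}_{d-2}^{\theta_d}(\Delta)\big),\quad h'_i=h_i(\Delta)\ (i<d-1).$$
   Context: Fix an infinite field $k$; $k(\Delta,\Theta)=k[\Delta]/(\Theta)$ for an l.s.o.p. $\Theta$; $\beta_i=\dim_k\tilde H_i(\Delta;k)$; $h_i$ is the $h$-vector. A space with isolated singularities is a pure complex whose vertex links are $k$-Buchsbaum. The depth of $\Delta$ is the largest $j$ such that the $(j-1)$-skeleton is $k$-Cohen–Macaulay. Here $\mathcal{K}_{d-2}^{\theta}(\Delta)$ denotes the kernel (a subspace of $\bigoplus_{v}H^{d-2}(\Delta,\{F:v\notin F\};k)$) of the map $f^{d-2,\theta}=\sum_v a_v\iota^*$ to $\tilde H^{d-2}(\Delta;k)$, where $\theta=\sum_va_vx_v$ and $\iota^*$ are the inclusion-induced maps. *)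

theory Defs
  imports Complex_Main "HOL-Library.Poly_Mapping" "HOL-Library.Function_Algebras"
begin

section \<open>Dimension of a quotient of vector spaces\<close>

(* dim (U / W) for finite-dimensional subspaces W \<subseteq> U; every use below is of this kind. *)
definition quot_dim ::
  "('k::field \<Rightarrow> 'b::ab_group_add \<Rightarrow> 'b) \<Rightarrow> 'b set \<Rightarrow> 'b set \<Rightarrow> nat" where
  "quot_dim scale U W = vector_space.dim scale U - vector_space.dim scale W"

definition fun_scale :: "'k::field \<Rightarrow> ('x \<Rightarrow> 'k) \<Rightarrow> 'x \<Rightarrow> 'k" where
  "fun_scale c f = (\<lambda>x. c * f x)"

definition fam_scale :: "'k::field \<Rightarrow> ('v \<Rightarrow> 'x \<Rightarrow> 'k) \<Rightarrow> 'v \<Rightarrow> 'x \<Rightarrow> 'k" where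
  "fam_scale c f = (\<lambda>v x. c * f v x)"

lemma vector_space_fun_scale: "vector_space fun_scale"
  by unfold_locales (auto simp: fun_scale_def fun_eq_iff algebra_simps)

lemma vector_space_fam_scale: "vector_space fam_scale"
  by unfold_locales (auto simp: fam_scale_def fun_eq_iff algebra_simps)


section \<open>Simplicial complexes\<close>

definition simplicial_complex :: "'v set set \<Rightarrow> bool" where
  "simplicial_complex \<Delta> \<longleftrightarrow>
     finite \<Delta> \<and> {} \<in> \<Delta> \<and> (\<forall>F\<in>\<Delta>. finite F) \<and> (\<forall>F\<in>\<Delta>. \<forall>G. G \<subseteq> F \<longrightarrow> G \<in> \<Delta>)"

definition vertices :: "'v set set \<Rightarrow> 'v set" where
  "vertices \<Delta> = \<Union>\<Delta>"

definition cdim :: "'v set set \<Rightarrow> int" where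
  "cdim \<Delta> = int (Max (card ` \<Delta>)) - 1"

definition facets :: "'v set set \<Rightarrow> 'v set set" where
  "facets \<Delta> = {F \<in> \<Delta>. \<forall>G\<in>\<Delta>. F \<subseteq> G \<longrightarrow> G = F}"

definition pure :: "'v set set \<Rightarrow> bool" where
  "pure \<Delta> \<longleftrightarrow> (\<forall>F\<in>facets \<Delta>. int (card F) - 1 = cdim \<Delta>)"

definition link :: "'v set set \<Rightarrow> 'v set \<Rightarrow> 'v set set" where
  "link \<Delta> F = {G \<in> \<Delta>. F \<inter> G = {} \<and> F \<union> G \<in> \<Delta>}"

definition skeleton :: "'v set set \<Rightarrow> int \<Rightarrow> 'v set set" where
  "skeleton \<Delta> i = {F \<in> \<Delta>. int (card F) - 1 \<le> i}"

definition f_number :: "'v set set \<Rightarrow> int \<Rightarrow> nat" where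
  "f_number \<Delta> i = card {F \<in> \<Delta>. int (card F) - 1 = i}"

(* d stands for cdim \<Delta> + 1. *)
definition h_number :: "'v set set \<Rightarrow> nat \<Rightarrow> nat \<Rightarrow> int" where
  "h_number \<Delta> d i =
     (\<Sum>j=0..i. (-1) ^ (i - j) * int ((d - j) choose (i - j)) * int (f_number \<Delta> (int j - 1)))"


section \<open>Reduced simplicial homology and relative cohomology\<close>

(* Faces are oriented by the linear order of the vertices. The empty face sits in degree -1, so
   the complexes are augmented and compute reduced (co)homology. Since \<Delta> is finite, chains and
   cochains are both functions supported on the faces of a given dimension. *)

definition chains :: "'v set set \<Rightarrow> int \<Rightarrow> ('v set \<Rightarrow> 'k::field) set" where
  "chains \<Delta> i = {c. \<forall>F. c F \<noteq> 0 \<longrightarrow> F \<in> \<Delta> \<and> int (card F) - 1 = i}"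

definition incidence :: "'v::linorder \<Rightarrow> 'v set \<Rightarrow> 'k::field" where
  "incidence v F = (-1) ^ card {u \<in> F. u < v}"

definition boundary :: "'v::linorder set set \<Rightarrow> ('v set \<Rightarrow> 'k::field) \<Rightarrow> 'v set \<Rightarrow> 'k" where
  "boundary \<Delta> c = (\<lambda>G. \<Sum>v \<in> vertices \<Delta> - G. incidence v (insert v G) * c (insert v G))"

definition coboundary :: "'v::linorder set set \<Rightarrow> ('v set \<Rightarrow> 'k::field) \<Rightarrow> 'v set \<Rightarrow> 'k" where
  "coboundary \<Delta> c = (\<lambda>F. if F \<in> \<Delta> then \<Sum>v \<in> F. incidence v F * c (F - {v}) else 0)"

definition betti :: "'k::field itself \<Rightarrow> 'v::linorder set set \<Rightarrow> int \<Rightarrow> nat" where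
  "betti _ \<Delta> i = quot_dim fun_scale
     {c \<in> (chains \<Delta> i :: ('v set \<Rightarrow> 'k) set). boundary \<Delta> c = 0}
     (boundary \<Delta> ` chains \<Delta> (i + 1))"

definition rel_cochains :: "'v set set \<Rightarrow> 'v set set \<Rightarrow> int \<Rightarrow> ('v set \<Rightarrow> 'k::field) set" where
  "rel_cochains \<Delta> \<Gamma> i = {c \<in> chains \<Delta> i. \<forall>F\<in>\<Gamma>. c F = 0}"

definition rel_cocycles ::
  "'v::linorder set set \<Rightarrow> 'v set set \<Rightarrow> int \<Rightarrow> ('v set \<Rightarrow> 'k::field) set" where
  "rel_cocycles \<Delta> \<Gamma> i = {c \<in> rel_cochains \<Delta> \<Gamma> i. coboundary \<Delta> c = 0}"

definition rel_coboundaries ::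
  "'v::linorder set set \<Rightarrow> 'v set set \<Rightarrow> int \<Rightarrow> ('v set \<Rightarrow> 'k::field) set" where
  "rel_coboundaries \<Delta> \<Gamma> i = coboundary \<Delta> ` rel_cochains \<Delta> \<Gamma> (i - 1)"

definition contrastar :: "'v set set \<Rightarrow> 'v \<Rightarrow> 'v set set" where
  "contrastar \<Delta> v = {F \<in> \<Delta>. v \<notin> F}"


section \<open>Cohen--Macaulay and Buchsbaum complexes, isolated singularities, depth\<close>

definition cohen_macaulay :: "'k::field itself \<Rightarrow> 'v::linorder set set \<Rightarrow> bool" where
  "cohen_macaulay K \<Delta> \<longleftrightarrow> (\<forall>F\<in>\<Delta>. \<forall>i < cdim (link \<Delta> F). betti K (link \<Delta> F) i = 0)"

definition buchsbaum :: "'k::field itself \<Rightarrow> 'v::linorder set set \<Rightarrow> bool" where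
  "buchsbaum K \<Delta> \<longleftrightarrow> pure \<Delta> \<and> (\<forall>v\<in>vertices \<Delta>. cohen_macaulay K (link \<Delta> {v}))"

definition isolated_singularities :: "'k::field itself \<Rightarrow> 'v::linorder set set \<Rightarrow> bool" where
  "isolated_singularities K \<Delta> \<longleftrightarrow> pure \<Delta> \<and> (\<forall>v\<in>vertices \<Delta>. buchsbaum K (link \<Delta> {v}))"

(* The bound on j only discards the values for which \<Delta> has no faces of dimension j - 1. *)
definition complex_depth :: "'k::field itself \<Rightarrow> 'v::linorder set set \<Rightarrow> nat" where
  "complex_depth K \<Delta> =
     (GREATEST j. int j - 1 \<le> cdim \<Delta> \<and> cohen_macaulay K (skeleton \<Delta> (int j - 1)))"


section \<open>The kernels \<open>\<K>\<^sup>\<theta>\<close>\<close>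

(* Quotients are handled through representatives. The direct sum over v of the relative cohomology
   groups H^i(\<Delta>, contrastar \<Delta> v) is the space of families of relative cocycles modulo the
   space rel_coboundary_families. The map iota^* is induced by the inclusion of relative cochains
   into cochains, and the reduced cohomology of \<Delta> is that of the pair (\<Delta>, {}). Hence
   the kernel of f^{i,theta} = \<Sum>v. a v iota^* is kernel_families \<Delta> i a modulo
   rel_coboundary_families \<Delta> i, a common denominator for all theta. *)

definition rel_coboundary_families ::
  "'v::linorder set set \<Rightarrow> int \<Rightarrow> ('v \<Rightarrow> 'v set \<Rightarrow> 'k::field) set" where
  "rel_coboundary_families \<Delta> i =
     {z. (\<forall>v\<in>vertices \<Delta>. z v \<in> rel_coboundaries \<Delta> (contrastar \<Delta> v) i) \<and>
         (\<forall>v. v \<notin> vertices \<Delta> \<longrightarrow> z v = 0)}"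

definition kernel_families ::
  "'v::linorder set set \<Rightarrow> int \<Rightarrow> ('v \<Rightarrow> 'k::field) \<Rightarrow> ('v \<Rightarrow> 'v set \<Rightarrow> 'k) set" where
  "kernel_families \<Delta> i a =
     {z. (\<forall>v\<in>vertices \<Delta>. z v \<in> rel_cocycles \<Delta> (contrastar \<Delta> v) i) \<and>
         (\<forall>v. v \<notin> vertices \<Delta> \<longrightarrow> z v = 0) \<and>
         (\<Sum>v\<in>vertices \<Delta>. fun_scale (a v) (z v)) \<in> rel_coboundaries \<Delta> {} i}"

definition dim_kernel_inter ::
  "'v::linorder set set \<Rightarrow> int \<Rightarrow> nat \<Rightarrow> (nat \<Rightarrow> 'v \<Rightarrow> 'k::field) \<Rightarrow> nat" where
  "dim_kernel_inter \<Delta> i d a =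
     quot_dim fam_scale (\<Inter>j\<in>{1..d}. kernel_families \<Delta> i (a j)) (rel_coboundary_families \<Delta> i)"


section \<open>Polynomials and face rings\<close>

type_synonym ('x, 'k) mpoly = "('x \<Rightarrow>\<^sub>0 nat) \<Rightarrow>\<^sub>0 'k"

definition polys :: "'x set \<Rightarrow> ('x, 'k::field) mpoly set" where
  "polys V = {p. \<forall>m \<in> Poly_Mapping.keys p. Poly_Mapping.keys m \<subseteq> V}"

definition mono_degree :: "('x \<Rightarrow>\<^sub>0 nat) \<Rightarrow> nat" where
  "mono_degree m = (\<Sum>x \<in> Poly_Mapping.keys m. Poly_Mapping.lookup m x)"

definition homogeneous_polys :: "'x set \<Rightarrow> nat \<Rightarrow> ('x, 'k::field) mpoly set" where
  "homogeneous_polys V i = {p \<in> polys V. \<forall>m \<in> Poly_Mapping.keys p. mono_degree m = i}"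

definition poly_scale :: "'k::field \<Rightarrow> ('x, 'k) mpoly \<Rightarrow> ('x, 'k) mpoly" where
  "poly_scale c p = Poly_Mapping.single 0 c * p"

lemma vector_space_poly_scale: "vector_space poly_scale"
  by unfold_locales
    (auto simp: poly_scale_def algebra_simps single_add mult_single simp flip: mult.assoc)

definition poly_eval :: "('x \<Rightarrow> 'k::field) \<Rightarrow> ('x, 'k) mpoly \<Rightarrow> 'k" where
  "poly_eval a p = (\<Sum>m \<in> Poly_Mapping.keys p.
     Poly_Mapping.lookup p m * (\<Prod>x \<in> Poly_Mapping.keys m. a x ^ Poly_Mapping.lookup m x))"

definition var :: "'x \<Rightarrow> ('x, 'k::field) mpoly" where
  "var x = Poly_Mapping.single (Poly_Mapping.single x 1) 1"

definition linear_form :: "'x set \<Rightarrow> ('x \<Rightarrow> 'k::field) \<Rightarrow> ('x, 'k) mpoly" where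
  "linear_form V a = (\<Sum>x\<in>V. poly_scale (a x) (var x))"

(* The ideal of the polynomial ring in the variables V generated by G. *)
definition ideal_gen :: "'x set \<Rightarrow> ('x, 'k::field) mpoly set \<Rightarrow> ('x, 'k) mpoly set" where
  "ideal_gen V G = {\<Sum>g\<in>S. q g * g | S q. finite S \<and> S \<subseteq> G \<and> (\<forall>g\<in>S. q g \<in> polys V)}"

definition nonface_monomials :: "'v set set \<Rightarrow> ('v, 'k::field) mpoly set" where
  "nonface_monomials \<Delta> = {\<Prod>v\<in>F. var v | F. F \<subseteq> vertices \<Delta> \<and> F \<notin> \<Delta>}"

(* k(\<Delta>,\<Theta>) = k[\<Delta>]/(\<Theta>) is the polynomial ring in the vertices modulo this ideal. *)
definition face_quotient_ideal ::
  "'v set set \<Rightarrow> ('v, 'k::field) mpoly set \<Rightarrow> ('v, 'k) mpoly set" where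
  "face_quotient_ideal \<Delta> \<Theta> = ideal_gen (vertices \<Delta>) (nonface_monomials \<Delta> \<union> \<Theta>)"

definition h_prime :: "'v set set \<Rightarrow> ('v, 'k::field) mpoly set \<Rightarrow> nat \<Rightarrow> nat" where
  "h_prime \<Delta> \<Theta> i = quot_dim poly_scale
     (homogeneous_polys (vertices \<Delta>) i)
     (homogeneous_polys (vertices \<Delta>) i \<inter> face_quotient_ideal \<Delta> \<Theta>)"

(* A linear system of parameters: cdim \<Delta> + 1 linear forms such that k(\<Delta>,\<Theta>) is
   finite-dimensional over k. *)
definition lsop :: "'v set set \<Rightarrow> nat \<Rightarrow> (nat \<Rightarrow> ('v, 'k::field) mpoly) \<Rightarrow> bool" where
  "lsop \<Delta> d \<theta> \<longleftrightarrow>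
     cdim \<Delta> = int d - 1 \<and>
     (\<forall>j\<in>{1..d}. \<theta> j \<in> homogeneous_polys (vertices \<Delta>) 1) \<and>
     (\<exists>B. finite B \<and> B \<subseteq> polys (vertices \<Delta>) \<and>
        (\<forall>p\<in>polys (vertices \<Delta>). \<exists>b\<in>module.span poly_scale B.
            p - b \<in> face_quotient_ideal \<Delta> (\<theta> ` {1..d})))"

(* Q holds on a Zariski open set of coefficient tuples (a j v), 1 \<le> j \<le> d, v \<in> V, which is
   nonempty when k is infinite. *)
definition sufficiently_generic ::
  "nat \<Rightarrow> 'v set \<Rightarrow> ((nat \<Rightarrow> 'v \<Rightarrow> 'k::field) \<Rightarrow> bool) \<Rightarrow> bool" where
  "sufficiently_generic d V Q \<longleftrightarrow>
     (\<exists>P :: (nat \<times> 'v, 'k) mpoly. P \<in> polys ({1..d} \<times> V) \<and> P \<noteq> 0 \<and>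
        (\<forall>a. poly_eval (\<lambda>(j, v). a j v) P \<noteq> 0 \<longrightarrow> Q a))"

end

theory Submission
  imports Defs "HOL-Library.Product_Lexorder"
begin

text \<open>
  Write \<open>p v = (a 1 v, \<dots>, a d v)\<close>. Genericity is only used to ensure that the vectors \<open>p v\<close>, \<open>v \<in> F\<close>, are
  linearly independent for every face \<open>F\<close>. Dually, \<open>k(\<Delta>,\<Theta>)\<close> in degree \<open>i\<close> is the space of stresses:
  functions \<open>g\<close> on the monomials of degree \<open>i\<close> supported on faces with \<open>(\<Sum>v. g (m x\<^sub>v) p v) = 0\<close> for all \<open>m\<close>. A stress is
  determined by its squarefree coefficients, and \<open>F \<mapsto> g (x\<^sub>F) \<omega>\<^sub>F\<close> identifies stresses with the top cycles of the
  complex \<open>T\<^sup>e\<close>, \<open>e = d - i\<close>, of simplicial chains of \<open>\<Delta>\<close> whose coefficient at \<open>F\<close> is an exterior \<open>e\<close>-form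
  annihilated by all \<open>p v\<close>, \<open>v \<in> F\<close>; here \<open>\<omega>\<^sub>F\<close> is the volume form contracted with these vectors. The Euler
  characteristic of \<open>T\<^sup>e\<close> is \<open>h\<^sub>i\<close>, so only its lower homology matters. Imposing the annihilation
  conditions one vertex at a time gives short exact sequences whose remaining terms are relative chain
  complexes, that is, chain complexes of links. These are acyclic below the top degree for faces with at
  least two vertices (isolated singularities), and below the top degree but one for the others (depth).
  Hence the lower homology of \<open>T\<^sup>e\<close> vanishes for \<open>e \<ge> 2\<close>, while for \<open>e = 1\<close> it is the cokernel of the map
  dual to the one defining the intersection of the kernels, and \<open>T\<^sup>0\<close> is the chain complex of \<open>\<Delta>\<close>.
\<close>

text \<open>Exterior forms enter because the condition on squarefree coefficients at a face
  \<open>G\<close> says that a certain vector lies in the span of the \<open>p v\<close>,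
  \<open>v \<in> G\<close>. Contracting the form of \<open>G\<close> with that vector tests this
  linearly, and the signs that arise are those of the simplicial boundary, so the conditions become
  the cycle condition of a complex. At a face with \<open>q\<close> vertices the coefficient space
  has dimension \<open>(d - q) choose e\<close>. For \<open>e = d - i\<close> this is one at
  \<open>q = i\<close> and zero for larger faces, so the complex ends there; for
  \<open>q \<le> i\<close> it is the binomial \<open>(d - q) choose (i - q)\<close> of the
  \<open>h\<close>-vector. The obstacle is that faces with at most one vertex may carry homology one
  degree too early. Trading an annihilation condition for a larger face lowers \<open>e\<close> and
  raises \<open>q\<close> by one, so \<open>q + e\<close> is preserved. Starting from the empty
  face, the bad degree \<open>d - 1\<close> at a vertex is reached only from
  \<open>q = d - 2\<close>, and for \<open>e \<ge> 1\<close> this lies below the top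
  \<open>q = d - e\<close> only if \<open>e = 1\<close>. Hence exactly one entry is corrected. The
  parameter property comes from the same source: above degree \<open>d\<close> there are no
  squarefree coefficients on faces, so no stresses.\<close>

section \<open>Finite-dimensional subspaces\<close>

text \<open>The ambient spaces of functions, families and polynomials are infinite-dimensional in
  general, so finiteness is attached to the subspace; it is what makes \<open>dim\<close> monotone
  and additive.\<close>

definition (in vector_space) findim :: "'b set \<Rightarrow> bool" where
  "findim U \<longleftrightarrow> subspace U \<and> (\<exists>B. finite B \<and> U \<subseteq> span B)"

context vector_space
begin

lemma findim_subspace: "findim U \<Longrightarrow> subspace U"
  by (simp add: findim_def)

lemma findim_subset: "findim U \<Longrightarrow> subspace W \<Longrightarrow> W \<subseteq> U \<Longrightarrow> findim W"
  unfolding findim_def by blast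

text \<open>The finite spanning set bounds the size of a maximal independent set. All dimension
  comparisons below go through such completed bases; \<open>B = {}\<close> gives a plain
  basis.\<close>

lemma findim_independent_extend:
  assumes "findim U" "B \<subseteq> U" "independent B"
  obtains C where "finite C" "B \<subseteq> C" "C \<subseteq> U" "independent C" "span C = U" "card C = dim U"
proof -
  obtain C where C: "B \<subseteq> C" "C \<subseteq> U" "independent C" "U \<subseteq> span C"
    using maximal_independent_subset_extend[OF assms(2,3)] by metis
  obtain D where D: "finite D" "U \<subseteq> span D"
    using assms(1) unfolding findim_def by blast
  have "finite C"
    using independent_span_bound[OF D(1) C(3)] C(2) D(2) by blast
  moreover have "span C = U"
    using C assms(1) span_subspace unfolding findim_def by blast
  moreover have "card C = dim U"
    using basis_card_eq_dim C by blast
  ultimately show thesis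
    using that C by blast
qed

lemma dim_le_of_findim:
  assumes "findim U" "subspace W" "W \<subseteq> U"
  shows "dim W \<le> dim U"
proof -
  obtain B where B: "finite B" "B \<subseteq> W" "span B = W" "independent B" "card B = dim W"
    by (metis findim_independent_extend[OF findim_subset[OF assms], of "{}"] empty_subsetI independent_empty)
  obtain C where C: "finite C" "B \<subseteq> C" "card C = dim U"
    by (metis findim_independent_extend[OF assms(1), of B] B(2,4) assms(3) subset_trans)
  show ?thesis
    using card_mono[OF C(1,2)] B(5) C(3) by simp
qed

text \<open>Turns dimension counts into equalities of subspaces; this is how a vanishing Betti
  number becomes exactness.\<close>

lemma eq_of_dim_le:
  assumes "findim U" "subspace W" "W \<subseteq> U" "dim U \<le> dim W"
  shows "W = U"
proof -
  obtain B where B: "finite B" "B \<subseteq> W" "span B = W" "independent B" "card B = dim W"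
    by (metis findim_independent_extend[OF findim_subset[OF assms(1-3)], of "{}"] empty_subsetI independent_empty)
  obtain C where C: "finite C" "B \<subseteq> C" "card C = dim U" "span C = U"
    by (metis findim_independent_extend[OF assms(1), of B] B(2,4) assms(3) subset_trans)
  have "B = C"
    using card_subset_eq[OF C(1,2)] card_mono[OF C(1,2)] B(5) C(3) assms(4) by simp
  then show ?thesis
    using B(3) C(4) by simp
qed

lemma dim_zero_subspace: "dim {0} = 0"
  using dim_unique[of "{}" "{0}" 0] independent_empty by simp

lemma findim_zero: "findim {0}"
  unfolding findim_def by (intro conjI exI[of _ "{}"]) auto

lemma dim_eq_1_multiples:
  assumes "findim U" "dim U = 1" "w \<in> U" "w \<noteq> 0" "x \<in> U"
  shows "\<exists>r. x = scale r w"
proof -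
  have "independent {w}"
    using assms(4) by simp
  then obtain C where C: "finite C" "{w} \<subseteq> C" "span C = U" "card C = dim U"
    using findim_independent_extend[OF assms(1), of "{w}"] assms(3) by (metis empty_subsetI insert_subset)
  then have "C = {w}"
    using assms(2) by (metis card_1_singletonE insert_subset singletonD)
  then show ?thesis
    using C(3) assms(5) span_singleton by auto
qed

end

section \<open>Rank and nullity on subspaces\<close>

context vector_space_pair
begin

lemma findim_image:
  assumes "Vector_Spaces.linear s1 s2 f" "vs1.findim U"
  shows "vs2.findim (f ` U)"
proof -
  obtain B where "finite B" "U \<subseteq> vs1.span B"
    using assms(2) unfolding vs1.findim_def by blast
  then have "finite (f ` B)" "f ` U \<subseteq> vs2.span (f ` B)"
    using linear_span_image[OF assms(1), of B] by auto
  then show ?thesis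
    using linear_subspace_image[OF assms(1)] assms(2) unfolding vs1.findim_def vs2.findim_def
    by blast
qed

lemma findim_kernel:
  assumes "Vector_Spaces.linear s1 s2 f" "vs1.findim U"
  shows "vs1.findim {x\<in>U. f x = 0}"
proof -
  have "vs1.subspace {x\<in>U. f x = 0}"
    using assms linear_0[OF assms(1)] unfolding vs1.findim_def vs1.subspace_def
    by (auto simp: linear_add[OF assms(1)] linear_scale[OF assms(1)])
  then show ?thesis
    using vs1.findim_subset[OF assms(2)] by blast
qed

text \<open>A basis \<open>B\<close> of the kernel is completed to a basis \<open>C\<close> of
  \<open>U\<close>; the images of \<open>C - B\<close> are then a basis of the image.\<close>

lemma rank_nullity:
  assumes "Vector_Spaces.linear s1 s2 f" "vs1.findim U"
  shows "vs1.dim U = vs1.dim {x\<in>U. f x = 0} + vs2.dim (f ` U)"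
proof -
  obtain B where B: "finite B" "B \<subseteq> {x\<in>U. f x = 0}" "vs1.independent B"
      "vs1.span B = {x\<in>U. f x = 0}" "card B = vs1.dim {x\<in>U. f x = 0}"
    by (metis vs1.findim_independent_extend[OF findim_kernel[OF assms], of "{}"] empty_subsetI
        vs1.independent_empty)
  obtain C where C: "finite C" "B \<subseteq> C" "C \<subseteq> U" "vs1.independent C" "vs1.span C = U" "card C = vs1.dim U"
    by (metis (no_types, lifting) vs1.findim_independent_extend[OF assms(2), of B] B(2,3)
        mem_Collect_eq subset_iff)
  \<comment> \<open>Such a vector has one expansion in \<open>B\<close> and one in
    \<open>C - B\<close>; their difference is a relation in the independent set
    \<open>C\<close>.\<close>
  have lin0: "x = 0" if x: "x \<in> vs1.span (C - B)" "f x = 0" for x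
  proof -
    have "x \<in> vs1.span B"
      using x B(4) C(5) vs1.span_mono[of "C - B" C] by auto
    then obtain w where w: "x = (\<Sum>b\<in>B. s1 (w b) b)"
      using vs1.span_finite[OF B(1)] by auto
    obtain u where u: "x = (\<Sum>b\<in>C - B. s1 (u b) b)"
      using x(1) vs1.span_finite[of "C - B"] C(1) by auto
    define r where "r b = (if b \<in> B then - w b else u b)" for b
    have "(\<Sum>b\<in>C. s1 (r b) b) = (\<Sum>b\<in>C - B. s1 (r b) b) + (\<Sum>b\<in>B. s1 (r b) b)"
      by (rule sum.subset_diff[OF C(2,1)])
    also have "\<dots> = x - x"
      using u w by (simp add: r_def sum_negf)
    finally have "(\<Sum>b\<in>C. s1 (r b) b) = 0" by simp
    then have "r b = 0" if "b \<in> C" for b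
      using vs1.independentD[OF C(4,1) order_refl] that by blast
    then have "u b = 0" if "b \<in> C - B" for b
      using that unfolding r_def by fastforce
    then show ?thesis
      using u by simp
  qed
  have inj: "inj_on f (vs1.span (C - B))"
    using lin0 linear_inj_on_iff_eq_0[OF assms(1), of "vs1.span (C - B)"] by auto
  have "vs2.independent (f ` (C - B))"
    using linear_independent_injective_image[OF assms(1) _ inj] vs1.independent_mono[OF C(4)] by blast
  moreover have "f ` U \<subseteq> vs2.span (f ` (C - B))"
  proof
    fix y assume "y \<in> f ` U"
    then obtain x where x: "x \<in> vs1.span (B \<union> (C - B))" "y = f x"
      using C(2,5) by (auto simp: Un_absorb1)
    then obtain x1 x2 where "x = x1 + x2" "x1 \<in> vs1.span B" "x2 \<in> vs1.span (C - B)"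
      unfolding vs1.span_Un by blast
    then show "y \<in> vs2.span (f ` (C - B))"
      using x(2) B(4) linear_span_image[OF assms(1)] by (auto simp: linear_add[OF assms(1)])
  qed
  moreover have "f ` (C - B) \<subseteq> f ` U"
    using C(3) by auto
  ultimately have "card (f ` (C - B)) = vs2.dim (f ` U)"
    using vs2.basis_card_eq_dim by blast
  moreover have "card (f ` (C - B)) = card (C - B)"
    using card_image inj_on_subset[OF inj vs1.span_superset] by blast
  moreover have "card C = card B + card (C - B)"
    using C(1,2) B(1) by (simp add: card_Diff_subset card_mono)
  ultimately show ?thesis
    using B(5) C(6) by simp
qed

lemma dim_image_injective:
  assumes "Vector_Spaces.linear s1 s2 f" "vs1.findim U" "\<And>x. x \<in> U \<Longrightarrow> f x = 0 \<Longrightarrow> x = 0"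
  shows "vs2.dim (f ` U) = vs1.dim U"
proof -
  have "{x\<in>U. f x = 0} = {0}"
    using assms linear_0 vs1.subspace_0 vs1.findim_subspace by auto
  then show ?thesis
    using rank_nullity[OF assms(1,2)] vs1.dim_zero_subspace by simp
qed

end

section \<open>Finitely supported functions\<close>

interpretation funs: vector_space fun_scale
  by (rule vector_space_fun_scale)

interpretation fams: vector_space fam_scale
  by (rule vector_space_fam_scale)

interpretation funs_pair: vector_space_pair fun_scale fun_scale ..

interpretation fams_pair: vector_space_pair fam_scale fam_scale ..

interpretation fams_funs: vector_space_pair fam_scale fun_scale ..

interpretation funs_fams: vector_space_pair fun_scale fam_scale ..

lemmas linear_funI = Vector_Spaces.linear_iff[THEN iffD2, OF conjI, OF vector_space_fun_scale conjI, OF vector_space_fun_scale conjI]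

section \<open>Coordinate spaces and annihilators\<close>

definition supp_in :: "'x set \<Rightarrow> ('x \<Rightarrow> 'k::field) set" where
  "supp_in X = {f. \<forall>x. x \<notin> X \<longrightarrow> f x = 0}"

lemma supp_inD: "f \<in> supp_in X \<Longrightarrow> x \<notin> X \<Longrightarrow> f x = 0"
  by (auto simp: supp_in_def)

lemma supp_in_subspace: "funs.subspace (supp_in X)"
  unfolding funs.subspace_def supp_in_def by (auto simp: fun_scale_def)

lemma supp_in_empty: "supp_in {} = {0}"
  by (auto simp: supp_in_def)

lemma supp_in_dim:
  assumes "finite X"
  shows "funs.findim (supp_in X :: ('x \<Rightarrow> 'k::field) set)" "funs.dim (supp_in X :: ('x \<Rightarrow> 'k) set) = card X"
proof -
  define e :: "'x \<Rightarrow> 'x \<Rightarrow> 'k" where "e = (\<lambda>x y. if y = x then 1 else 0)"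
  have inj: "inj_on e X"
  proof (rule inj_onI)
    fix x y assume "e x = e y"
    then have "e x x = e y x" by simp
    then show "x = y" by (simp add: e_def split: if_splits)
  qed
  have sum_e: "(\<Sum>b\<in>X. fun_scale (u b) (e b)) = (\<lambda>y. if y \<in> X then u y else 0)" for u :: "'x \<Rightarrow> 'k"
  proof
    fix y
    have "(\<Sum>b\<in>X. fun_scale (u b) (e b)) y = (\<Sum>b\<in>X. u b * (if y = b then 1 else 0))"
      using assms by (induction X) (auto simp: fun_scale_def e_def)
    also have "\<dots> = (\<Sum>b\<in>X. if y = b then u b else 0)"
      by (intro sum.cong) auto
    finally show "(\<Sum>b\<in>X. fun_scale (u b) (e b)) y = (if y \<in> X then u y else 0)"
      using assms by simp
  qed
  have sup: "supp_in X \<subseteq> funs.span (e ` X)"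
  proof
    fix f :: "'x \<Rightarrow> 'k" assume f: "f \<in> supp_in X"
    have "(\<Sum>b\<in>X. fun_scale (f b) (e b)) \<in> funs.span (e ` X)"
      by (intro funs.span_sum funs.span_scale funs.span_base) auto
    moreover have "(\<Sum>b\<in>X. fun_scale (f b) (e b)) = f"
      unfolding sum_e using f by (auto simp: supp_in_def fun_eq_iff)
    ultimately show "f \<in> funs.span (e ` X)" by simp
  qed
  then show "funs.findim (supp_in X :: ('x \<Rightarrow> 'k) set)"
    unfolding funs.findim_def using supp_in_subspace assms by blast
  have "funs.independent (e ` X)"
  proof (rule funs.independent_if_scalars_zero)
    fix u b
    assume "(\<Sum>x\<in>e ` X. fun_scale (u x) x) = 0" "b \<in> e ` X"
    then have "(\<Sum>x\<in>X. fun_scale (u (e x)) (e x)) = 0" 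
      by (simp add: sum.reindex[OF inj])
    then have *: "(\<lambda>x. if x \<in> X then u (e x) else 0) = 0"
      unfolding sum_e .
    obtain x where "x \<in> X" "b = e x"
      using \<open>b \<in> e ` X\<close> by blast
    then show "u b = 0"
      using fun_cong[OF *, of x] by simp
  qed (use assms in simp)
  moreover have "e ` X \<subseteq> supp_in X"
    by (auto simp: supp_in_def e_def split: if_splits)
  ultimately show "funs.dim (supp_in X :: ('x \<Rightarrow> 'k) set) = card X"
    using funs.dim_unique[OF _ sup] card_image[OF inj] by blast
qed

text \<open>The annihilator under the standard bilinear form, taken inside \<open>supp_in X\<close>.
  For finite \<open>X\<close> it is a concrete model of the dual of \<open>supp_in X\<close> modulo
  \<open>U\<close>.\<close>

definition perp :: "'x set \<Rightarrow> ('x \<Rightarrow> 'k::field) set \<Rightarrow> ('x \<Rightarrow> 'k) set" where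
  "perp X U = {g \<in> supp_in X. \<forall>f\<in>U. (\<Sum>x\<in>X. f x * g x) = 0}"

lemma perp_subspace: "funs.subspace (perp X (U :: ('x \<Rightarrow> 'k::field) set))"
proof -
  have "(\<Sum>x\<in>X. f x * (c * g x)) = c * (\<Sum>x\<in>X. f x * g x)" for f g :: "'x \<Rightarrow> 'k" and c
    by (simp add: sum_distrib_left mult.left_commute)
  then show ?thesis
    unfolding funs.subspace_def perp_def supp_in_def
    by (auto simp: fun_scale_def distrib_left sum.distrib)
qed

text \<open>Over a general field \<open>U\<close> may meet its annihilator, so there is no
  orthogonal splitting to use. Instead one coordinate is removed at a time, and each coordinate
  contributes one dimension to exactly one of \<open>U\<close> and its annihilator.\<close>

lemma perp_dim:
  fixes U :: "('a \<Rightarrow> 'b::field) set"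
  assumes "finite X" "funs.subspace U" "U \<subseteq> supp_in X"
  shows "funs.dim U + funs.dim (perp X U) = card X"
  using assms
proof (induction X arbitrary: U)
  case empty
  then have "U = {0}"
    using supp_in_empty funs.subspace_0 by fastforce
  moreover have "perp {} U = {0}"
    using supp_in_empty by (auto simp: perp_def)
  ultimately show ?case
    using funs.dim_zero_subspace by simp
next
  case (insert x Y)
  define r where "r = (\<lambda>f :: 'a \<Rightarrow> 'b. \<lambda>y. if y = x then f x else 0)"
  define t where "t = (\<lambda>f :: 'a \<Rightarrow> 'b. \<lambda>y. if y \<in> Y then f y else 0)"
  have lr: "Vector_Spaces.linear fun_scale fun_scale r" and lt: "Vector_Spaces.linear fun_scale fun_scale t"
    by (rule linear_funI; auto simp: r_def t_def fun_scale_def fun_eq_iff)+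
  have fin: "funs.findim (supp_in (insert x Y) :: ('a \<Rightarrow> 'b) set)"
    by (rule supp_in_dim(1)) (use insert.hyps in simp)
  have finU: "funs.findim U"
    using funs.findim_subset[OF fin] insert.prems by blast
  have finp: "funs.findim (perp (insert x Y) U)"
    by (rule funs.findim_subset[OF fin perp_subspace]) (auto simp: perp_def)
  define U0 where "U0 = {f\<in>U. r f = 0}"
  have U0: "U0 = {f \<in> U. f x = 0}"
    unfolding U0_def r_def by (auto simp: fun_eq_iff)
  have U0s: "funs.subspace U0" 
    using funs_pair.findim_kernel[OF lr finU] unfolding U0_def by (rule funs.findim_subspace)
  have "U0 \<subseteq> supp_in Y"
    using insert.prems(2) unfolding U0 supp_in_def by auto
  then have IH: "funs.dim U0 + funs.dim (perp Y U0) = card Y"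
    using insert.IH U0s by blast
  have rnU: "funs.dim U = funs.dim U0 + funs.dim (r ` U)"
    using funs_pair.rank_nullity[OF lr finU] unfolding U0_def .
  have rnp: "funs.dim (perp (insert x Y) U) =
      funs.dim {g\<in>perp (insert x Y) U. t g = 0} + funs.dim (t ` perp (insert x Y) U)"
    by (rule funs_pair.rank_nullity[OF lt finp])
  have dimx: "funs.dim (supp_in {x} :: ('a \<Rightarrow> 'b) set) = 1"
    using supp_in_dim(2)[of "{x}"] by simp
  have t0: "t g = 0 \<longleftrightarrow> g \<in> supp_in {x}" if "g \<in> supp_in (insert x Y)" for g
    using that insert.hyps(2) unfolding t_def supp_in_def by (auto simp: fun_eq_iff)
  show ?case
  \<comment> \<open>If all of \<open>U\<close> vanishes at \<open>x\<close>, that coordinate is free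
    in the annihilator; otherwise an element \<open>u\<close> with \<open>u x = 1\<close> determines
    it from the others.\<close>
  proof (cases "U0 = U")
    case True
    then have Ux: "f x = 0" if "f \<in> U" for f
      using that unfolding U0 by blast
    have sumUx: "(\<Sum>y\<in>insert x Y. f y * g y) = (\<Sum>y\<in>Y. f y * g y)" if "f \<in> U" for f g
      using Ux[OF that] insert.hyps by simp
    have "r f = 0" if "f \<in> U" for f
      using Ux[OF that] by (auto simp: r_def)
    then have "r ` U = {0}"
      using funs.subspace_0[OF insert.prems(1)] by force
    moreover have "{g\<in>perp (insert x Y) U. t g = 0} = supp_in {x}"
    proof -
      have "g \<in> perp (insert x Y) U" if "g \<in> supp_in {x}" for g
      proof -
        have "g \<in> supp_in (insert x Y)"
          using that unfolding supp_in_def by auto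
        moreover have "(\<Sum>y\<in>insert x Y. f y * g y) = 0" if "f \<in> U" for f
          using Ux[OF that] \<open>g \<in> supp_in {x}\<close> unfolding supp_in_def
          by (intro sum.neutral) auto
        ultimately show ?thesis
          unfolding perp_def by blast
      qed
      then show ?thesis
        using t0 unfolding perp_def by blast
    qed
    moreover have "t ` perp (insert x Y) U = perp Y U0"
    proof
      show "t ` perp (insert x Y) U \<subseteq> perp Y U0"
        unfolding True perp_def t_def by (auto simp: supp_in_def sumUx)
      show "perp Y U0 \<subseteq> t ` perp (insert x Y) U"
      proof
        fix g assume g: "g \<in> perp Y U0"
        then have "t g = g"
          unfolding perp_def t_def supp_in_def by (auto simp: fun_eq_iff)
        moreover have "g \<in> perp (insert x Y) U"
          using g unfolding True perp_def by (auto simp: supp_in_def sumUx)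
        ultimately show "g \<in> t ` perp (insert x Y) U" by (metis imageI)
      qed
    qed
    ultimately show ?thesis
      using rnU rnp IH insert.hyps dimx by (simp add: funs.dim_zero_subspace)
  next
    case False
    then obtain u' where u': "u' \<in> U" "u' x \<noteq> 0"
      unfolding U0 by auto
    define u where "u = fun_scale (inverse (u' x)) u'"
    have u: "u \<in> U" "u x = 1"
      using u' insert.prems(1) unfolding u_def by (auto simp: funs.subspace_scale) (simp add: fun_scale_def)
    have "r ` U = supp_in {x}"
    proof
      show "r ` U \<subseteq> supp_in {x}" 
        unfolding r_def supp_in_def by auto
      show "supp_in {x} \<subseteq> r ` U"
      proof
        fix f :: "'a \<Rightarrow> 'b" assume "f \<in> supp_in {x}"
        then have "f = r (fun_scale (f x) u)"
          using u(2) unfolding r_def fun_scale_def supp_in_def by (auto simp: fun_eq_iff)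
        then show "f \<in> r ` U"
          using u(1) insert.prems(1) by (auto simp: funs.subspace_scale)
      qed
    qed
    moreover have "{g\<in>perp (insert x Y) U. t g = 0} = {0}"
    proof -
      have "g = 0" if g: "g \<in> perp (insert x Y) U" "t g = 0" for g
      proof -
        have gx: "g \<in> supp_in {x}"
          using t0 g unfolding perp_def by blast
        have "(\<Sum>y\<in>insert x Y. u y * g y) = 0"
          using g(1) u(1) unfolding perp_def by blast
        moreover have "(\<Sum>y\<in>Y. u y * g y) = 0"
          using gx insert.hyps(2) by (intro sum.neutral) (auto simp: supp_in_def)
        ultimately have "g x = 0"
          using u(2) insert.hyps by simp
        then show "g = 0"
          using gx unfolding supp_in_def by (auto simp: fun_eq_iff)
      qed
      moreover have "0 \<in> perp (insert x Y) U" "t 0 = 0"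
        using funs.subspace_0[OF perp_subspace] by (auto simp: t_def)
      ultimately show ?thesis by blast
    qed
    moreover have "t ` perp (insert x Y) U = perp Y U0"
    proof
      show "t ` perp (insert x Y) U \<subseteq> perp Y U0"
        using insert.hyps unfolding U0 perp_def t_def
        by (auto simp: supp_in_def)
      show "perp Y U0 \<subseteq> t ` perp (insert x Y) U"
      proof
        fix g assume g: "g \<in> perp Y U0"
        \<comment> \<open>The value at \<open>x\<close> is forced by orthogonality to
          \<open>u\<close>; any \<open>f\<close> in \<open>U\<close> then reduces to
          \<open>f - f x u\<close>, which lies in \<open>U0\<close>.\<close>
        define g' where "g' = (\<lambda>y. if y = x then - (\<Sum>z\<in>Y. u z * g z) else g y)"
        have tg: "t g' = g"
          using g insert.hyps(2) unfolding perp_def t_def g'_def supp_in_def by (auto simp: fun_eq_iff)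
        have "(\<Sum>y\<in>insert x Y. f y * g' y) = 0" if f: "f \<in> U" for f
        proof -
          define f0 where "f0 = f - fun_scale (f x) u"
          have "f0 \<in> U0"
            using f u insert.prems(1) unfolding U0 f0_def
            by (simp add: funs.subspace_diff funs.subspace_scale) (simp add: fun_scale_def)
          then have "0 = (\<Sum>y\<in>Y. f0 y * g y)"
            using g unfolding perp_def by simp
          also have "\<dots> = (\<Sum>y\<in>Y. f y * g y) - f x * (\<Sum>y\<in>Y. u y * g y)"
            unfolding f0_def by (simp add: fun_scale_def algebra_simps sum_subtractf sum_distrib_left)
          also have "(\<Sum>y\<in>Y. f y * g y) = (\<Sum>y\<in>Y. f y * g' y)"
            using insert.hyps(2) by (intro sum.cong) (auto simp: g'_def)
          finally show ?thesis
            using insert.hyps by (simp add: g'_def)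
        qed
        then have "g' \<in> perp (insert x Y) U"
          using g unfolding perp_def g'_def supp_in_def by auto
        then show "g \<in> t ` perp (insert x Y) U"
          using tg by (metis imageI)
      qed
    qed
    ultimately show ?thesis
      using rnU rnp IH insert.hyps dimx by (simp add: funs.dim_zero_subspace)
  qed
qed

text \<open>One inclusion is the adjunction formula, the other a dimension count. It converts
  coboundaries into annihilators of cycles, so that cohomological data can be handled on the side of
  chains.\<close>

lemma image_adjoint_eq_perp_kernel:
  fixes L :: "('a \<Rightarrow> 'b::field) \<Rightarrow> 'c \<Rightarrow> 'b"
  assumes X: "finite X" and Y: "finite Y"
    and L: "Vector_Spaces.linear fun_scale fun_scale L" "L ` supp_in X \<subseteq> supp_in Y"
    and M: "Vector_Spaces.linear fun_scale fun_scale M" "M ` supp_in Y \<subseteq> supp_in X"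
    and adj: "\<And>f g. f \<in> supp_in X \<Longrightarrow> g \<in> supp_in Y \<Longrightarrow>
      (\<Sum>y\<in>Y. L f y * g y) = (\<Sum>x\<in>X. f x * M g x)"
  shows "M ` supp_in Y = perp X {f\<in>supp_in X. L f = 0}"
proof (rule funs.eq_of_dim_le)
  have fX: "funs.findim (supp_in X :: ('a \<Rightarrow> 'b) set)" and fY: "funs.findim (supp_in Y :: ('c \<Rightarrow> 'b) set)"
    by (rule supp_in_dim(1)[OF X], rule supp_in_dim(1)[OF Y])
  show "funs.findim (perp X {f\<in>supp_in X. L f = 0})"
    by (rule funs.findim_subset[OF fX perp_subspace]) (auto simp: perp_def)
  show "funs.subspace (M ` supp_in Y)"
    using funs_pair.findim_image[OF M(1) fY] funs.findim_subspace by blast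
  show "M ` supp_in Y \<subseteq> perp X {f\<in>supp_in X. L f = 0}"
    unfolding perp_def using M(2) adj[symmetric] by auto
  \<comment> \<open>The adjunction formula tested on indicator functions of points of
    \<open>X\<close>.\<close>
  have "{g\<in>supp_in Y. M g = 0} = perp Y (L ` supp_in X)"
  proof -
    have "M g = 0" if g: "g \<in> supp_in Y" "\<forall>f\<in>supp_in X. (\<Sum>y\<in>Y. L f y * g y) = 0" for g
    proof
      fix x
      show "M g x = 0 x"
      proof (cases "x \<in> X")
        case True
        define f :: "'a \<Rightarrow> 'b" where "f = (\<lambda>y. if y = x then 1 else 0)"
        have f: "f \<in> supp_in X"
          using True by (auto simp: f_def supp_in_def)
        have "(\<Sum>y\<in>X. f y * M g y) = (\<Sum>y\<in>X. if y = x then M g y else 0)"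
          by (intro sum.cong) (auto simp: f_def)
        then show ?thesis
          using adj[OF f g(1)] g(2) f True X by simp
      next
        case False
        have "M g \<in> supp_in X"
          using M(2) g(1) by blast
        then show ?thesis
          using False by (simp add: supp_inD)
      qed
    qed
    then show ?thesis
      unfolding perp_def using adj by (auto simp: fun_eq_iff)
  qed
  then have "funs.dim (M ` supp_in Y) = card Y - funs.dim (perp Y (L ` supp_in X))"
    using funs_pair.rank_nullity[OF M(1) fY] supp_in_dim(2)[OF Y, where 'k='b] by simp
  also have "\<dots> = funs.dim (L ` supp_in X)"
    using perp_dim[OF Y _ L(2)] funs_pair.findim_image[OF L(1) fX] funs.findim_subspace by fastforce
  also have "\<dots> = card X - funs.dim {f\<in>supp_in X. L f = 0}"
    using funs_pair.rank_nullity[OF L(1) fX] supp_in_dim(2)[OF X, where 'k='b] by simp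
  also have "\<dots> = funs.dim (perp X {f\<in>supp_in X. L f = 0})"
    using perp_dim[OF X, of "{f\<in>supp_in X. L f = 0}"] funs_pair.findim_kernel[OF L(1) fX]
      funs.findim_subspace by fastforce
  finally show "funs.dim (perp X {f\<in>supp_in X. L f = 0}) \<le> funs.dim (M ` supp_in Y)" by simp
qed

text \<open>A direct sum realised by families that are zero off \<open>X\<close>, so that equality
  of elements is equality of functions.\<close>

definition fam_prod :: "'x set \<Rightarrow> ('x \<Rightarrow> ('y \<Rightarrow> 'k::field) set) \<Rightarrow> ('x \<Rightarrow> 'y \<Rightarrow> 'k) set" where
  "fam_prod X U = {c. \<forall>x. if x \<in> X then c x \<in> U x else c x = 0}"

lemma fam_prod_dim:
  fixes U :: "'a \<Rightarrow> ('b \<Rightarrow> 'c::field) set"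
  assumes "finite X" "\<And>x. x \<in> X \<Longrightarrow> funs.findim (U x)"
  shows "fams.findim (fam_prod X U)" "fams.dim (fam_prod X U) = (\<Sum>x\<in>X. funs.dim (U x))"
proof -
  have "fams.findim (fam_prod X U) \<and> fams.dim (fam_prod X U) = (\<Sum>x\<in>X. funs.dim (U x))"
    using assms
  proof (induction X)
    case empty
    have "fam_prod {} U = {0}"
      by (auto simp: fam_prod_def fun_eq_iff)
    then show ?case
      using fams.findim_zero fams.dim_zero_subspace by simp
  next
    case (insert x X)
    define i where "i = (\<lambda>(f :: 'b \<Rightarrow> 'c) y. if y = x then f else 0)"
    have li: "Vector_Spaces.linear fun_scale fam_scale i"
      unfolding Vector_Spaces.linear_iff i_def using vector_space_fun_scale vector_space_fam_scale
      by (auto simp: fun_eq_iff fun_scale_def fam_scale_def)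
    define ev where "ev = (\<lambda>c :: 'a \<Rightarrow> 'b \<Rightarrow> 'c. c x)"
    have lev: "Vector_Spaces.linear fam_scale fun_scale ev"
      unfolding Vector_Spaces.linear_iff ev_def using vector_space_fun_scale vector_space_fam_scale
      by (auto simp: fun_eq_iff fun_scale_def fam_scale_def)
    have fU: "funs.findim (U x)" and IH: "fams.findim (fam_prod X U)"
        "fams.dim (fam_prod X U) = (\<Sum>x\<in>X. funs.dim (U x))"
      using insert by auto
    have fam_scale_app: "fam_scale r c y = fun_scale r (c y)" for r :: 'c and c :: "'a \<Rightarrow> 'b \<Rightarrow> 'c" and y
      by (simp add: fam_scale_def fun_scale_def)
    have "funs.subspace (U y)" if "y \<in> insert x X" for y
      using insert.prems that funs.findim_subspace by blast
    then have sub: "fams.subspace (fam_prod (insert x X) U)"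
      unfolding fams.subspace_def fam_prod_def fam_scale_app
      by (simp add: funs.subspace_0 funs.subspace_add funs.subspace_scale)
    obtain B where B: "finite B" "fam_prod X U \<subseteq> fams.span B"
      using IH(1) unfolding fams.findim_def by blast
    obtain C where C: "finite C" "i ` U x \<subseteq> fams.span C"
      using funs_fams.findim_image[OF li fU] unfolding fams.findim_def by blast
    have "fam_prod (insert x X) U \<subseteq> fams.span (B \<union> C)"
    proof
      fix c assume c: "c \<in> fam_prod (insert x X) U"
      have "c = (\<lambda>y. if y = x then 0 else c y) + i (c x)"
        by (auto simp: i_def fun_eq_iff)
      moreover have "(\<lambda>y. if y = x then 0 else c y) \<in> fam_prod X U"
        using c insert.hyps(2) unfolding fam_prod_def by auto
      moreover have "i (c x) \<in> i ` U x"
        using c unfolding fam_prod_def by auto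
      ultimately show "c \<in> fams.span (B \<union> C)"
        using B C fams.span_Un by blast
    qed
    then have fin: "fams.findim (fam_prod (insert x X) U)"
      using sub B(1) C(1) unfolding fams.findim_def by blast
    have "{c\<in>fam_prod (insert x X) U. ev c = 0} = fam_prod X U"
      using insert.hyps(2) funs.subspace_0[OF funs.findim_subspace[OF fU]]
      unfolding ev_def fam_prod_def by (auto split: if_splits)
    moreover have "ev ` fam_prod (insert x X) U = U x"
    proof
      show "ev ` fam_prod (insert x X) U \<subseteq> U x"
        unfolding ev_def fam_prod_def by auto
      show "U x \<subseteq> ev ` fam_prod (insert x X) U"
      proof
        fix f assume "f \<in> U x"
        then have "i f \<in> fam_prod (insert x X) U" "ev (i f) = f"
          using insert.prems funs.subspace_0 funs.findim_subspace
          unfolding ev_def i_def fam_prod_def by auto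
        then show "f \<in> ev ` fam_prod (insert x X) U" by (metis imageI)
      qed
    qed
    ultimately show ?case
      using fams_funs.rank_nullity[OF lev fin] IH(2) insert.hyps fin by simp
  qed
  then show "fams.findim (fam_prod X U)" "fams.dim (fam_prod X U) = (\<Sum>x\<in>X. funs.dim (U x))"
    by auto
qed

text \<open>Makes the annihilator calculus for scalar functions available for families.\<close>

lemma fams_dim_uncurry:
  fixes U :: "('x \<Rightarrow> 'y \<Rightarrow> 'k::field) set"
  assumes "fams.findim U"
  shows "funs.dim (case_prod ` U) = fams.dim U" "funs.findim (case_prod ` U)"
proof -
  have l: "Vector_Spaces.linear fam_scale fun_scale (case_prod :: ('x \<Rightarrow> 'y \<Rightarrow> 'k) \<Rightarrow> _)"
    unfolding Vector_Spaces.linear_iff using vector_space_fun_scale vector_space_fam_scale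
    by (auto simp: fun_eq_iff fun_scale_def fam_scale_def)
  show "funs.dim (case_prod ` U) = fams.dim U"
    by (rule fams_funs.dim_image_injective[OF l assms]) (auto simp: fun_eq_iff)
  show "funs.findim (case_prod ` U)"
    by (rule fams_funs.findim_image[OF l assms])
qed

section \<open>Exterior forms\<close>

lemma incidence_insert_self: "incidence v (insert v F) = (incidence v F :: 'k::field)"
proof -
  have "{u \<in> insert v F. u < v} = {u \<in> F. u < v}" by auto
  then show ?thesis unfolding incidence_def by simp
qed

lemma incidence_singleton: "incidence v {v} = (1 :: 'k::field)"
  using incidence_insert_self[of v "{}"] by (simp add: incidence_def)

lemma incidence_insert:
  assumes "finite F" "u \<notin> F"
  shows "incidence v (insert u F) = (if u < v then - incidence v F else (incidence v F :: 'k::field))"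
proof (cases "u < v")
  case True
  then have "{w \<in> insert u F. w < v} = insert u {w \<in> F. w < v}" by auto
  then show ?thesis
    unfolding incidence_def using True assms by simp
next
  case False
  then have "{w \<in> insert u F. w < v} = {w \<in> F. w < v}" by auto
  then show ?thesis
    unfolding incidence_def using False by simp
qed

lemma incidence_sqr: "incidence v F * incidence v F = (1 :: 'k::field)"
  unfolding incidence_def by (simp flip: power_add mult_2)

lemma incidence_nonzero: "incidence v F \<noteq> (0 :: 'k::field)"
  unfolding incidence_def by simp

section \<open>Interior and exterior multiplication\<close>

text \<open>A form is stored by its coefficients: \<open>w J\<close> belongs to the product of the
  basis covectors indexed by \<open>J\<close>. This is the interior product with the vector
  \<open>x\<close>, written with the sign convention of the simplicial boundary.\<close>

definition contract :: "'i::linorder set \<Rightarrow> ('i \<Rightarrow> 'k::field) \<Rightarrow> ('i set \<Rightarrow> 'k) \<Rightarrow> 'i set \<Rightarrow> 'k" where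
  "contract N x w = (\<lambda>J. \<Sum>i\<in>N - J. incidence i (insert i J) * (x i * w (insert i J)))"

text \<open>Exterior multiplication from the left by the covector \<open>c\<close>.\<close>

definition wedge :: "'i::linorder set \<Rightarrow> ('i \<Rightarrow> 'k::field) \<Rightarrow> ('i set \<Rightarrow> 'k) \<Rightarrow> 'i set \<Rightarrow> 'k" where
  "wedge N c w = (\<lambda>J. if J \<subseteq> N then \<Sum>i\<in>J. incidence i J * (c i * w (J - {i})) else 0)"

definition pairing :: "'i set \<Rightarrow> ('i \<Rightarrow> 'k::field) \<Rightarrow> ('i \<Rightarrow> 'k) \<Rightarrow> 'k" where
  "pairing N c x = (\<Sum>i\<in>N. c i * x i)"

lemma contract_add: "contract N x (w + w') = contract N x w + contract N x w'"
  by (auto simp: contract_def fun_eq_iff distrib_left sum.distrib)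

lemma contract_scale: "contract N x (fun_scale r w) = fun_scale r (contract N x w)"
  by (auto simp: contract_def fun_eq_iff fun_scale_def sum_distrib_left algebra_simps)

lemma contract_linear: "Vector_Spaces.linear fun_scale fun_scale (contract N x)"
  by (rule linear_funI) (auto simp: contract_add contract_scale)

lemma wedge_linear: "Vector_Spaces.linear fun_scale fun_scale (wedge N x)"
  by (rule linear_funI)
    (auto simp: wedge_def fun_eq_iff fun_scale_def sum_distrib_left sum.distrib algebra_simps)

lemmas contract_0 = funs_pair.linear_0[OF contract_linear]
lemmas wedge_0 = funs_pair.linear_0[OF wedge_linear]
lemmas contract_diff = funs_pair.linear_diff[OF contract_linear]
lemmas contract_sum = funs_pair.linear_sum[OF contract_linear]

lemma sum_apply_fun: "(\<Sum>x\<in>A. f x) y = (\<Sum>x\<in>A. f x y)" for f :: "'a \<Rightarrow> 'b \<Rightarrow> 'c::comm_monoid_add"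
  by (induction A rule: infinite_finite_induct) auto

lemma contract_sum_left:
  "contract N (\<lambda>i. \<Sum>v\<in>A. r v * x v i) w = (\<Sum>v\<in>A. fun_scale (r v) (contract N (x v) w))"
proof
  fix J
  have "contract N (\<lambda>i. \<Sum>v\<in>A. r v * x v i) w J =
      (\<Sum>i\<in>N - J. \<Sum>v\<in>A. r v * (incidence i (insert i J) * (x v i * w (insert i J))))"
    unfolding contract_def by (simp add: sum_distrib_left sum_distrib_right mult.assoc mult.left_commute)
  also have "\<dots> = (\<Sum>v\<in>A. r v * contract N (x v) w J)"
    unfolding contract_def by (subst sum.swap) (simp add: sum_distrib_left)
  finally show "contract N (\<lambda>i. \<Sum>v\<in>A. r v * x v i) w J =
      (\<Sum>v\<in>A. fun_scale (r v) (contract N (x v) w)) J"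
    by (simp add: sum_apply_fun fun_scale_def)
qed

text \<open>Terms with \<open>i < j\<close> cancel against those with \<open>j < i\<close>. The
  diagonal is absent and nothing is divided by two, so characteristic two is included.\<close>

lemma sum_antisym_zero:
  fixes t :: "'i::linorder \<Rightarrow> 'i \<Rightarrow> 'k::field"
  assumes "finite S" "\<And>i j. i \<in> S \<Longrightarrow> j \<in> S \<Longrightarrow> i \<noteq> j \<Longrightarrow> t i j = - t j i"
  shows "(\<Sum>i\<in>S. \<Sum>j\<in>S - {i}. t i j) = 0"
proof -
  have "(\<Sum>i\<in>S. \<Sum>j\<in>S - {i}. t i j) = (\<Sum>i\<in>S. (\<Sum>j\<in>{j\<in>S. i < j}. t i j) + (\<Sum>j\<in>{j\<in>S. j < i}. t i j))"
  proof (rule sum.cong[OF refl])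
    fix i
    have eq: "S - {i} = {j\<in>S. i < j} \<union> {j\<in>S. j < i}" by auto
    show "(\<Sum>j\<in>S - {i}. t i j) = (\<Sum>j\<in>{j\<in>S. i < j}. t i j) + (\<Sum>j\<in>{j\<in>S. j < i}. t i j)"
      unfolding eq by (rule sum.union_disjoint) (use assms(1) in auto)
  qed
  also have "\<dots> = (\<Sum>i\<in>S. \<Sum>j\<in>{j\<in>S. i < j}. t i j) + (\<Sum>i\<in>S. \<Sum>j\<in>{j\<in>S. j < i}. t i j)"
    by (simp add: sum.distrib)
  also have "(\<Sum>i\<in>S. \<Sum>j\<in>{j\<in>S. j < i}. t i j) = (\<Sum>j\<in>S. \<Sum>i\<in>{i\<in>S. j < i}. t i j)"
    by (rule sum.swap_restrict[OF assms(1,1)])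
  also have "\<dots> = (\<Sum>j\<in>S. \<Sum>i\<in>{i\<in>S. j < i}. - t j i)"
    using assms(2) by (intro sum.cong) auto
  finally show ?thesis
    by (simp add: sum_negf)
qed

lemma contract_contract_expand:
  assumes "finite J"
  shows "contract N x (contract N y w) J =
    (\<Sum>i\<in>N - J. \<Sum>j\<in>(N - J) - {i}. (incidence i J * incidence j (insert i J)) * (x i * y j * w (insert i (insert j J))))"
  unfolding contract_def incidence_insert_self sum_distrib_left
  by (intro sum.cong) (auto simp: insert_commute algebra_simps)

lemma incidence_pair_antisym:
  assumes "finite J" "i \<notin> J" "j \<notin> J" "i \<noteq> j"
  shows "incidence i J * incidence j (insert i J) = - (incidence j J * incidence i (insert j J) :: 'k::field)"
  using assms by (cases i j rule: linorder_cases) (auto simp: incidence_insert)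

text \<open>The sign rules are available only for finite \<open>J\<close>; on infinite index sets
  forms vanish, and contraction preserves this.\<close>

lemma contract_infinite:
  assumes "\<And>J. infinite J \<Longrightarrow> w J = 0" "infinite J"
  shows "contract N x w J = 0"
  unfolding contract_def using assms by (intro sum.neutral) auto

text \<open>Not a special case of anticommutation, which in characteristic two says nothing about
  squares.\<close>

lemma contract_contract_self:
  assumes "finite N" "\<And>J. infinite J \<Longrightarrow> w J = 0"
  shows "contract N x (contract N x w) = 0"
proof
  fix J
  show "contract N x (contract N x w) J = 0 J"
  proof (cases "finite J")
    case True
    have "(\<Sum>i\<in>N - J. \<Sum>j\<in>(N - J) - {i}. (incidence i J * incidence j (insert i J)) * (x i * x j * w (insert i (insert j J)))) = 0"
    proof (rule sum_antisym_zero)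
      fix i j assume "i \<in> N - J" "j \<in> N - J" "i \<noteq> j"
      then show "(incidence i J * incidence j (insert i J)) * (x i * x j * w (insert i (insert j J))) =
         - ((incidence j J * incidence i (insert j J)) * (x j * x i * w (insert j (insert i J))))"
        using incidence_pair_antisym[OF True, of i j, where 'k='b]
        by (simp add: insert_commute mult.commute mult.left_commute)
    qed (use assms in auto)
    then show ?thesis
      unfolding contract_contract_expand[OF True] by simp
  next
    case False
    then have "contract N x' (contract N y' w) J = 0" for x' y'
      by (rule contract_infinite[rotated]) (rule contract_infinite[OF assms(2)])
    then show ?thesis by simp
  qed
qed

text \<open>After symmetrising the coefficient in \<open>x\<close> and \<open>y\<close>, the double
  sum of the two products has antisymmetric summands.\<close>

lemma contract_anticommute:
  assumes "finite N" "\<And>J. infinite J \<Longrightarrow> w J = 0"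
  shows "contract N x (contract N y w) = - contract N y (contract N x w)"
proof
  fix J
  show "contract N x (contract N y w) J = (- contract N y (contract N x w)) J"
  proof (cases "finite J")
    case True
    define t where "t i j = (incidence i J * incidence j (insert i J)) *
      ((x i * y j + y i * x j) * w (insert i (insert j J)))" for i j
    have "(\<Sum>i\<in>N - J. \<Sum>j\<in>(N - J) - {i}. t i j) = 0"
    proof (rule sum_antisym_zero)
      fix i j assume "i \<in> N - J" "j \<in> N - J" "i \<noteq> j"
      then show "t i j = - t j i"
        unfolding t_def using incidence_pair_antisym[OF True, of i j, where 'k='b]
        by (simp add: insert_commute add.commute mult.commute)
    qed (use assms in auto)
    then have "contract N x (contract N y w) J + contract N y (contract N x w) J = 0"
      unfolding contract_contract_expand[OF True] t_def by (simp add: distrib_right distrib_left sum.distrib)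
    then show ?thesis
      by (simp add: eq_neg_iff_add_eq_0)
  next
    case False
    then have "contract N x' (contract N y' w) J = 0" for x' y'
      by (rule contract_infinite[rotated]) (rule contract_infinite[OF assms(2)])
    then show ?thesis by simp
  qed
qed

text \<open>The Koszul homotopy identity. It is the only relation between the two operations that is
  used: it provides the lifts through contractions and detects linear dependence.\<close>

lemma contract_wedge:
  assumes N: "finite N" and w: "w \<in> supp_in (Pow N)"
  shows "contract N x (wedge N c w) + wedge N c (contract N x w) = fun_scale (pairing N c x) w"
proof
  fix J
  show "(contract N x (wedge N c w) + wedge N c (contract N x w)) J = fun_scale (pairing N c x) w J"
  proof (cases "J \<subseteq> N")
    case True
    have fJ: "finite J"
      using True N finite_subset by blast
    \<comment> \<open>\<open>A\<close> and \<open>B\<close> are the off-diagonal parts of the two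
      products and cancel. The diagonal parts run over \<open>N - J\<close> and over
      \<open>J\<close>, and together give the full pairing.\<close>
    define A where "A = (\<Sum>i\<in>N - J. \<Sum>j\<in>J. incidence i J * incidence j (insert i J) * (x i * c j * w (insert i J - {j})))"
    define B where "B = (\<Sum>j\<in>J. \<Sum>i\<in>N - J. incidence j J * incidence i (J - {j}) * (x i * c j * w (insert i J - {j})))"
    have "A = (\<Sum>j\<in>J. \<Sum>i\<in>N - J. incidence i J * incidence j (insert i J) * (x i * c j * w (insert i J - {j})))"
      unfolding A_def by (rule sum.swap)
    also have "\<dots> = (\<Sum>j\<in>J. \<Sum>i\<in>N - J. - (incidence j J * incidence i (J - {j}) * (x i * c j * w (insert i J - {j}))))"
    proof (intro sum.cong refl)
      fix j i assume ij: "j \<in> J" "i \<in> N - J"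
      define K where "K = J - {j}"
      have J: "J = insert j K" "j \<notin> K" "finite K" "i \<notin> K" "i \<noteq> j"
        using ij fJ unfolding K_def by auto
      have "incidence i J * incidence j (insert i J) = - (incidence j J * incidence i (J - {j}) :: 'b)"
        using incidence_pair_antisym[of K j i, where 'k='b] J
        by (cases i j rule: linorder_cases) (auto simp: incidence_insert incidence_insert_self insert_commute)
      then show "incidence i J * incidence j (insert i J) * (x i * c j * w (insert i J - {j})) =
          - (incidence j J * incidence i (J - {j}) * (x i * c j * w (insert i J - {j})))"
        by simp
    qed
    also have "\<dots> = - B"
      unfolding B_def by (simp add: sum_negf)
    finally have AB: "A + B = 0" by simp
    have "contract N x (wedge N c w) J = (\<Sum>i\<in>N - J. c i * x i * w J) + A"
    proof -
      have "incidence i (insert i J) * (x i * wedge N c w (insert i J)) = c i * x i * w J +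
          (\<Sum>j\<in>J. incidence i J * incidence j (insert i J) * (x i * c j * w (insert i J - {j})))"
        if i: "i \<in> N - J" for i
      proof -
        have iJ: "i \<notin> J" "insert i J - {i} = J" using i by auto
        have "wedge N c w (insert i J) = incidence i (insert i J) * (c i * w J) +
            (\<Sum>j\<in>J. incidence j (insert i J) * (c j * w (insert i J - {j})))"
          unfolding wedge_def using True i fJ iJ by simp
        then have "incidence i (insert i J) * (x i * wedge N c w (insert i J)) =
            (incidence i (insert i J) * incidence i (insert i J)) * (c i * x i * w J) +
            incidence i (insert i J) * (x i * (\<Sum>j\<in>J. incidence j (insert i J) * (c j * w (insert i J - {j}))))"
          by (simp only: distrib_left) (simp add: algebra_simps)
        then show ?thesis
          unfolding incidence_sqr unfolding incidence_insert_self
          by (simp add: sum_distrib_left algebra_simps)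
      qed
      then show ?thesis
        unfolding contract_def A_def by (simp add: sum.distrib)
    qed
    moreover have "wedge N c (contract N x w) J = (\<Sum>j\<in>J. c j * x j * w J) + B"
    proof -
      have "incidence j J * (c j * contract N x w (J - {j})) = c j * x j * w J +
          (\<Sum>i\<in>N - J. incidence j J * incidence i (J - {j}) * (x i * c j * w (insert i J - {j})))"
        if j: "j \<in> J" for j
      proof -
        have NJ: "N - (J - {j}) = insert j (N - J)" "insert j (J - {j}) = J"
          using j True by auto
        have "contract N x w (J - {j}) = incidence j J * (x j * w J) +
            (\<Sum>i\<in>N - J. incidence i (J - {j}) * (x i * w (insert i (J - {j}))))"
          unfolding contract_def NJ(1) incidence_insert_self[of _ "J - {j}"]
          using N j NJ(2) incidence_insert_self[of j "J - {j}", where 'k='b] by simp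
        also have "(\<Sum>i\<in>N - J. incidence i (J - {j}) * (x i * w (insert i (J - {j})))) =
            (\<Sum>i\<in>N - J. incidence i (J - {j}) * (x i * w (insert i J - {j})))"
          using j by (intro sum.cong refl arg_cong2[of _ _ _ _ "(*)"] arg_cong[of _ _ w]) auto
        finally have "incidence j J * (c j * contract N x w (J - {j})) =
            (incidence j J * incidence j J) * (c j * x j * w J) +
            incidence j J * (c j * (\<Sum>i\<in>N - J. incidence i (J - {j}) * (x i * w (insert i J - {j}))))"
          by (simp only: distrib_left) (simp add: algebra_simps)
        then show ?thesis
          unfolding incidence_sqr
          by (simp add: sum_distrib_left algebra_simps)
      qed
      then show ?thesis
        unfolding wedge_def B_def using True by (simp add: sum.distrib)
    qed
    moreover have "pairing N c x = (\<Sum>i\<in>N - J. c i * x i) + (\<Sum>i\<in>J. c i * x i)"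
      unfolding pairing_def by (rule sum.subset_diff[OF True N])
    ultimately show ?thesis
      using AB by (simp add: fun_scale_def sum_distrib_left algebra_simps)
  next
    case False
    then have "w J = 0" "wedge N c (contract N x w) J = 0"
      using supp_inD[OF w, of J] by (auto simp: wedge_def)
    moreover have "contract N x (wedge N c w) J = 0"
      unfolding contract_def wedge_def using False by (intro sum.neutral) auto
    ultimately show ?thesis
      by (simp add: fun_scale_def)
  qed
qed

section \<open>Forms annihilated by the vectors of a face\<close>

definition forms :: "'i set \<Rightarrow> nat \<Rightarrow> ('i set \<Rightarrow> 'k::field) set" where
  "forms N e = supp_in {J. J \<subseteq> N \<and> card J = e}"

lemma forms_Pow: "w \<in> forms N e \<Longrightarrow> w \<in> supp_in (Pow N)"
  by (auto simp: forms_def supp_in_def)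

lemma supp_Pow_infinite: "finite N \<Longrightarrow> w \<in> supp_in (Pow N) \<Longrightarrow> infinite J \<Longrightarrow> w J = 0"
  by (rule supp_inD) (auto dest: finite_subset)

lemma forms_dim:
  assumes "finite N"
  shows "funs.findim (forms N e :: ('i set \<Rightarrow> 'k::field) set)"
    "funs.dim (forms N e :: ('i set \<Rightarrow> 'k::field) set) = card N choose e"
  using supp_in_dim[of "{J. J \<subseteq> N \<and> card J = e}", where 'k='k] assms n_subsets[OF assms, of e]
  unfolding forms_def by auto

lemma contract_forms:
  assumes N: "finite N" and w: "w \<in> forms N (Suc e)"
  shows "contract N x w \<in> forms N e"
  unfolding forms_def supp_in_def
proof (intro CollectI allI impI)
  fix J assume J: "J \<notin> {J. J \<subseteq> N \<and> card J = e}"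
  have "w (insert i J) = 0" if i: "i \<in> N - J" for i
  proof (rule supp_inD[OF w[unfolded forms_def]], rule notI)
    assume "insert i J \<in> {J. J \<subseteq> N \<and> card J = Suc e}"
    then show False
      using i J N finite_subset[of J N] by auto
  qed
  then show "contract N x w J = 0"
    unfolding contract_def by simp
qed

lemma contract_forms_0:
  assumes N: "finite N" and w: "w \<in> forms N 0"
  shows "contract N x w = 0"
proof
  fix J
  have "w (insert i J) = 0" if i: "i \<in> N - J" for i
  proof (rule supp_inD[OF w[unfolded forms_def]], rule notI)
    assume "insert i J \<in> {J. J \<subseteq> N \<and> card J = 0}"
    then show False
      using N finite_subset[of "insert i J" N] by auto
  qed
  then show "contract N x w J = 0 J"
    unfolding contract_def by simp
qed

lemma wedge_forms:
  assumes N: "finite N" and w: "w \<in> forms N e"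
  shows "wedge N x w \<in> forms N (Suc e)"
  unfolding forms_def supp_in_def
proof (intro CollectI allI impI)
  fix J assume J: "J \<notin> {J. J \<subseteq> N \<and> card J = Suc e}"
  have "w (J - {i}) = 0" if i: "i \<in> J" "J \<subseteq> N" for i
  proof (rule supp_inD[OF w[unfolded forms_def]], rule notI)
    assume "J - {i} \<in> {J. J \<subseteq> N \<and> card J = e}"
    moreover have "card J > 0"
      using i N finite_subset[of J N] by (auto simp: card_gt_0_iff)
    ultimately show False
      using i J N finite_subset[of J N] by (auto simp: card_Diff_singleton)
  qed
  then show "wedge N x w J = 0"
    unfolding wedge_def by simp
qed

text \<open>The exterior power of the space of covectors vanishing on all \<open>p v\<close>, \<open>v \<in> S\<close>.\<close>

definition kforms :: "'i::linorder set \<Rightarrow> ('v \<Rightarrow> 'i \<Rightarrow> 'k::field) \<Rightarrow> 'v set \<Rightarrow> nat \<Rightarrow> ('i set \<Rightarrow> 'k) set" where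
  "kforms N p S e = {w \<in> forms N e. \<forall>v\<in>S. contract N (p v) w = 0}"

lemma kforms_findim:
  assumes "finite N"
  shows "funs.findim (kforms N p S e :: ('i::linorder set \<Rightarrow> 'k::field) set)"
proof (rule funs.findim_subset[OF forms_dim(1)[OF assms]])
  have "funs.subspace (forms N e :: ('i set \<Rightarrow> 'k) set)"
    using forms_dim(1)[OF assms] funs.findim_subspace by blast
  then show "funs.subspace (kforms N p S e)"
    unfolding kforms_def funs.subspace_def by (auto simp: contract_0 contract_add contract_scale)
qed (auto simp: kforms_def)

text \<open>Linear independence of the vectors on \<open>F\<close>, witnessed by covectors that can
  be inserted into \<open>wedge\<close> directly.\<close>

definition dual_basis :: "'i set \<Rightarrow> ('v \<Rightarrow> 'i \<Rightarrow> 'k::field) \<Rightarrow> 'v set \<Rightarrow> ('v \<Rightarrow> 'i \<Rightarrow> 'k) \<Rightarrow> bool" where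
  "dual_basis N p F c \<longleftrightarrow> (\<forall>u\<in>F. \<forall>v\<in>F. pairing N (c u) (p v) = (if u = v then 1 else 0))"

lemma dual_basis_subset: "dual_basis N p F c \<Longrightarrow> G \<subseteq> F \<Longrightarrow> dual_basis N p G c"
  unfolding dual_basis_def by blast

lemma contract_wedge_lift:
  assumes N: "finite N" and w: "w \<in> supp_in (Pow N)"
    and "contract N x w = 0"
  shows "contract N x (wedge N c w) = fun_scale (pairing N c x) w"
  using contract_wedge[OF N w, of x c] assms(3) by (simp add: wedge_0)

text \<open>Multiplication by the dual covector of \<open>v\<close> is a section of contraction with
  \<open>p v\<close>; since this covector vanishes on the other vectors of \<open>F\<close>, their
  annihilation conditions survive.\<close>

lemma kforms_lift:
  assumes N: "finite N" and c: "dual_basis N p F c" and v: "v \<in> F" "S \<subseteq> F" "v \<notin> S"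
    and w: "w \<in> kforms N p (insert v S) e"
  shows "wedge N (c v) w \<in> kforms N p S (Suc e)" "contract N (p v) (wedge N (c v) w) = w"
proof -
  have wf: "w \<in> forms N e" and wk: "\<And>u. u \<in> insert v S \<Longrightarrow> contract N (p u) w = 0"
    using w unfolding kforms_def by auto
  have *: "contract N (p u) (wedge N (c v) w) = fun_scale (pairing N (c v) (p u)) w" if "u \<in> insert v S" for u
    by (rule contract_wedge_lift[OF N forms_Pow[OF wf] wk[OF that]])
  show "contract N (p v) (wedge N (c v) w) = w"
    using *[of v] c v unfolding dual_basis_def by (simp add: fun_scale_def)
  have "contract N (p u) (wedge N (c v) w) = 0" if "u \<in> S" for u
  proof -
    have "pairing N (c v) (p u) = 0"
      using c v that unfolding dual_basis_def by (metis subsetD)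
    then show ?thesis
      using *[of u] that by simp
  qed
  then show "wedge N (c v) w \<in> kforms N p S (Suc e)"
    using wedge_forms[OF N wf] unfolding kforms_def by auto
qed

lemma kforms_contract:
  assumes N: "finite N" and w: "w \<in> kforms N p S (Suc e)"
  shows "contract N (p v) w \<in> kforms N p (insert v S) e"
proof -
  have wf: "w \<in> forms N (Suc e)" and wk: "\<And>u. u \<in> S \<Longrightarrow> contract N (p u) w = 0"
    using w unfolding kforms_def by auto
  have inf: "\<And>J. infinite J \<Longrightarrow> w J = 0"
    using supp_Pow_infinite[OF N forms_Pow[OF wf]] .
  have "contract N (p u) (contract N (p v) w) = 0" if "u \<in> S" for u
    using contract_anticommute[OF N inf, where x = "p u" and y = "p v"] wk[OF that] by (simp add: contract_0)
  then show ?thesis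
    using contract_forms[OF N wf] contract_contract_self[OF N inf] unfolding kforms_def by auto
qed

text \<open>Contraction with \<open>p v\<close> maps the \<open>Suc e\<close>-forms for
  \<open>S\<close> onto the \<open>e\<close>-forms for \<open>insert v S\<close>, with kernel the
  \<open>Suc e\<close>-forms for \<open>insert v S\<close>. The dimensions therefore obey Pascal's
  rule.\<close>

lemma kforms_dim:
  assumes N: "finite N" and c: "dual_basis N p F c" and F: "finite F" "card F \<le> card N"
  shows "funs.dim (kforms N p F e) = (card N - card F) choose e"
  using F(1,2) c
proof (induction F arbitrary: e rule: finite_induct)
  case empty
  then show ?case
    using forms_dim(2)[OF N] unfolding kforms_def by simp
next
  case (insert v S)
  have cS: "dual_basis N p S c"
    using insert.prems(2) dual_basis_subset by blast
  have IH: "funs.dim (kforms N p S e) = (card N - card S) choose e" for e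
    using insert.IH cS insert.prems(1) insert.hyps by simp
  obtain n where n: "card N - card S = Suc n" "card N - card (insert v S) = n"
    using insert.prems(1) insert.hyps by (metis Suc_diff_le card_insert_disjoint diff_Suc_Suc)
  show ?case
  proof (induction e)
    case 0
    have "kforms N p (insert v S) 0 = kforms N p S 0"
      unfolding kforms_def using contract_forms_0[OF N] by auto
    then show ?case
      using IH[of 0] by simp
  next
    case (Suc e)
    have "funs.dim (kforms N p S (Suc e)) =
        funs.dim {w\<in>kforms N p S (Suc e). contract N (p v) w = 0} +
        funs.dim (contract N (p v) ` kforms N p S (Suc e))"
      by (rule funs_pair.rank_nullity[OF contract_linear kforms_findim[OF N]])
    also have "{w\<in>kforms N p S (Suc e). contract N (p v) w = 0} = kforms N p (insert v S) (Suc e)"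
      unfolding kforms_def by auto
    also have "contract N (p v) ` kforms N p S (Suc e) = kforms N p (insert v S) e"
    proof
      show "contract N (p v) ` kforms N p S (Suc e) \<subseteq> kforms N p (insert v S) e"
        by (rule image_subsetI) (rule kforms_contract[OF N])
      show "kforms N p (insert v S) e \<subseteq> contract N (p v) ` kforms N p S (Suc e)"
        using kforms_lift[OF N insert.prems(2) insertI1 subset_insertI insert.hyps(2)]
        by (metis image_eqI subsetI)
    qed
    finally show ?case
      using IH[of "Suc e"] Suc n by simp
  qed
qed

section \<open>The contracted volume form of a face\<close>

definition vol :: "'i set \<Rightarrow> 'i set \<Rightarrow> 'k::field" where
  "vol N = (\<lambda>J. if J = N then 1 else 0)"

text \<open>The contraction with the smallest vertex is applied last. This fixes the sign by the
  vertex order, as the orientation of faces does.\<close>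

definition omega :: "'i::linorder set \<Rightarrow> ('v::linorder \<Rightarrow> 'i \<Rightarrow> 'k::field) \<Rightarrow> 'v set \<Rightarrow> 'i set \<Rightarrow> 'k" where
  "omega N p F = foldr (\<lambda>v. contract N (p v)) (sorted_list_of_set F) (vol N)"

lemma omega_empty: "omega N p {} = vol N"
  by (simp add: omega_def)

lemma sorted_list_of_set_insert_min:
  assumes "finite A" "\<forall>a\<in>A. b < a"
  shows "sorted_list_of_set (insert b A) = b # sorted_list_of_set A"
proof -
  have "b \<notin> A" using assms(2) by auto
  moreover have "insort b (sorted_list_of_set A) = b # sorted_list_of_set A"
    using assms by (intro insort_is_Cons) auto
  ultimately show ?thesis
    using assms(1) by simp
qed

lemma omega_insert_min:
  assumes "finite A" "\<forall>a\<in>A. b < a"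
  shows "omega N p (insert b A) = contract N (p b) (omega N p A)"
  unfolding omega_def sorted_list_of_set_insert_min[OF assms] by simp

lemma vol_Pow: "vol N \<in> supp_in (Pow N)"
  by (auto simp: vol_def supp_in_def)

lemma contract_Pow: "w \<in> supp_in (Pow N) \<Longrightarrow> contract N x w \<in> supp_in (Pow N)"
  unfolding supp_in_def contract_def by (auto intro!: sum.neutral)

lemma omega_Pow: "omega N p F \<in> supp_in (Pow N)"
proof -
  have "foldr (\<lambda>v. contract N (p v)) vs (vol N) \<in> supp_in (Pow N)" for vs
    by (induction vs) (auto simp: vol_Pow contract_Pow)
  then show ?thesis
    unfolding omega_def .
qed

text \<open>Moving \<open>p v\<close> past the contractions with the smaller vertices costs one sign
  each, which is precisely the incidence number. Exterior signs thus agree with simplicial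
  ones.\<close>

lemma contract_omega:
  assumes N: "finite N" and "finite G" "v \<notin> G"
  shows "contract N (p v) (omega N p G) = fun_scale (incidence v G) (omega N p (insert v G))"
  using assms(2,3)
proof (induction G rule: finite_linorder_min_induct)
  case empty
  show ?case
    using omega_insert_min[of "{}" v N p] by (simp add: incidence_def fun_scale_def)
next
  case (insert b A)
  show ?case
  proof (cases "v < b")
    case True
    then have "incidence v (insert b A) = (1 :: 'c)"
      using insert.hyps(2) incidence_def[of v "insert b A"] True
      by (metis (no_types, lifting) Collect_empty_eq card.empty insert_iff less_asym' order_less_trans power_0)
    moreover have "omega N p (insert v (insert b A)) = contract N (p v) (omega N p (insert b A))"
      using True insert.hyps by (intro omega_insert_min) auto
    ultimately show ?thesis
      by (simp add: fun_scale_def)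
  next
    case False
    then have bv: "b < v" "v \<notin> A"
      using insert.prems by auto
    have "contract N (p v) (omega N p (insert b A)) = - contract N (p b) (contract N (p v) (omega N p A))"
      unfolding omega_insert_min[OF insert.hyps(1,2)]
      by (rule contract_anticommute[OF N supp_Pow_infinite[OF N omega_Pow]])
    also have "\<dots> = fun_scale (- incidence v A) (contract N (p b) (omega N p (insert v A)))"
      using insert.IH[OF bv(2)] by (simp add: contract_scale)
    also have "contract N (p b) (omega N p (insert v A)) = omega N p (insert b (insert v A))"
      using bv insert.hyps by (intro omega_insert_min[symmetric]) auto
    also have "- incidence v A = (incidence v (insert b A) :: 'c)"
      using bv insert.hyps by (subst incidence_insert) auto
    finally show ?thesis
      by (simp add: insert_commute)
  qed
qed

lemma contract_omega_mem:
  assumes N: "finite N" and "finite G" "v \<in> G"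
  shows "contract N (p v) (omega N p G) = 0"
proof -
  have "fun_scale (incidence v (G - {v})) (contract N (p v) (omega N p G)) =
      contract N (p v) (contract N (p v) (omega N p (G - {v})))"
    using contract_omega[OF N, of "G - {v}" v p] assms by (simp add: contract_scale insert_absorb)
  also have "\<dots> = 0"
    by (rule contract_contract_self[OF N supp_Pow_infinite[OF N omega_Pow]])
  finally show ?thesis
    using incidence_nonzero[of v "G - {v}", where 'k='c] by simp
qed

lemma omega_forms:
  assumes N: "finite N" and "finite F" "card F \<le> card N"
  shows "omega N p F \<in> forms N (card N - card F)"
  using assms(2,3)
proof (induction F rule: finite_linorder_min_induct)
  case empty
  show ?case
    unfolding omega_empty forms_def supp_in_def vol_def by auto
next
  case (insert b A)
  have "b \<notin> A" using insert.hyps(2) by auto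
  then have "card N - card A = Suc (card N - card (insert b A))"
    using insert.prems insert.hyps by simp
  then show ?case
    unfolding omega_insert_min[OF insert.hyps(1,2)]
    using insert.IH insert.prems insert.hyps \<open>b \<notin> A\<close> by (intro contract_forms[OF N]) simp
qed

lemma omega_kforms:
  assumes "finite N" "finite F" "card F \<le> card N"
  shows "omega N p F \<in> kforms N p F (card N - card F)"
  using omega_forms[OF assms] contract_omega_mem[OF assms(1,2)] unfolding kforms_def by blast

text \<open>Every covector kills the top form, and one that vanishes on the contracted vectors
  anticommutes with their contractions.\<close>

lemma wedge_omega:
  fixes c :: "'i::linorder \<Rightarrow> 'b::field"
  assumes N: "finite N" and "finite F" and c: "\<And>v. v \<in> F \<Longrightarrow> pairing N c (p v) = 0"
  shows "wedge N c (omega N p F) = 0"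
  using assms(2) c
proof (induction F rule: finite_linorder_min_induct)
  case empty
  have "vol N (J - {i}) = (0 :: 'b)" if "J \<subseteq> N" "i \<in> J" for J i
    using that unfolding vol_def by auto
  then have "wedge N c (vol N) J = 0" for J
    unfolding wedge_def by simp
  then show ?case
    unfolding omega_empty by auto
next
  case (insert b A)
  have "wedge N c (omega N p A) = 0"
    using insert by blast
  moreover have "pairing N c (p b) = 0"
    using insert.prems by simp
  ultimately show ?case
    using contract_wedge[OF N omega_Pow, of "p b" c p A]
    unfolding omega_insert_min[OF insert.hyps(1,2)] by (simp add: contract_0)
qed

text \<open>The contracted volume form remembers the span of its vectors: contraction with
  \<open>x\<close> can vanish only if \<open>x\<close> is killed by every covector that kills the
  span.\<close>

lemma pairing_zero_of_contract_omega:
  assumes N: "finite N" and F: "finite F" and c: "\<And>v. v \<in> F \<Longrightarrow> pairing N c (p v) = 0"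
    and nz: "omega N p F \<noteq> 0" and x: "contract N x (omega N p F) = 0"
  shows "pairing N c x = 0"
proof -
  have "wedge N c (omega N p F) = 0"
    by (rule wedge_omega[OF N F c])
  then have "fun_scale (pairing N c x) (omega N p F) = 0"
    using contract_wedge[OF N omega_Pow, of x c p F] x by (simp add: contract_0 wedge_0)
  then show ?thesis
    using nz funs.scale_eq_0_iff by blast
qed

lemma omega_nonzero:
  assumes N: "finite N" and F: "finite F" and c: "dual_basis N p F c"
  shows "omega N p F \<noteq> 0"
  using F c
proof (induction F rule: finite_linorder_min_induct)
  case empty
  have "vol N N \<noteq> (0 :: 'c)" by (simp add: vol_def)
  then show ?case
    unfolding omega_empty by (metis zero_fun_apply)
next
  case (insert b A)
  have nz: "omega N p A \<noteq> 0"
    using insert.IH dual_basis_subset[OF insert.prems] by blast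
  have "pairing N (c b) (p v) = 0" if "v \<in> A" for v
    using insert.prems insert.hyps(2) that unfolding dual_basis_def by auto
  then have "contract N (p b) (omega N p A) = 0 \<Longrightarrow> pairing N (c b) (p b) = 0"
    using pairing_zero_of_contract_omega[OF N insert.hyps(1) _ nz] by blast
  moreover have "pairing N (c b) (p b) = 1"
    using insert.prems unfolding dual_basis_def by simp
  ultimately show ?case
    unfolding omega_insert_min[OF insert.hyps(1,2)] by (metis zero_neq_one)
qed

text \<open>With as many vectors as coordinates the form has degree zero; its one coefficient is, up
  to sign, the determinant of the vectors.\<close>

lemma omega_empty_nonzero:
  assumes N: "finite N" and F: "finite F" "card F = card N" and nz: "omega N p F \<noteq> 0"
  shows "omega N p F {} \<noteq> 0"
proof
  assume "omega N p F {} = 0"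
  moreover have "omega N p F J = 0" if "J \<noteq> {}" for J
  proof -
    have "J \<notin> {J. J \<subseteq> N \<and> card J = 0}"
      using that finite_subset[OF _ N, of J] by auto
    then show ?thesis
      using omega_forms[OF N F(1), of p] F(2) supp_inD unfolding forms_def by fastforce
  qed
  ultimately have "omega N p F J = 0" for J
    by (cases "J = {}") auto
  then show False
    using nz by auto
qed

text \<open>Cramer's rule: the covector for \<open>u\<close> has the cofactors of \<open>u\<close>
  as entries, read off from the form of \<open>F - {u}\<close>, divided by the determinant
  \<open>D\<close>.\<close>

lemma dual_basis_of_omega:
  assumes N: "finite N" and F: "finite F" and nz: "omega N p F {} \<noteq> 0"
  shows "\<exists>c. dual_basis N p F c"
proof -
  define D where "D = omega N p F {}"
  have D: "D \<noteq> 0"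
    using nz unfolding D_def .
  define c where "c u i = incidence u (F - {u}) * omega N p (F - {u}) {i} / D" for u i
  have cx: "pairing N (c u) x = incidence u (F - {u}) * contract N x (omega N p (F - {u})) {} / D" for u x
    unfolding pairing_def c_def contract_def
    by (simp add: incidence_singleton sum_distrib_left sum_divide_distrib algebra_simps)
  have "dual_basis N p F c"
    unfolding dual_basis_def
  proof (intro ballI)
    fix u v assume uv: "u \<in> F" "v \<in> F"
    show "pairing N (c u) (p v) = (if u = v then 1 else 0)"
    proof (cases "u = v")
      case True
      have "contract N (p u) (omega N p (F - {u})) = fun_scale (incidence u (F - {u})) (omega N p F)"
        using contract_omega[OF N, of "F - {u}" u p] F uv by (simp add: insert_absorb)
      then have "pairing N (c u) (p u) = (incidence u (F - {u}) * incidence u (F - {u})) * D / D"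
        unfolding cx by (simp add: fun_scale_def D_def)
      then show ?thesis
        using True D by (simp add: incidence_sqr)
    next
      case False
      then have "contract N (p v) (omega N p (F - {u})) = 0"
        using uv F by (intro contract_omega_mem[OF N]) auto
      then show ?thesis
        using False unfolding cx by simp
    qed
  qed
  then show ?thesis by blast
qed

section \<open>Relative simplicial chains\<close>

lemma simplicial_complexD:
  assumes "simplicial_complex \<Delta>"
  shows "finite \<Delta>" "{} \<in> \<Delta>" "\<And>F. F \<in> \<Delta> \<Longrightarrow> finite F" "\<And>F G. F \<in> \<Delta> \<Longrightarrow> G \<subseteq> F \<Longrightarrow> G \<in> \<Delta>"
  using assms unfolding simplicial_complex_def by blast+

lemma finite_vertices: "simplicial_complex \<Delta> \<Longrightarrow> finite (vertices \<Delta>)"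
  unfolding vertices_def simplicial_complex_def by blast

lemma face_subset_vertices: "F \<in> \<Delta> \<Longrightarrow> F \<subseteq> vertices \<Delta>"
  unfolding vertices_def by blast

section \<open>Chains supported on the faces over a given face\<close>

text \<open>The boundary of chains relative to the subcomplex of faces not containing
  \<open>G\<close>. The vertex set is a parameter so that a skeleton can be compared with the whole
  complex without changing the operator.\<close>

definition rbd :: "'v::linorder set \<Rightarrow> 'v set \<Rightarrow> ('v set \<Rightarrow> 'k::field) \<Rightarrow> 'v set \<Rightarrow> 'k" where
  "rbd V G z = (\<lambda>H. if G \<subseteq> H then \<Sum>v\<in>V - H. incidence v (insert v H) * z (insert v H) else 0)"

text \<open>Graded by cardinality, one more than the dimension, so the empty face sits at
  \<open>q = 0\<close> and no negative degrees occur.\<close>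

definition faces_over :: "'v set set \<Rightarrow> 'v set \<Rightarrow> nat \<Rightarrow> 'v set set" where
  "faces_over \<Delta> G q = {F\<in>\<Delta>. G \<subseteq> F \<and> card F = q}"

lemma finite_faces_over: "simplicial_complex \<Delta> \<Longrightarrow> finite (faces_over \<Delta> G q)"
  unfolding faces_over_def simplicial_complex_def by simp

lemma boundary_eq_rbd: "boundary \<Delta> = rbd (vertices \<Delta>) {}"
  by (auto simp: boundary_def rbd_def fun_eq_iff)

lemma rbd_linear: "Vector_Spaces.linear fun_scale fun_scale (rbd V G)"
  by (rule linear_funI)
    (auto simp: rbd_def fun_eq_iff fun_scale_def sum_distrib_left distrib_left sum.distrib
      mult.left_commute)

lemma chains_eq_supp_in: "chains \<Delta> i = supp_in {F\<in>\<Delta>. int (card F) - 1 = i}"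
  unfolding chains_def supp_in_def by auto

text \<open>The boundary is contraction with the all-ones vector, restricted to faces over
  \<open>G\<close>.\<close>

lemma rbd_rbd:
  assumes "finite V" "\<And>F. infinite F \<Longrightarrow> z F = 0"
  shows "rbd V G (rbd V G z) = 0"
proof
  fix H
  have "rbd V G (rbd V G z) H = (if G \<subseteq> H then contract V (\<lambda>_. 1) (contract V (\<lambda>_. 1) z) H else 0)"
    unfolding rbd_def contract_def by (auto intro!: sum.cong)
  then show "rbd V G (rbd V G z) H = 0 H"
    using contract_contract_self[OF assms] by simp
qed

lemma rbd_supp_in:
  assumes \<Delta>: "simplicial_complex \<Delta>" and z: "z \<in> supp_in (faces_over \<Delta> G (Suc q))"
  shows "rbd V G z \<in> supp_in (faces_over \<Delta> G q)"
  unfolding supp_in_def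
proof (intro CollectI allI impI)
  fix H assume H: "H \<notin> faces_over \<Delta> G q"
  have "z (insert v H) = 0" if "G \<subseteq> H" "v \<in> V - H" for v
  proof (rule supp_inD[OF z], rule notI)
    assume "insert v H \<in> faces_over \<Delta> G (Suc q)"
    then have *: "insert v H \<in> \<Delta>" "card (insert v H) = Suc q"
      by (auto simp: faces_over_def)
    then have "finite H" "H \<in> \<Delta>"
      using simplicial_complexD(3,4)[OF \<Delta>] by (meson finite_insert subset_insertI)+
    then show False
      using * H that unfolding faces_over_def by auto
  qed
  then show "rbd V G z H = 0"
    unfolding rbd_def by simp
qed

lemma incidence_Un_disjoint:
  assumes "finite G" "finite K" "G \<inter> K = {}"
  shows "incidence v (G \<union> K) = incidence v G * (incidence v K :: 'k::field)"
proof -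
  have "{u \<in> G \<union> K. u < v} = {u \<in> G. u < v} \<union> {u \<in> K. u < v}" by auto
  moreover have "card ({u \<in> G. u < v} \<union> {u \<in> K. u < v}) = card {u \<in> G. u < v} + card {u \<in> K. u < v}"
    using assms by (intro card_Un_disjoint) auto
  ultimately show ?thesis
    unfolding incidence_def by (simp add: power_add)
qed

lemma link_simplicial_complex:
  assumes \<Delta>: "simplicial_complex \<Delta>" and G: "G \<in> \<Delta>"
  shows "simplicial_complex (link \<Delta> G)"
proof -
  have "F' \<in> link \<Delta> G" if F: "F \<in> link \<Delta> G" "F' \<subseteq> F" for F F'
  proof -
    have "G \<union> F' \<subseteq> G \<union> F" "G \<union> F \<in> \<Delta>" "F \<in> \<Delta>" "G \<inter> F = {}"
      using F unfolding link_def by auto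
    then show ?thesis
      using F(2) simplicial_complexD(4)[OF \<Delta>] unfolding link_def by blast
  qed
  moreover have "link \<Delta> G \<subseteq> \<Delta>" "{} \<in> link \<Delta> G"
    using simplicial_complexD(2)[OF \<Delta>] G unfolding link_def by auto
  ultimately show ?thesis
    using simplicial_complexD(1,3)[OF \<Delta>] finite_subset unfolding simplicial_complex_def by blast
qed

lemma mem_link_iff:
  assumes \<Delta>: "simplicial_complex \<Delta>"
  shows "H \<in> link \<Delta> G \<longleftrightarrow> G \<inter> H = {} \<and> G \<union> H \<in> \<Delta>"
  using simplicial_complexD(4)[OF \<Delta>] unfolding link_def by blast

text \<open>Up to the sign twist \<open>\<Prod>h\<in>H. incidence h G\<close>, the chains on the faces containing \<open>G\<close> are the chains of
  the link of \<open>G\<close>.\<close>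

lemma boundary_link_twist:
  fixes z :: "'v::linorder set \<Rightarrow> 'k::field"
  assumes \<Delta>: "simplicial_complex \<Delta>" and V: "finite V" "vertices \<Delta> \<subseteq> V"
    and z: "\<And>F. F \<notin> \<Delta> \<Longrightarrow> z F = 0" and K: "K \<in> link \<Delta> G"
  shows "boundary (link \<Delta> G) (\<lambda>H. if H \<in> link \<Delta> G then (\<Prod>h\<in>H. incidence h G) * z (G \<union> H) else 0) K =
    (\<Prod>h\<in>K. incidence h G) * rbd V G z (G \<union> K)"
proof -
  define A where "A = {v \<in> V - (G \<union> K). insert v (G \<union> K) \<in> \<Delta>}"
  define tw where "tw H = (\<Prod>h\<in>H. incidence h G :: 'k)" for H
  have GK: "G \<inter> K = {}" "G \<union> K \<in> \<Delta>"
    using K mem_link_iff[OF \<Delta>] by auto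
  have fin: "finite G" "finite K"
    using simplicial_complexD(3)[OF \<Delta> GK(2)] by auto
  have link: "insert v K \<in> link \<Delta> G \<longleftrightarrow> v \<in> A" if "v \<notin> K" "v \<in> V" for v
    unfolding mem_link_iff[OF \<Delta>] A_def using that GK by auto
  have "boundary (link \<Delta> G) (\<lambda>H. if H \<in> link \<Delta> G then tw H * z (G \<union> H) else 0) K =
      (\<Sum>v\<in>A. incidence v (insert v K) * (tw (insert v K) * z (G \<union> insert v K)))"
    unfolding boundary_def
  proof (rule sum.mono_neutral_cong)
    have AV: "v \<in> vertices (link \<Delta> G)" if "v \<in> A" for v
      using link[of v] that unfolding A_def vertices_def by blast
    have VV: "v \<in> V" if "v \<in> vertices (link \<Delta> G)" for v
      using that V(2) unfolding vertices_def link_def by blast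
    show "finite (vertices (link \<Delta> G) - K)"
      using VV finite_subset[OF _ V(1)] by blast
    show "finite A"
      using V(1) unfolding A_def by simp
    show "incidence i (insert i K) * (tw (insert i K) * z (G \<union> insert i K)) = 0"
      if "i \<in> A - (vertices (link \<Delta> G) - K)" for i
      using that AV unfolding A_def by auto
    show "incidence i (insert i K) * (if insert i K \<in> link \<Delta> G then tw (insert i K) * z (G \<union> insert i K) else 0) = 0"
      if "i \<in> vertices (link \<Delta> G) - K - A" for i
      using that VV link by auto
    show "incidence i (insert i K) * (if insert i K \<in> link \<Delta> G then tw (insert i K) * z (G \<union> insert i K) else 0) =
        incidence i (insert i K) * (tw (insert i K) * z (G \<union> insert i K))"
      if "i \<in> (vertices (link \<Delta> G) - K) \<inter> A" for i
      using that VV link by auto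
  qed
  also have "\<dots> = (\<Sum>v\<in>A. tw K * (incidence v (insert v (G \<union> K)) * z (insert v (G \<union> K))))"
  proof (rule sum.cong[OF refl])
    fix v assume v: "v \<in> A"
    \<comment> \<open>The sign of \<open>v\<close> in \<open>G \<union> K\<close> is the product of
      its signs in \<open>G\<close> and in \<open>K\<close>; the new factor of the twist supplies
      the former.\<close>
    have "tw (insert v K) = incidence v G * tw K"
      unfolding tw_def using v fin unfolding A_def by simp
    then show "incidence v (insert v K) * (tw (insert v K) * z (G \<union> insert v K)) =
        tw K * (incidence v (insert v (G \<union> K)) * z (insert v (G \<union> K)))"
      unfolding incidence_insert_self incidence_Un_disjoint[OF fin GK(1)] by simp
  qed
  also have "\<dots> = tw K * rbd V G z (G \<union> K)"
  proof -
    have "(\<Sum>v\<in>A. incidence v (insert v (G \<union> K)) * z (insert v (G \<union> K))) =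
        (\<Sum>v\<in>V - (G \<union> K). incidence v (insert v (G \<union> K)) * z (insert v (G \<union> K)))"
      by (rule sum.mono_neutral_left) (use V z in \<open>auto simp: A_def\<close>)
    then show ?thesis
      unfolding rbd_def by (simp flip: sum_distrib_left)
  qed
  finally show ?thesis
    unfolding tw_def .
qed

text \<open>\<open>betti\<close> is a truncated difference, so its vanishing gives only an
  inequality of dimensions. Together with the inclusion of boundaries in cycles this forces
  equality.\<close>

lemma betti_zero_exact:
  fixes z :: "'v::linorder set \<Rightarrow> 'k::field"
  assumes \<Delta>: "simplicial_complex \<Delta>" and b: "betti TYPE('k) \<Delta> i = 0"
    and z: "z \<in> chains \<Delta> i" "boundary \<Delta> z = 0"
  obtains y where "y \<in> chains \<Delta> (i + 1)" "boundary \<Delta> y = z"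
proof -
  define Z where "Z = {c \<in> (chains \<Delta> i :: ('v set \<Rightarrow> 'k) set). boundary \<Delta> c = 0}"
  define B where "B = boundary \<Delta> ` (chains \<Delta> (i + 1) :: ('v set \<Rightarrow> 'k) set)"
  have fc: "funs.findim (chains \<Delta> j :: ('v set \<Rightarrow> 'k) set)" for j
    unfolding chains_eq_supp_in by (rule supp_in_dim(1)) (use simplicial_complexD(1)[OF \<Delta>] in simp)
  have lin: "Vector_Spaces.linear fun_scale fun_scale (boundary \<Delta> :: ('v set \<Rightarrow> 'k) \<Rightarrow> _)"
    unfolding boundary_eq_rbd by (rule rbd_linear)
  have "B = Z"
  proof (rule funs.eq_of_dim_le)
    show "funs.findim Z"
      unfolding Z_def by (rule funs_pair.findim_kernel[OF lin fc])
    show "funs.subspace B"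
      unfolding B_def using funs_pair.findim_image[OF lin fc] funs.findim_subspace by blast
    show "funs.dim Z \<le> funs.dim B"
      using b unfolding betti_def quot_dim_def Z_def B_def by simp
    show "B \<subseteq> Z"
    proof
      fix x assume "x \<in> B"
      then obtain y where y: "y \<in> chains \<Delta> (i + 1)" "x = boundary \<Delta> y"
        unfolding B_def by blast
      have inf: "y F = 0" if "infinite F" for F
        using y(1) that simplicial_complexD(3)[OF \<Delta>] unfolding chains_def by blast
      have "boundary \<Delta> x = 0"
        unfolding y(2) boundary_eq_rbd by (rule rbd_rbd[OF finite_vertices[OF \<Delta>] inf])
      moreover have "x \<in> chains \<Delta> i"
        unfolding chains_def
      proof (intro CollectI allI impI)
        fix F assume "x F \<noteq> 0"
        then obtain v where v: "v \<in> vertices \<Delta> - F" "y (insert v F) \<noteq> 0"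
          unfolding y(2) boundary_def by (metis (no_types, lifting) mult_zero_right sum.neutral)
        then have *: "insert v F \<in> \<Delta>" "int (card (insert v F)) - 1 = i + 1"
          using y(1) unfolding chains_def by blast+
        then have "finite F" "F \<in> \<Delta>"
          using simplicial_complexD(3,4)[OF \<Delta>] by (meson finite_insert subset_insertI)+
        then show "F \<in> \<Delta> \<and> int (card F) - 1 = i"
          using * v(1) by simp
      qed
      ultimately show "x \<in> Z"
        unfolding Z_def by simp
    qed
  qed
  then have "z \<in> B"
    using z unfolding Z_def by blast
  then show thesis
    using that unfolding B_def by blast
qed

definition racyclic :: "'k::field itself \<Rightarrow> 'v::linorder set \<Rightarrow> 'v set set \<Rightarrow> 'v set \<Rightarrow> nat \<Rightarrow> bool" where
  "racyclic _ V \<Delta> G q \<longleftrightarrow> (\<forall>z\<in>supp_in (faces_over \<Delta> G q) :: ('v set \<Rightarrow> 'k) set. rbd V G z = 0 \<longrightarrow>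
     z \<in> rbd V G ` supp_in (faces_over \<Delta> G (Suc q)))"

text \<open>A face of cardinality \<open>q\<close> over \<open>G\<close> leaves a face of dimension
  \<open>q - 1 - card G\<close> in the link. The twist squares to one, so it also transports a
  primitive back from the link.\<close>

lemma racyclic_of_betti_link:
  assumes \<Delta>: "simplicial_complex \<Delta>" and V: "finite V" "vertices \<Delta> \<subseteq> V" and G: "G \<in> \<Delta>"
    and b: "betti TYPE('k::field) (link \<Delta> G) (int q - 1 - int (card G)) = 0"
  shows "racyclic TYPE('k) V \<Delta> G q"
  unfolding racyclic_def
proof (intro ballI impI)
  fix z :: "'a set \<Rightarrow> 'k"
  assume z: "z \<in> supp_in (faces_over \<Delta> G q)" "rbd V G z = 0"
  define L where "L = link \<Delta> G"
  define tw where "tw H = (\<Prod>h\<in>H. incidence h G :: 'k)" for H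
  have tw: "tw H * tw H = 1" for H
    unfolding tw_def by (simp flip: prod.distrib add: incidence_sqr)
  define down where "down y = (\<lambda>H. if H \<in> L then tw H * y (G \<union> H) else 0)" for y :: "'a set \<Rightarrow> 'k"
  have L: "simplicial_complex L"
    unfolding L_def by (rule link_simplicial_complex[OF \<Delta> G])
  have finG: "finite G"
    using simplicial_complexD(3)[OF \<Delta> G] .
  have cardL: "G \<union> H \<in> \<Delta>" "card (G \<union> H) = card G + card H" "G \<inter> H = {}" if "H \<in> L" for H
    using that simplicial_complexD(3)[OF \<Delta>, of H] finG unfolding L_def link_def
    by (auto simp: card_Un_disjoint)
  have downbd: "boundary L (down y) K = tw K * rbd V G y (G \<union> K)"
    if "\<And>F. F \<notin> \<Delta> \<Longrightarrow> y F = 0" "K \<in> L" for y K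
    using boundary_link_twist[OF \<Delta> V that(1), where K = K and G = G] that(2) unfolding L_def down_def tw_def by simp
  have zF: "z F = 0" if "F \<notin> \<Delta>" for F
    using supp_inD[OF z(1)] that unfolding faces_over_def by blast
  have "boundary L (down z) = 0"
  proof
    fix K
    show "boundary L (down z) K = 0 K"
    proof (cases "K \<in> L")
      case True
      then show ?thesis
        using downbd[of z K, OF _ True] zF z(2) by simp
    next
      case False
      then have "insert v K \<notin> L" for v
        using simplicial_complexD(4)[OF L] by blast
      then show ?thesis
        unfolding boundary_def down_def by simp
    qed
  qed
  moreover have "down z \<in> chains L (int q - 1 - int (card G))"
    unfolding chains_def
  proof (intro CollectI allI impI)
    fix F assume "down z F \<noteq> 0"
    then have "F \<in> L" "z (G \<union> F) \<noteq> 0"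
      unfolding down_def by (auto split: if_splits)
    moreover have "G \<union> F \<in> faces_over \<Delta> G q"
      using supp_inD[OF z(1)] calculation(2) by blast
    ultimately show "F \<in> L \<and> int (card F) - 1 = int q - 1 - int (card G)"
      using cardL unfolding faces_over_def by auto
  qed
  ultimately obtain y' where y': "y' \<in> chains L (int q - 1 - int (card G) + 1)" "boundary L y' = down z"
    using betti_zero_exact[OF L] b unfolding L_def by metis
  define y where "y F = (if G \<subseteq> F then tw (F - G) * y' (F - G) else 0)" for F
  have ysupp: "y \<in> supp_in (faces_over \<Delta> G (Suc q))"
    unfolding supp_in_def
  proof (intro CollectI allI impI, rule ccontr)
    fix F assume F: "F \<notin> faces_over \<Delta> G (Suc q)" "y F \<noteq> 0"
    then have GF: "G \<subseteq> F" "y' (F - G) \<noteq> 0"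
      unfolding y_def by (auto split: if_splits)
    then have "F - G \<in> L" "int (card (F - G)) = int q - int (card G) + 1"
      using y'(1) unfolding chains_def by auto
    moreover have "G \<union> (F - G) = F" using GF by blast
    ultimately have "F \<in> \<Delta>" "int (card F) = int q + 1"
      using cardL[of "F - G"] by auto
    then show False
      using F(1) GF unfolding faces_over_def by auto
  qed
  have yF: "y F = 0" if "F \<notin> \<Delta>" for F
    using supp_inD[OF ysupp] that unfolding faces_over_def by blast
  have down_y: "down y = y'"
  proof
    fix H
    show "down y H = y' H"
    proof (cases "H \<in> L")
      case True
      then have "G \<union> H - G = H"
        using cardL(3) by blast
      then have "down y H = (tw H * tw H) * y' H"
        unfolding down_def y_def using True by (simp add: mult.assoc)
      then show ?thesis
        using tw by simp
    next
      case False
      then show ?thesis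
        using y'(1) unfolding down_def chains_def by auto
    qed
  qed
  have eq: "tw K * rbd V G y (G \<union> K) = tw K * z (G \<union> K)" if "K \<in> L" for K
  proof -
    have "tw K * rbd V G y (G \<union> K) = boundary L y' K"
      using downbd[of y K, OF _ that] yF down_y by simp
    then show ?thesis
      using y'(2) that unfolding down_def by simp
  qed
  have "rbd V G y = z"
  proof
    fix F
    show "rbd V G y F = z F"
    proof (cases "F \<in> \<Delta> \<and> G \<subseteq> F")
      case True
      then have FG: "G \<union> (F - G) = F" by blast
      then have "F - G \<in> L"
        using True FG mem_link_iff[OF \<Delta>, of "F - G" G] unfolding L_def by auto
      then have "tw (F - G) * (tw (F - G) * rbd V G y F) = tw (F - G) * (tw (F - G) * z F)"
        using eq[of "F - G"] FG by simp
      then show ?thesis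
        unfolding mult.assoc[symmetric] tw by simp
    next
      case False
      then have "F \<notin> faces_over \<Delta> G q"
        unfolding faces_over_def by blast
      then show ?thesis
        using supp_inD[OF z(1)] supp_inD[OF rbd_supp_in[OF \<Delta> ysupp]] by simp
    qed
  qed
  then show "z \<in> rbd V G ` supp_in (faces_over \<Delta> G (Suc q))"
    using ysupp by blast
qed

section \<open>Chains with coefficients in exterior forms\<close>

text \<open>\<open>N\<close> indexes the linear forms: \<open>p v j\<close> is the coefficient of
  the variable of \<open>v\<close> in the form with index \<open>j\<close>, and
  \<open>card N\<close> is the number \<open>d\<close>.\<close>

locale face_vectors =
  fixes \<Delta> :: "'v::linorder set set" and N :: "'i::linorder set" and p :: "'v \<Rightarrow> 'i \<Rightarrow> 'k::field"
  assumes complex: "simplicial_complex \<Delta>" and finite_N: "finite N"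
    and face_card: "F \<in> \<Delta> \<Longrightarrow> card F \<le> card N"
    and ex_dual_basis: "F \<in> \<Delta> \<Longrightarrow> \<exists>c. dual_basis N p F c"
begin

abbreviation V :: "'v set" where "V \<equiv> vertices \<Delta>"

abbreviation faces :: "'v set \<Rightarrow> nat \<Rightarrow> 'v set set" where "faces \<equiv> faces_over \<Delta>"

definition dual :: "'v set \<Rightarrow> 'v \<Rightarrow> 'i \<Rightarrow> 'k" where
  "dual F = (SOME c. dual_basis N p F c)"

lemma dual_basis_dual: "F \<in> \<Delta> \<Longrightarrow> dual_basis N p F (dual F)"
  unfolding dual_def using someI_ex[OF ex_dual_basis] by blast

lemmas finite_V = finite_vertices[OF complex]
lemmas finite_face = simplicial_complexD(3)[OF complex]
lemmas face_subset = simplicial_complexD(4)[OF complex]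

section \<open>The interpolating complexes and their boundary\<close>

text \<open>Chains over \<open>G\<close> whose coefficients are annihilated by the vectors of
  \<open>G\<close> and by those vertices of the face that lie in \<open>S\<close>. For
  \<open>S = {}\<close> the coefficients are constant and the complex is a relative chain complex;
  for \<open>G = {}\<close> and \<open>S = V\<close> it is the complex of interest.\<close>

definition X :: "'v set \<Rightarrow> 'v set \<Rightarrow> nat \<Rightarrow> nat \<Rightarrow> ('v set \<Rightarrow> 'i set \<Rightarrow> 'k) set" where
  "X G S e q = fam_prod (faces G q) (\<lambda>F. kforms N p (G \<union> (F \<inter> S)) e)"

definition fbd :: "'v set \<Rightarrow> ('v set \<Rightarrow> 'i set \<Rightarrow> 'k) \<Rightarrow> 'v set \<Rightarrow> 'i set \<Rightarrow> 'k" where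
  "fbd G c = (\<lambda>H. if G \<subseteq> H then \<Sum>v\<in>V - H. fun_scale (incidence v (insert v H)) (c (insert v H)) else 0)"

lemma X_findim: "fams.findim (X G S e q)"
  unfolding X_def by (rule fam_prod_dim(1)) (auto intro: finite_faces_over[OF complex] kforms_findim finite_N)

lemmas X_subspace = fams.findim_subspace[OF X_findim]

lemma kforms_subspace: "funs.subspace (kforms N p S e)"
  using kforms_findim[OF finite_N] funs.findim_subspace by blast

lemma X_memI:
  assumes "\<And>F. F \<in> faces G q \<Longrightarrow> c F \<in> kforms N p (G \<union> (F \<inter> S)) e"
    and "\<And>F. F \<notin> faces G q \<Longrightarrow> c F = 0"
  shows "c \<in> X G S e q"
  using assms unfolding X_def fam_prod_def by auto

lemma X_mem_kforms: "c \<in> X G S e q \<Longrightarrow> F \<in> faces G q \<Longrightarrow> c F \<in> kforms N p (G \<union> (F \<inter> S)) e"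
  unfolding X_def fam_prod_def by (metis (mono_tags, lifting) mem_Collect_eq)

lemma X_mem_zero: "c \<in> X G S e q \<Longrightarrow> F \<notin> faces G q \<Longrightarrow> c F = 0"
  unfolding X_def fam_prod_def by (metis (mono_tags, lifting) mem_Collect_eq)

text \<open>The boundary acts on each form coefficient \<open>J\<close> separately, so facts about
  scalar chains carry over.\<close>

lemma fbd_apply: "fbd G c H J = rbd V G (\<lambda>F. c F J) H"
  unfolding fbd_def rbd_def by (simp add: sum_apply_fun fun_scale_def)

lemma fbd_linear: "Vector_Spaces.linear fam_scale fam_scale (fbd G)"
proof -
  have "rbd V G (\<lambda>F. r * c F) H = r * rbd V G c H" for r H and c :: "'v set \<Rightarrow> 'k"
    using funs_pair.linear_scale[OF rbd_linear[of V G], of r c] by (simp add: fun_scale_def fun_eq_iff)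
  moreover have "rbd V G (\<lambda>F. b F + c F) H = rbd V G b H + rbd V G c H" for H and b c :: "'v set \<Rightarrow> 'k"
    using funs_pair.linear_add[OF rbd_linear[of V G], of b c] by (simp add: plus_fun_def fun_eq_iff)
  ultimately show ?thesis
    unfolding Vector_Spaces.linear_iff using vector_space_fam_scale
    by (auto simp: fun_eq_iff fbd_apply fam_scale_def)
qed

text \<open>Passing to a smaller face only drops annihilation conditions, so the coefficients of a
  face are admissible on its subfaces.\<close>

lemma fbd_mem:
  assumes c: "c \<in> X G S e (Suc q)"
  shows "fbd G c \<in> X G S e q"
proof (rule X_memI)
  fix H assume H: "H \<in> faces G q"
  have "c (insert v H) \<in> kforms N p (G \<union> (H \<inter> S)) e" for v
  proof (cases "insert v H \<in> faces G (Suc q)")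
    case True
    then show ?thesis
      using X_mem_kforms[OF c] unfolding kforms_def by blast
  next
    case False
    then show ?thesis
      using X_mem_zero[OF c] funs.subspace_0[OF kforms_subspace] by simp
  qed
  then show "fbd G c H \<in> kforms N p (G \<union> (H \<inter> S)) e"
    unfolding fbd_def
    by (auto intro!: funs.subspace_sum[OF kforms_subspace] funs.subspace_scale[OF kforms_subspace]
        funs.subspace_0[OF kforms_subspace])
next
  fix H assume H: "H \<notin> faces G q"
  have "(\<lambda>F. c F J) \<in> supp_in (faces G (Suc q))" for J
    using X_mem_zero[OF c] unfolding supp_in_def by simp
  then have "fbd G c H J = 0" for J
    unfolding fbd_apply using supp_inD[OF rbd_supp_in[OF complex]] H by blast
  then show "fbd G c H = 0" by auto
qed

lemma fbd_fbd:
  assumes c: "c \<in> X G S e q"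
  shows "fbd G (fbd G c) = 0"
proof (intro ext)
  fix H J
  have "c F J = 0" if "infinite F" for F
  proof -
    have "F \<notin> faces G q"
      using that finite_face unfolding faces_over_def by blast
    then show ?thesis
      using X_mem_zero[OF c] by simp
  qed
  then have "rbd V G (rbd V G (\<lambda>F. c F J)) = 0"
    by (rule rbd_rbd[OF finite_V])
  then show "fbd G (fbd G c) H J = 0 H J"
    unfolding fbd_apply by simp
qed

definition iota :: "'v \<Rightarrow> ('v set \<Rightarrow> 'i set \<Rightarrow> 'k) \<Rightarrow> 'v set \<Rightarrow> 'i set \<Rightarrow> 'k" where
  "iota v c = (\<lambda>F. if v \<in> F then contract N (p v) (c F) else 0)"

text \<open>Above a face containing \<open>v\<close> all faces contain \<open>v\<close>, so
  discarding the other faces produces no correction term.\<close>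

lemma iota_fbd: "iota v (fbd G c) = fbd (insert v G) (iota v c)"
proof
  fix H
  show "iota v (fbd G c) H = fbd (insert v G) (iota v c) H"
    unfolding iota_def fbd_def
    by (auto simp: contract_0 contract_sum contract_scale intro!: sum.cong)
qed

lemma iota_diff: "iota v (b - c) = iota v b - iota v c"
  unfolding iota_def by (auto simp: fun_eq_iff contract_diff)

lemma iota_mem:
  assumes c: "c \<in> X G S (Suc e) q"
  shows "iota v c \<in> X (insert v G) S e q"
proof (rule X_memI)
  fix F assume F: "F \<in> faces (insert v G) q"
  then have "c F \<in> kforms N p (G \<union> (F \<inter> S)) (Suc e)"
    using X_mem_kforms[OF c] unfolding faces_over_def by blast
  then have "contract N (p v) (c F) \<in> kforms N p (insert v (G \<union> (F \<inter> S))) e"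
    by (rule kforms_contract[OF finite_N])
  then show "iota v c F \<in> kforms N p (insert v G \<union> (F \<inter> S)) e"
    using F unfolding iota_def faces_over_def by simp
next
  fix F assume F: "F \<notin> faces (insert v G) q"
  show "iota v c F = 0"
  proof (cases "v \<in> F")
    case True
    then have "c F = 0"
      using F X_mem_zero[OF c, of F] unfolding faces_over_def by auto
    then show ?thesis
      unfolding iota_def by (simp add: contract_0)
  qed (simp add: iota_def)
qed

text \<open>The lift is built face by face with the dual basis of that face. The lifts need not be
  compatible with the boundary; exactness in each degree suffices.\<close>

lemma iota_surj:
  assumes v: "v \<notin> G" "v \<notin> S" and u: "u \<in> X (insert v G) S e q"
  obtains w where "w \<in> X G S (Suc e) q" "iota v w = u"
proof
  define w where "w F = (if v \<in> F \<and> F \<in> \<Delta> then wedge N (dual F v) (u F) else 0)" for F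
  have lift: "wedge N (dual F v) (u F) \<in> kforms N p (G \<union> (F \<inter> S)) (Suc e) \<and>
      contract N (p v) (wedge N (dual F v) (u F)) = u F"
    if F: "F \<in> faces (insert v G) q" for F
  proof -
    have D: "dual_basis N p F (dual F)" "v \<in> F" "G \<union> (F \<inter> S) \<subseteq> F" "v \<notin> G \<union> (F \<inter> S)"
      using F v dual_basis_dual unfolding faces_over_def by auto
    have "u F \<in> kforms N p (insert v (G \<union> (F \<inter> S))) e"
      using X_mem_kforms[OF u F] by simp
    then show ?thesis
      using kforms_lift[OF finite_N D] by simp
  qed
  show "w \<in> X G S (Suc e) q"
  proof (rule X_memI)
    fix F assume F: "F \<in> faces G q"
    then show "w F \<in> kforms N p (G \<union> (F \<inter> S)) (Suc e)"
      using lift[of F] funs.subspace_0[OF kforms_subspace] unfolding w_def faces_over_def by auto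
  next
    fix F assume F: "F \<notin> faces G q"
    then have "u F = 0"
      using X_mem_zero[OF u, of F] unfolding faces_over_def by auto
    then show "w F = 0"
      unfolding w_def by (simp add: wedge_0)
  qed
  show "iota v w = u"
  proof
    fix F
    show "iota v w F = u F"
    proof (cases "F \<in> faces (insert v G) q")
      case True
      then show ?thesis
        using lift[of F] unfolding iota_def w_def faces_over_def by auto
    next
      case False
      then have "u F = 0"
        using X_mem_zero[OF u, of F] by simp
      then show ?thesis
        unfolding iota_def w_def by (simp add: wedge_0 contract_0)
    qed
  qed
qed

lemma X_insert_iff:
  "c \<in> X G (insert v S) e q \<longleftrightarrow> c \<in> X G S e q \<and> iota v c = 0"
proof
  assume c: "c \<in> X G (insert v S) e q"
  have "c \<in> X G S e q"
  proof (rule X_memI)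
    fix F assume "F \<in> faces G q"
    then show "c F \<in> kforms N p (G \<union> (F \<inter> S)) e"
      using X_mem_kforms[OF c] unfolding kforms_def by auto
  qed (rule X_mem_zero[OF c])
  moreover have "iota v c F = 0" for F
    using X_mem_kforms[OF c, of F] X_mem_zero[OF c, of F]
    unfolding iota_def kforms_def by (cases "F \<in> faces G q") (auto simp: contract_0)
  ultimately show "c \<in> X G S e q \<and> iota v c = 0" by auto
next
  assume c: "c \<in> X G S e q \<and> iota v c = 0"
  show "c \<in> X G (insert v S) e q"
  proof (rule X_memI)
    fix F assume F: "F \<in> faces G q"
    have "iota v c F = 0"
      using c by simp
    then have "v \<in> F \<Longrightarrow> contract N (p v) (c F) = 0"
      unfolding iota_def by simp
    then show "c F \<in> kforms N p (G \<union> (F \<inter> insert v S)) e"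
      using X_mem_kforms[OF conjunct1[OF c] F] unfolding kforms_def by auto
  qed (use c X_mem_zero in blast)
qed

definition acyclic_at :: "'v set \<Rightarrow> 'v set \<Rightarrow> nat \<Rightarrow> nat \<Rightarrow> bool" where
  "acyclic_at G S e q \<longleftrightarrow> (\<forall>z\<in>X G S e q. fbd G z = 0 \<longrightarrow> z \<in> fbd G ` X G S e (Suc q))"

text \<open>The short exact sequence of complexes \<open>X G (insert v S) (Suc e) \<rightarrow> X G S (Suc e) \<rightarrow> X (insert v G) S e\<close>,
  whose second map is contraction with \<open>p v\<close>.\<close>

lemma acyclic_insert:
  assumes v: "v \<notin> G" "v \<notin> S"
    and ac: "acyclic_at (insert v G) S e (Suc q)" "acyclic_at G S (Suc e) q"
  shows "acyclic_at G (insert v S) (Suc e) q"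
  unfolding acyclic_at_def
proof (intro ballI impI)
  fix z assume z: "z \<in> X G (insert v S) (Suc e) q" "fbd G z = 0"
  then obtain y where y: "y \<in> X G S (Suc e) (Suc q)" "z = fbd G y"
    using ac(2) X_insert_iff unfolding acyclic_at_def by blast
  have "fbd (insert v G) (iota v y) = 0"
    using z(1) y(2) X_insert_iff iota_fbd by metis
  then obtain u where u: "u \<in> X (insert v G) S e (Suc (Suc q))" "iota v y = fbd (insert v G) u"
    using ac(1) iota_mem[OF y(1)] unfolding acyclic_at_def by blast
  obtain w where w: "w \<in> X G S (Suc e) (Suc (Suc q))" "iota v w = u"
    using iota_surj[OF v u(1)] .
  \<comment> \<open>The diagram chase of the long exact sequence: subtracting the boundary of a lift
    of \<open>u\<close> moves the primitive \<open>y\<close> into the kernel of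
    \<open>iota v\<close> and leaves its boundary unchanged.\<close>
  define y' where "y' = y - fbd G w"
  have "iota v y' = 0"
    unfolding y'_def iota_diff iota_fbd w(2) u(2) by simp
  moreover have "y' \<in> X G S (Suc e) (Suc q)"
    unfolding y'_def using y(1) fbd_mem[OF w(1)] fams.subspace_diff[OF X_subspace] by blast
  ultimately have "y' \<in> X G (insert v S) (Suc e) (Suc q)"
    using X_insert_iff by blast
  moreover have "fbd G y' = z"
    unfolding y'_def fams_pair.linear_diff[OF fbd_linear] using fbd_fbd[OF w(1)] y(2) by simp
  ultimately show "z \<in> fbd G ` X G (insert v S) (Suc e) (Suc q)" by blast
qed

section \<open>Vanishing of homology\<close>

text \<open>A linear right inverse \<open>g\<close> of the scalar boundary is applied to every form
  coefficient. Linearity makes it commute with contractions, so the conditions imposed by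
  \<open>G\<close> carry over to the primitive.\<close>

lemma acyclic_base:
  assumes r: "racyclic TYPE('k) V \<Delta> G q"
  shows "acyclic_at G {} e q"
  unfolding acyclic_at_def
proof (intro ballI impI)
  fix z assume z: "z \<in> X G {} e q" "fbd G z = 0"
  obtain g where g: "range g \<subseteq> supp_in (faces G (Suc q))"
      "Vector_Spaces.linear fun_scale fun_scale g"
      "\<And>w. w \<in> rbd V G ` supp_in (faces G (Suc q)) \<Longrightarrow> rbd V G (g w) = (w :: 'v set \<Rightarrow> 'k)"
    using funs_pair.linear_exists_right_inverse_on[OF rbd_linear[of V G] supp_in_subspace[of "faces G (Suc q)"]]
    by blast
  have kf: "z F \<in> kforms N p G e" for F
  proof (cases "F \<in> faces G q")
    case True
    then show ?thesis
      using X_mem_kforms[OF z(1)] by simp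
  next
    case False
    then show ?thesis
      using X_mem_zero[OF z(1)] funs.subspace_0[OF kforms_subspace] by simp
  qed
  define y where "y F J = g (\<lambda>F'. z F' J) F" for F J
  have "y \<in> X G {} e (Suc q)"
  proof (rule X_memI)
    fix F assume F: "F \<notin> faces G (Suc q)"
    have "y F J = 0" for J
      unfolding y_def by (rule supp_inD[OF _ F]) (use g(1) in blast)
    then show "y F = 0" by auto
  next
    fix F assume "F \<in> faces G (Suc q)"
    have "y F \<in> forms N e"
      unfolding forms_def supp_in_def
    proof (intro CollectI allI impI)
      fix J assume J: "J \<notin> {J. J \<subseteq> N \<and> card J = e}"
      then have "(\<lambda>F'. z F' J) = 0"
        using kf supp_inD[OF _ J] unfolding kforms_def forms_def by (auto simp: fun_eq_iff)
      then show "y F J = 0"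
        unfolding y_def using funs_pair.linear_0[OF g(2)] by simp
    qed
    moreover have "contract N (p v) (y F) = 0" if "v \<in> G" for v
    proof
      fix J
      have "contract N (p v) (y F) J =
          (\<Sum>i\<in>N - J. fun_scale (incidence i (insert i J) * p v i) (g (\<lambda>F'. z F' (insert i J)))) F"
        unfolding contract_def y_def by (simp add: sum_apply_fun fun_scale_def mult.assoc)
      also have "\<dots> = g (\<Sum>i\<in>N - J. fun_scale (incidence i (insert i J) * p v i) (\<lambda>F'. z F' (insert i J))) F"
        by (simp add: funs_pair.linear_sum[OF g(2)] funs_pair.linear_scale[OF g(2)])
      also have "(\<Sum>i\<in>N - J. fun_scale (incidence i (insert i J) * p v i) (\<lambda>F'. z F' (insert i J))) =
          (\<lambda>F'. contract N (p v) (z F') J)"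
        unfolding contract_def by (auto simp: sum_apply_fun fun_scale_def mult.assoc)
      also have "\<dots> = 0"
        using kf that unfolding kforms_def by (auto simp: fun_eq_iff)
      finally show "contract N (p v) (y F) J = 0 J"
        using funs_pair.linear_0[OF g(2)] by (simp add: zero_fun_def)
    qed
    ultimately show "y F \<in> kforms N p (G \<union> (F \<inter> {})) e"
      unfolding kforms_def by simp
  qed
  moreover have "fbd G y = z"
  proof (intro ext)
    fix H J
    have "rbd V G (\<lambda>F. z F J) = 0"
      using z(2) by (auto simp: fun_eq_iff fbd_apply)
    moreover have "(\<lambda>F. z F J) \<in> supp_in (faces G q)"
      using X_mem_zero[OF z(1)] unfolding supp_in_def by simp
    ultimately have "rbd V G (g (\<lambda>F. z F J)) = (\<lambda>F. z F J)"
      using r g(3) unfolding racyclic_def by blast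
    then show "fbd G y H J = z H J"
      unfolding fbd_apply y_def by (simp add: fun_eq_iff)
  qed
  ultimately show "z \<in> fbd G ` X G {} e (Suc q)" by blast
qed

text \<open>The new condition is either imposed already through \<open>G\<close> or void, since
  forms of degree zero are killed by every contraction.\<close>

lemma X_insert_no_change:
  assumes "v \<in> G \<or> e = 0"
  shows "X G (insert v S) e q = X G S e q"
proof -
  have "iota v c = 0" if c: "c \<in> X G S e q" for c
  proof
    fix F
    show "iota v c F = 0 F"
      using X_mem_kforms[OF c, of F] X_mem_zero[OF c, of F] assms contract_forms_0[OF finite_N]
      unfolding iota_def kforms_def by (cases "F \<in> faces G q") (auto simp: contract_0)
  qed
  then show ?thesis
    using X_insert_iff by blast
qed

text \<open>Removing a vertex from \<open>S\<close> asks for exactness at \<open>(G, e, q)\<close>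
  and at \<open>(insert v G, e - 1, q + 1)\<close>, so \<open>q + e\<close> does not increase. A
  nonempty \<open>G\<close> then grows to size two, where only \<open>q < d\<close> is required.
  From the empty face the next stage is a single vertex at \<open>q + 1\<close>, which must itself
  stay below \<open>d - 1\<close>; hence the assumption \<open>q + 2 < d\<close>.\<close>

lemma acyclic_general:
  assumes base: "\<And>G q. G \<in> \<Delta> \<Longrightarrow> q < d \<Longrightarrow> (card G \<le> 1 \<Longrightarrow> Suc q < d) \<Longrightarrow> racyclic TYPE('k) V \<Delta> G q"
    and "finite S" "finite G" "q + e < d" "card G \<le> 1 \<Longrightarrow> Suc q < d" "card G = 0 \<Longrightarrow> e > 0 \<Longrightarrow> q + 2 < d"
  shows "acyclic_at G S e q"
  using assms(2-)
proof (induction S arbitrary: G e q rule: finite_induct)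
  case empty
  show ?case
  proof (cases "G \<in> \<Delta>")
    case True
    then show ?thesis
      using base[of G q] empty by (intro acyclic_base) auto
  next
    case False
    then have "faces G q = {}" for q
      using face_subset unfolding faces_over_def by blast
    then have "X G {} e q = {0}" for q
      unfolding X_def fam_prod_def by auto
    then show ?thesis
      unfolding acyclic_at_def using fams_pair.linear_0[OF fbd_linear] by auto
  qed
next
  case (insert v S)
  show ?case
  proof (cases "v \<in> G \<or> e = 0")
    case True
    then show ?thesis
      using insert.IH[OF insert.prems] X_insert_no_change[OF True] unfolding acyclic_at_def by simp
  next
    case False
    then obtain e' where e': "e = Suc e'" "v \<notin> G"
      by (cases e) auto
    have "acyclic_at (insert v G) S e' (Suc q)"
      using insert.prems e' by (intro insert.IH) auto
    moreover have "acyclic_at G S (Suc e') q"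
      using insert.IH[OF insert.prems] e' by simp
    ultimately show ?thesis
      using acyclic_insert[OF e'(2) insert.hyps(2)] e'(1) by blast
  qed
qed

section \<open>Euler characteristic of the fully constrained complex\<close>

definition T :: "nat \<Rightarrow> nat \<Rightarrow> ('v set \<Rightarrow> 'i set \<Rightarrow> 'k) set" where
  "T e q = X {} V e q"

definition T_cycles :: "nat \<Rightarrow> nat \<Rightarrow> ('v set \<Rightarrow> 'i set \<Rightarrow> 'k) set" where
  "T_cycles e q = {c\<in>T e q. fbd {} c = 0}"

lemma T_dim: "fams.dim (T e q) = card (faces {} q) * ((card N - q) choose e)"
proof -
  have "funs.dim (kforms N p ({} \<union> (F \<inter> V)) e) = (card N - q) choose e" if F: "F \<in> faces {} q" for F
  proof -
    have "F \<inter> V = F" "F \<in> \<Delta>" "card F = q"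
      using F face_subset_vertices unfolding faces_over_def by auto
    then show ?thesis
      using kforms_dim[OF finite_N dual_basis_dual finite_face face_card] by simp
  qed
  then show ?thesis
    unfolding T_def X_def
    by (subst fam_prod_dim(2)) (auto intro: finite_faces_over[OF complex] kforms_findim finite_N)
qed

lemma T_rank_nullity_Suc:
  "fams.dim (T e (Suc q)) = fams.dim (T_cycles e (Suc q)) + fams.dim (fbd {} ` T e (Suc q))"
  unfolding T_cycles_def T_def by (rule fams_pair.rank_nullity[OF fbd_linear X_findim])

lemma T_cycles_0: "T_cycles e 0 = T e 0"
proof -
  have "fbd {} c = 0" if c: "c \<in> T e 0" for c
  proof
    fix H
    have "c (insert v H) = 0" for v
    proof (rule X_mem_zero[OF c[unfolded T_def]], rule notI)
      assume "insert v H \<in> faces {} 0"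
      then show False
        using finite_face[of "insert v H"] unfolding faces_over_def by auto
    qed
    then show "fbd {} c H = 0 H"
      unfolding fbd_def by simp
  qed
  then show ?thesis
    unfolding T_cycles_def by blast
qed

lemma T_cycles_findim: "fams.findim (T_cycles e q)"
  unfolding T_cycles_def T_def by (rule fams_pair.findim_kernel[OF fbd_linear X_findim])

lemma T_boundaries_eq_cycles:
  assumes "acyclic_at {} V e q"
  shows "fbd {} ` T e (Suc q) = T_cycles e q"
  using assms fbd_mem fbd_fbd unfolding acyclic_at_def T_cycles_def T_def by blast

text \<open>Exactness identifies each boundary space below \<open>i\<close> with the cycle space in
  the same degree, so the alternating sum telescopes to the cycles at \<open>i\<close>.\<close>

lemma euler_sum_acyclic:
  assumes "\<And>q. q < i \<Longrightarrow> acyclic_at {} V e q"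
  shows "(\<Sum>q=0..i. (-1) ^ (i - q) * int (fams.dim (T e q))) = int (fams.dim (T_cycles e i))"
  using assms
proof (induction i)
  case 0
  then show ?case
    using T_cycles_0 by simp
next
  case (Suc i)
  have "(\<Sum>q=0..Suc i. (-1) ^ (Suc i - q) * int (fams.dim (T e q))) =
      (\<Sum>q=0..i. (-1) ^ (Suc i - q) * int (fams.dim (T e q))) + int (fams.dim (T e (Suc i)))"
    by simp
  also have "(\<Sum>q=0..i. (-1) ^ (Suc i - q) * int (fams.dim (T e q))) =
      - (\<Sum>q=0..i. (-1) ^ (i - q) * int (fams.dim (T e q)))"
    by (simp add: Suc_diff_le sum_negf)
  also have "(\<Sum>q=0..i. (-1) ^ (i - q) * int (fams.dim (T e q))) = int (fams.dim (T_cycles e i))"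
    using Suc by simp
  finally show ?case
    using T_rank_nullity_Suc[of e i] T_boundaries_eq_cycles[OF Suc.prems[of i]] by simp
qed

text \<open>Allows homology in the single degree \<open>i\<close> directly below the top; its
  dimension enters with a minus sign. This is the situation for \<open>e = 1\<close>.\<close>

lemma euler_sum_Suc:
  assumes "\<And>q. q < i \<Longrightarrow> acyclic_at {} V e q"
  shows "(\<Sum>q=0..Suc i. (-1) ^ (Suc i - q) * int (fams.dim (T e q))) =
    int (fams.dim (T_cycles e (Suc i))) + int (fams.dim (fbd {} ` T e (Suc i))) - int (fams.dim (T_cycles e i))"
proof -
  have "(\<Sum>q=0..i. (-1) ^ (Suc i - q) * int (fams.dim (T e q))) =
      - (\<Sum>q=0..i. (-1) ^ (i - q) * int (fams.dim (T e q)))"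
    by (simp add: Suc_diff_le sum_negf)
  then show ?thesis
    using euler_sum_acyclic[OF assms] T_rank_nullity_Suc[of e i] by simp
qed

end

section \<open>Monomials\<close>

abbreviation mkeys :: "('v \<Rightarrow>\<^sub>0 nat) \<Rightarrow> 'v set" where "mkeys \<equiv> Poly_Mapping.keys"
abbreviation mlookup :: "('v \<Rightarrow>\<^sub>0 nat) \<Rightarrow> 'v \<Rightarrow> nat" where "mlookup \<equiv> Poly_Mapping.lookup"
abbreviation xvar :: "'v \<Rightarrow> 'v \<Rightarrow>\<^sub>0 nat" where "xvar v \<equiv> Poly_Mapping.single v 1"

lemma mkeys_add_var: "mkeys (m + xvar v) = insert v (mkeys m)"
proof -
  have "x \<in> mkeys (m + xvar v) \<longleftrightarrow> x \<in> insert v (mkeys m)" for x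
    unfolding in_keys_iff by (simp add: lookup_add lookup_single when_def in_keys_iff)
  then show ?thesis by blast
qed

lemma mkeys_add: "mkeys (m + n) = mkeys m \<union> mkeys n"
proof -
  have "x \<in> mkeys (m + n) \<longleftrightarrow> x \<in> mkeys m \<union> mkeys n" for x
    unfolding in_keys_iff by (simp add: lookup_add in_keys_iff)
  then show ?thesis by blast
qed

lemma mono_degree_superset:
  assumes "finite A" "mkeys m \<subseteq> A"
  shows "mono_degree m = (\<Sum>x\<in>A. mlookup m x)"
  unfolding mono_degree_def
  by (rule sum.mono_neutral_left) (use assms in \<open>auto simp: in_keys_iff\<close>)

lemma mono_degree_add: "mono_degree (m + n) = mono_degree m + mono_degree n"
proof -
  have fin: "finite (mkeys m \<union> mkeys n)" by simp
  show ?thesis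
    using mono_degree_superset[OF fin, of "m + n"] mono_degree_superset[OF fin, of m]
      mono_degree_superset[OF fin, of n]
    by (simp add: mkeys_add lookup_add sum.distrib)
qed

lemma mono_degree_var: "mono_degree (xvar v) = 1"
  using mono_degree_superset[of "{v}" "xvar v"] by (simp add: lookup_single)

lemma card_mkeys_le: "card (mkeys m) \<le> mono_degree m"
proof -
  have "card (mkeys m) = (\<Sum>x\<in>mkeys m. 1)" by simp
  also have "\<dots> \<le> mono_degree m"
    unfolding mono_degree_def by (rule sum_mono) (simp add: in_keys_iff Suc_leI)
  finally show ?thesis .
qed

lemma finite_monomials:
  assumes "finite A"
  shows "finite {m. mkeys m \<subseteq> A \<and> mono_degree m = i}"
proof -
  have "finite {f. \<forall>x. (x \<in> A \<longrightarrow> f x \<in> {..i}) \<and> (x \<notin> A \<longrightarrow> f x = 0)}"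
    by (rule finite_set_of_finite_funs) (use assms in auto)
  moreover have "mlookup ` {m. mkeys m \<subseteq> A \<and> mono_degree m = i} \<subseteq>
      {f. \<forall>x. (x \<in> A \<longrightarrow> f x \<in> {..i}) \<and> (x \<notin> A \<longrightarrow> f x = 0)}"
  proof clarsimp
    fix m x assume m: "mkeys m \<subseteq> A" "i = mono_degree m"
    have "mlookup m x \<le> mono_degree m" if "x \<in> mkeys m"
      unfolding mono_degree_def using that member_le_sum[of x "mkeys m" "mlookup m"] by simp
    then show "(x \<in> A \<longrightarrow> mlookup m x \<le> mono_degree m) \<and> (x \<notin> A \<longrightarrow> mlookup m x = 0)"
      using m(1) by (cases "x \<in> mkeys m") (auto simp: in_keys_iff)
  qed
  moreover have "inj_on mlookup {m. mkeys m \<subseteq> A \<and> mono_degree m = i}"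
    by (rule inj_onI) (simp add: poly_mapping_eqI)
  ultimately show ?thesis
    using finite_imageD finite_subset by blast
qed

definition sqf :: "'v set \<Rightarrow> 'v \<Rightarrow>\<^sub>0 nat" where
  "sqf F = (\<Sum>v\<in>F. xvar v)"

lemma sqf_insert: "finite F \<Longrightarrow> v \<notin> F \<Longrightarrow> sqf (insert v F) = sqf F + xvar v"
  unfolding sqf_def by (simp add: add.commute)

lemma mkeys_sqf: "finite F \<Longrightarrow> mkeys (sqf F) = F"
proof (induction F rule: finite_induct)
  case empty
  then show ?case by (simp add: sqf_def)
next
  case (insert v F)
  then show ?case by (simp add: sqf_insert mkeys_add_var del: One_nat_def)
qed

lemma mono_degree_sqf: "finite F \<Longrightarrow> mono_degree (sqf F) = card F"
proof (induction F rule: finite_induct)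
  case empty
  then show ?case by (simp add: sqf_def mono_degree_def)
next
  case (insert v F)
  then show ?case by (simp add: sqf_insert mono_degree_add mono_degree_var del: One_nat_def)
qed

lemma lookup_sqf: "finite F \<Longrightarrow> mlookup (sqf F) v = (if v \<in> F then 1 else 0)"
proof (induction F rule: finite_induct)
  case empty
  then show ?case by (simp add: sqf_def)
next
  case (insert w F)
  then show ?case by (auto simp: sqf_insert lookup_add lookup_single when_def)
qed

text \<open>A repeated variable can be divided out once without changing the support. This gives the
  alternative for inductions on the support: squarefree, or reachable from a monomial with the same
  support.\<close>

lemma sqf_or_remove:
  obtains "m = sqf (mkeys m)" | u m' where "u \<in> mkeys m'" "mkeys m' = mkeys m" "m = m' + xvar u"
proof (cases "\<exists>u. mlookup m u \<ge> 2")
  case True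
  then obtain u where u: "mlookup m u \<ge> 2" by blast
  define m' where "m' = m - xvar u"
  have "m = m' + xvar u"
    by (rule poly_mapping_eqI) (use u in \<open>auto simp: m'_def lookup_add lookup_minus lookup_single when_def\<close>)
  moreover have "u \<in> mkeys m'"
    unfolding in_keys_iff m'_def using u by (simp add: lookup_minus lookup_single)
  ultimately show thesis
    using that(2)[of u m'] by (metis insert_absorb mkeys_add_var)
next
  case False
  have "mlookup m v = (if v \<in> mkeys m then 1 else 0)" for v
    using False in_keys_iff[of v m] by (metis One_nat_def Suc_1 less_Suc0 less_Suc_eq not_less)
  then have "m = sqf (mkeys m)"
    by (intro poly_mapping_eqI) (simp add: lookup_sqf)
  then show thesis
    using that(1) by blast
qed

section \<open>Stresses\<close>

lemma pairing_sum_right: "pairing N w (\<lambda>i. \<Sum>v\<in>A. r v * x v i) = (\<Sum>v\<in>A. r v * pairing N w (x v))"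
proof -
  have "pairing N w (\<lambda>i. \<Sum>v\<in>A. r v * x v i) = (\<Sum>i\<in>N. \<Sum>v\<in>A. r v * (w i * x v i))"
    unfolding pairing_def by (simp add: sum_distrib_left mult.left_commute)
  also have "\<dots> = (\<Sum>v\<in>A. \<Sum>i\<in>N. r v * (w i * x v i))"
    by (rule sum.swap)
  finally show ?thesis
    unfolding pairing_def by (simp add: sum_distrib_left)
qed

lemma pairing_diff_sum_left:
  "pairing N (\<lambda>i. w i - (\<Sum>v\<in>A. r v * c v i)) x = pairing N w x - (\<Sum>v\<in>A. r v * pairing N (c v) x)"
proof -
  have "(\<Sum>i\<in>N. \<Sum>v\<in>A. r v * (c v i * x i)) = (\<Sum>v\<in>A. \<Sum>i\<in>N. r v * (c v i * x i))"
    by (rule sum.swap)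
  then show ?thesis
    unfolding pairing_def by (simp add: left_diff_distrib sum_subtractf sum_distrib_left sum_distrib_right mult.assoc)
qed

context face_vectors
begin

section \<open>Squarefree coefficients determine a stress\<close>

text \<open>The vector equation at \<open>m\<close>, tested against a covector. Arbitrary covectors
  instead of coordinates are allowed so that dual bases of faces can be inserted.\<close>

definition stress_sum :: "(('v \<Rightarrow>\<^sub>0 nat) \<Rightarrow> 'k) \<Rightarrow> ('i \<Rightarrow> 'k) \<Rightarrow> ('v \<Rightarrow>\<^sub>0 nat) \<Rightarrow> 'k" where
  "stress_sum g w m = (\<Sum>v\<in>V. pairing N w (p v) * g (m + xvar v))"

definition face_monomials :: "nat \<Rightarrow> ('v \<Rightarrow>\<^sub>0 nat) set" where
  "face_monomials i = {m. mkeys m \<in> \<Delta> \<and> mono_degree m = i}"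

definition stress :: "nat \<Rightarrow> (('v \<Rightarrow>\<^sub>0 nat) \<Rightarrow> 'k) set" where
  "stress i = {g \<in> supp_in (face_monomials i). \<forall>w m. stress_sum g w m = 0}"

text \<open>A balancing condition: the sum of the vectors \<open>p v\<close> weighted by
  \<open>s (insert v G)\<close> lies in the span of the vectors of \<open>G\<close>, expressed
  through the covectors that vanish on this span.\<close>

definition sq_stress :: "nat \<Rightarrow> ('v set \<Rightarrow> 'k) set" where
  "sq_stress i = {s \<in> supp_in (faces {} i). \<forall>G\<in>\<Delta>. Suc (card G) = i \<longrightarrow>
     (\<forall>w. (\<forall>v\<in>G. pairing N w (p v) = 0) \<longrightarrow> (\<Sum>v\<in>V - G. s (insert v G) * pairing N w (p v)) = 0)}"

lemma stress_outside: "g \<in> stress i \<Longrightarrow> m \<notin> face_monomials i \<Longrightarrow> g m = 0"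
  by (rule supp_inD[of g "face_monomials i"]) (auto simp: stress_def)

lemma sq_stress_outside: "s \<in> sq_stress i \<Longrightarrow> F \<notin> faces {} i \<Longrightarrow> s F = 0"
  by (rule supp_inD[of s "faces {} i"]) (auto simp: sq_stress_def)

lemma finite_face_monomials: "finite (face_monomials i)"
  by (rule finite_subset[OF _ finite_monomials[OF finite_V, of i]])
    (auto simp: face_monomials_def face_subset_vertices vertices_def)

lemma stress_subspace: "funs.subspace (stress i)"
proof -
  have "stress_sum (b + c) w m = stress_sum b w m + stress_sum c w m" 
    "stress_sum (fun_scale r b) w m = r * stress_sum b w m" for b c w m r
    unfolding stress_sum_def by (auto simp: distrib_left sum.distrib fun_scale_def sum_distrib_left mult.left_commute)
  moreover have "stress_sum 0 w m = 0" for w m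
    unfolding stress_sum_def by simp
  ultimately show ?thesis
    using supp_in_subspace[of "face_monomials i"] unfolding stress_def funs.subspace_def by auto
qed

lemma stress_findim: "funs.findim (stress i)"
  by (rule funs.findim_subset[OF supp_in_dim(1)[OF finite_face_monomials] stress_subspace])
    (auto simp: stress_def)

text \<open>Pairing the stress equation at \<open>m'\<close> with the dual basis of the face \<open>mkeys m'\<close> expresses the
  coefficient at \<open>m' + xvar u\<close> through coefficients of larger support.\<close>

lemma stress_sum_dual:
  assumes F: "mkeys m' = F" "F \<in> \<Delta>" "u \<in> F"
  shows "stress_sum g (dual F u) m' = g (m' + xvar u) + (\<Sum>v\<in>V - F. pairing N (dual F u) (p v) * g (m' + xvar v))"
proof -
  have FV: "F \<subseteq> V" "finite F"
    using F face_subset_vertices finite_face by auto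
  have "(\<Sum>v\<in>F. pairing N (dual F u) (p v) * g (m' + xvar v)) = (\<Sum>v\<in>F. if v = u then g (m' + xvar v) else 0)"
    using dual_basis_dual[OF F(2)] F(3) unfolding dual_basis_def by (intro sum.cong) auto
  also have "\<dots> = g (m' + xvar u)"
    using F(3) FV(2) by simp
  finally show ?thesis
    unfolding stress_sum_def sum.subset_diff[OF FV(1) finite_V] by simp
qed

text \<open>Descending induction on the support: by \<open>stress_sum_dual\<close> a coefficient
  with a repeated variable is a combination of coefficients with larger support.\<close>

lemma stress_zero:
  assumes g: "g \<in> stress i" and sq: "\<And>F. F \<in> faces {} i \<Longrightarrow> g (sqf F) = 0"
  shows "g = 0"
proof -
  have "g m = 0" for m
  proof (induction "card V - card (mkeys m)" arbitrary: m rule: less_induct)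
    case less
    show ?case
    proof (cases "m \<in> face_monomials i")
      case True
      then have m: "mkeys m \<in> \<Delta>" "mono_degree m = i"
        unfolding face_monomials_def by auto
      show ?thesis
      proof (cases rule: sqf_or_remove[of m])
        case 1
        then have "card (mkeys m) = i"
          using m mono_degree_sqf[of "mkeys m"] by simp
        then show ?thesis
          using sq[of "mkeys m"] 1 m unfolding faces_over_def by simp
      next
        case (2 u m')
        define F where "F = mkeys m'"
        have F: "F \<in> \<Delta>" "u \<in> F" "F \<subseteq> V" "finite F"
          using 2 m(1) face_subset_vertices finite_face unfolding F_def by auto
        have "g (m' + xvar v) = 0" if v: "v \<in> V - F" for v
        proof (rule less.hyps)
          have "card F < card (insert v F)" "card (insert v F) \<le> card V"
            using v F by (auto intro!: card_mono[OF finite_V] simp del: card_insert_disjoint) simp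
          then show "card V - card (mkeys (m' + xvar v)) < card V - card (mkeys m)"
            unfolding mkeys_add_var 2(2)[symmetric] F_def by arith
        qed
        then have "stress_sum g (dual F u) m' = g m"
          using stress_sum_dual[of m' F u g] F 2(3) F_def by simp
        then show ?thesis
          using g unfolding stress_def by simp
      qed
    next
      case False
      then show ?thesis
        using stress_outside[OF g] by simp
    qed
  qed
  then show ?thesis by auto
qed

text \<open>A covector vanishing on \<open>G\<close> removes from the equation at the squarefree
  monomial of \<open>G\<close> all terms with a repeated variable.\<close>

lemma stress_restrict:
  assumes g: "g \<in> stress i"
  shows "(\<lambda>F. if F \<in> faces {} i then g (sqf F) else 0) \<in> sq_stress i"
proof -
  have gz: "g m = 0" if "m \<notin> face_monomials i" for m
    using stress_outside[OF g that] .
  have "(\<Sum>v\<in>V - G. (if insert v G \<in> faces {} i then g (sqf (insert v G)) else 0) * pairing N w (p v)) = 0"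
    if G: "G \<in> \<Delta>" "Suc (card G) = i" and w: "\<forall>v\<in>G. pairing N w (p v) = 0" for G w
  proof -
    have finG: "finite G" and GV: "G \<subseteq> V"
      using G(1) finite_face face_subset_vertices by auto
    have "0 = stress_sum g w (sqf G)"
      using g unfolding stress_def by simp
    also have "\<dots> = (\<Sum>v\<in>V - G. pairing N w (p v) * g (sqf G + xvar v))"
      unfolding stress_sum_def sum.subset_diff[OF GV finite_V] using w by simp
    also have "\<dots> = (\<Sum>v\<in>V - G. (if insert v G \<in> faces {} i then g (sqf (insert v G)) else 0) * pairing N w (p v))"
    proof (rule sum.cong[OF refl])
      fix v assume v: "v \<in> V - G"
      have "g (sqf (insert v G)) = 0" if "insert v G \<notin> \<Delta>"
        by (rule gz) (use that finG in \<open>simp add: face_monomials_def mkeys_sqf\<close>)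
      then show "pairing N w (p v) * g (sqf G + xvar v) =
          (if insert v G \<in> faces {} i then g (sqf (insert v G)) else 0) * pairing N w (p v)"
        using v finG G(2) unfolding faces_over_def by (auto simp: sqf_insert)
    qed
    finally show ?thesis by simp
  qed
  then show ?thesis
    unfolding sq_stress_def supp_in_def by auto
qed

section \<open>Extending balanced weights to stresses\<close>

text \<open>The operators attached to two covectors commute, like derivatives with constant
  coefficients. This is the integrability condition behind the extension below.\<close>

lemma stress_sum_symmetric:
  "(\<Sum>v\<in>V. pairing N w' (p v) * stress_sum g w (m + xvar v)) =
   (\<Sum>v\<in>V. pairing N w (p v) * stress_sum g w' (m + xvar v))"
proof -
  have "(\<Sum>v\<in>V. pairing N w' (p v) * stress_sum g w (m + xvar v)) =
      (\<Sum>v\<in>V. \<Sum>y\<in>V. pairing N w' (p v) * (pairing N w (p y) * g (m + xvar v + xvar y)))"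
    unfolding stress_sum_def by (simp add: sum_distrib_left)
  also have "\<dots> = (\<Sum>y\<in>V. \<Sum>v\<in>V. pairing N w' (p v) * (pairing N w (p y) * g (m + xvar v + xvar y)))"
    by (rule sum.swap)
  also have "\<dots> = (\<Sum>v\<in>V. pairing N w (p v) * stress_sum g w' (m + xvar v))"
    unfolding stress_sum_def by (simp add: sum_distrib_left mult.left_commute ac_simps)
  finally show ?thesis .
qed

text \<open>The equation tested against a dual covector prescribes each coefficient of support size
  \<open>k\<close> in terms of larger supports. Two points need proof: the prescription is
  independent of the variable removed, and the equations against covectors vanishing on the support
  hold by themselves. Both follow from commutation, except for squarefree monomials, where the
  second is the balancing condition.\<close>

lemma stress_extend_step:
  assumes s: "s \<in> sq_stress i" and k: "k < i"
    and gsupp: "\<And>m. g m \<noteq> 0 \<Longrightarrow> m \<in> face_monomials i \<and> Suc k \<le> card (mkeys m)"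
    and gs: "\<And>F. F \<in> faces {} i \<Longrightarrow> g (sqf F) = s F"
    and geq: "\<And>w m. Suc k \<le> card (mkeys m) \<Longrightarrow> stress_sum g w m = 0"
  obtains g' where "\<And>m. g' m \<noteq> 0 \<Longrightarrow> m \<in> face_monomials i \<and> k \<le> card (mkeys m)"
    and "\<And>F. F \<in> faces {} i \<Longrightarrow> g' (sqf F) = s F"
    and "\<And>w m. k \<le> card (mkeys m) \<Longrightarrow> stress_sum g' w m = 0"
proof
  \<comment> \<open>A repeated variable of the monomial. It exists wherever it is used, since a
    monomial of degree \<open>i\<close> with support of size \<open>k < i\<close> is not
    squarefree.\<close>
  define U where "U m = (SOME u. \<exists>m'. u \<in> mkeys m' \<and> m = m' + xvar u)" for m :: "'v \<Rightarrow>\<^sub>0 nat"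
  define g' where "g' m = (if m \<in> face_monomials i \<and> card (mkeys m) = k
     then - stress_sum g (dual (mkeys m) (U m)) (m - xvar (U m)) else g m)" for m
  show "m \<in> face_monomials i \<and> k \<le> card (mkeys m)" if "g' m \<noteq> 0" for m
    using that gsupp[of m] unfolding g'_def by (auto split: if_splits)
  show "g' (sqf F) = s F" if F: "F \<in> faces {} i" for F
  proof -
    have "card (mkeys (sqf F)) = i"
      using F finite_face unfolding faces_over_def by (simp add: mkeys_sqf)
    then show ?thesis
      using gs[OF F] k unfolding g'_def by simp
  qed
  fix w :: "'i \<Rightarrow> 'k" and m' :: "'v \<Rightarrow>\<^sub>0 nat"
  assume km: "k \<le> card (mkeys m')"
  show "stress_sum g' w m' = 0"
  proof (cases "Suc k \<le> card (mkeys m')")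
    case True
    have "g' (m' + xvar v) = g (m' + xvar v)" for v
    proof -
      have "card (mkeys m') \<le> card (mkeys (m' + xvar v))"
        unfolding mkeys_add_var by (simp add: card_insert_le)
      then show ?thesis
        using True unfolding g'_def by simp
    qed
    then show ?thesis
      using geq[OF True, of w] unfolding stress_sum_def by simp
  next
    case False
    define F where "F = mkeys m'"
    have cF: "card F = k"
      using False km unfolding F_def by simp
    show ?thesis
    proof (cases "F \<in> \<Delta> \<and> Suc (mono_degree m') = i")
      case False
      then have "m' + xvar v \<notin> face_monomials i" for v
        using face_subset[of "insert v F" F]
        unfolding face_monomials_def F_def by (auto simp: mkeys_add_var mono_degree_add mono_degree_var simp del: One_nat_def)
      then have "g' (m' + xvar v) = 0" for v
        using gsupp[of "m' + xvar v"] unfolding g'_def by auto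
      then show ?thesis
        unfolding stress_sum_def by simp
    next
      case True
      then have F: "F \<in> \<Delta>" "finite F" "F \<subseteq> V" and deg: "Suc (mono_degree m') = i"
        using finite_face face_subset_vertices by auto
      have db: "pairing N (dual F u) (p v) = (if u = v then 1 else 0)" if "u \<in> F" "v \<in> F" for u v
        using dual_basis_dual[OF F(1)] that unfolding dual_basis_def by blast
      have outside: "stress_sum g w (m'' + xvar v) = 0" if "mkeys m'' = F" "v \<in> V - F" for m'' v w
        by (rule geq) (use that cF F in \<open>simp add: mkeys_add_var del: One_nat_def\<close>)
      \<comment> \<open>For \<open>v\<close> outside \<open>F\<close> the equation at the enlarged
        support already holds, so commutation leaves only the sums over \<open>F\<close>.\<close>
      have sym: "(\<Sum>v\<in>F. pairing N w2 (p v) * stress_sum g w1 (m'' + xvar v)) =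
          (\<Sum>v\<in>F. pairing N w1 (p v) * stress_sum g w2 (m'' + xvar v))" if "mkeys m'' = F" for m'' w1 w2
        using stress_sum_symmetric[of w2 g w1 m''] outside[OF that]
        unfolding sum.subset_diff[OF F(3) finite_V] by simp
      have pick: "(\<Sum>v\<in>F. pairing N (dual F u) (p v) * f v) = f u" if "u \<in> F" for u and f :: "'v \<Rightarrow> 'k"
      proof -
        have "(\<Sum>v\<in>F. pairing N (dual F u) (p v) * f v) = (\<Sum>v\<in>F. if v = u then f v else 0)"
          using db that by (intro sum.cong) auto
        then show ?thesis
          using that F(2) by simp
      qed
      \<comment> \<open>Independence of the choice: if \<open>v\<close> and the chosen
        \<open>u\<close> differ, \<open>m' = m'' + xvar u\<close> and
        \<open>n = m'' + xvar v\<close> for a monomial \<open>m''\<close> with the same support, and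
        the commutation relation at \<open>m''\<close> compares the two prescriptions.\<close>
      have g'F: "g' (m' + xvar v) = - stress_sum g (dual F v) m'" if v: "v \<in> F" for v
      proof -
        define m where "m = m' + xvar v"
        have mF: "mkeys m = F"
          using v unfolding m_def F_def by (simp add: mkeys_add_var insert_absorb del: One_nat_def)
        have mm: "m \<in> face_monomials i"
          using mF F deg unfolding face_monomials_def m_def
          by (simp add: mono_degree_add mono_degree_var del: One_nat_def)
        define u where "u = U m"
        have "\<exists>u n. u \<in> mkeys n \<and> m = n + xvar u"
          using v m_def F_def by blast
        then have "\<exists>n. u \<in> mkeys n \<and> m = n + xvar u"
          unfolding u_def U_def by (rule someI_ex)
        then obtain n where n: "u \<in> mkeys n" "m = n + xvar u" by blast
        have nF: "mkeys n = F"
          using n mF by (metis insert_absorb mkeys_add_var)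
        have gm: "g' m = - stress_sum g (dual F u) n"
          unfolding g'_def u_def[symmetric] mF using mm cF n(2) by simp
        show ?thesis
        proof (cases "u = v")
          case True
          then show ?thesis
            using gm n(2) m_def by simp
        next
          case False
          define m'' where "m'' = n - xvar v"
          have "n = m'' + xvar v" "m' = m'' + xvar u" "mkeys m'' = F"
          proof -
            have eq: "mlookup m' x + (if x = v then 1 else 0) = mlookup n x + (if x = u then 1 else 0)" for x
              using arg_cong[OF trans[OF m_def[symmetric] n(2)], of "\<lambda>m. mlookup m x"]
              by (auto simp: lookup_add lookup_single when_def split: if_splits)
            have m'v: "mlookup m' v \<ge> 1" and nu: "mlookup n u \<ge> 1"
              using v n(1) unfolding F_def in_keys_iff by auto
            then have nv: "mlookup n v \<ge> 2" and m'u: "mlookup m' u \<ge> 2"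
              using eq[of v] eq[of u] False by auto
            show n': "n = m'' + xvar v"
              unfolding m''_def by (rule poly_mapping_eqI)
                (use nv in \<open>auto simp: lookup_add lookup_minus lookup_single when_def\<close>)
            show "m' = m'' + xvar u"
              unfolding m''_def
            proof (rule poly_mapping_eqI)
              fix x
              show "mlookup m' x = mlookup (n - xvar v + xvar u) x"
                using eq[of x] nv False
                by (auto simp: lookup_add lookup_minus lookup_single when_def split: if_splits)
            qed
            have "v \<in> mkeys m''"
              unfolding in_keys_iff m''_def using nv by (simp add: lookup_minus lookup_single)
            then show "mkeys m'' = F"
              using n' nF by (metis insert_absorb mkeys_add_var)
          qed
          moreover have "u \<in> F"
            using n(1) nF by simp
          ultimately have "stress_sum g (dual F u) n = stress_sum g (dual F v) m'"
            using sym[of m'' "dual F v" "dual F u"] pick[OF v] pick[of u] by simp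
          then show ?thesis
            using gm m_def by simp
        qed
      qed
      \<comment> \<open>Coefficients of support \<open>F\<close> do not enter these equations. For
        squarefree \<open>m'\<close> this is the balancing condition; otherwise commutation at
        \<open>m''\<close> gives a sum in which every factor \<open>pairing N w0 (p v)\<close> is
        zero.\<close>
      have perp0: "stress_sum g w0 m' = 0" if w0: "\<And>v. v \<in> F \<Longrightarrow> pairing N w0 (p v) = 0" for w0
      proof (cases rule: sqf_or_remove[of m'])
        case 1
        then have m's: "m' = sqf F" 
          unfolding F_def by simp
        then have ci: "Suc (card F) = i"
          using deg F(2) mono_degree_sqf by metis
        have "stress_sum g w0 m' = (\<Sum>v\<in>V - F. pairing N w0 (p v) * g (m' + xvar v))"
          unfolding stress_sum_def sum.subset_diff[OF F(3) finite_V] using w0 by simp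
        also have "\<dots> = (\<Sum>v\<in>V - F. s (insert v F) * pairing N w0 (p v))"
        proof (rule sum.cong[OF refl])
          fix v assume v: "v \<in> V - F"
          have m'v: "m' + xvar v = sqf (insert v F)"
            using v F(2) m's by (simp add: sqf_insert)
          show "pairing N w0 (p v) * g (m' + xvar v) = s (insert v F) * pairing N w0 (p v)"
          proof (cases "insert v F \<in> \<Delta>")
            case True
            then have "insert v F \<in> faces {} i"
              using v F(2) ci unfolding faces_over_def by simp
            then show ?thesis
              using gs m'v by simp
          next
            case False
            then have "insert v F \<notin> faces {} i" "sqf (insert v F) \<notin> face_monomials i"
              using F(2) unfolding faces_over_def face_monomials_def by (auto simp: mkeys_sqf)
            then have "s (insert v F) = 0" "g (sqf (insert v F)) = 0"
              using sq_stress_outside[OF s] gsupp by blast+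
            then show ?thesis
              using m'v by simp
          qed
        qed
        also have "\<dots> = 0"
          using s F(1) ci w0 unfolding sq_stress_def by blast
        finally show ?thesis .
      next
        case (2 u m'')
        have "mkeys m'' = F" "u \<in> F"
          using 2 unfolding F_def by auto
        then have "stress_sum g w0 (m'' + xvar u) = 0"
          using sym[of m'' "dual F u" w0] pick[of u] w0 by simp
        then show ?thesis
          using 2(3) by simp
      qed
      \<comment> \<open>The part of \<open>w\<close> that vanishes on the vectors of
        \<open>F\<close>; the rest is a combination of dual covectors, which \<open>g'F\<close>
        takes care of.\<close>
      define w0 where "w0 = (\<lambda>i. w i - (\<Sum>v\<in>F. pairing N w (p v) * dual F v i))"
      have w0: "pairing N w0 x = pairing N w x - (\<Sum>v\<in>F. pairing N w (p v) * pairing N (dual F v) x)" for x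
        unfolding w0_def by (rule pairing_diff_sum_left)
      have "pairing N w0 (p u) = 0" if "u \<in> F" for u
      proof -
        have "(\<Sum>v\<in>F. pairing N w (p v) * pairing N (dual F v) (p u)) = (\<Sum>v\<in>F. if v = u then pairing N w (p v) else 0)"
          using db that by (intro sum.cong) auto
        then show ?thesis
          unfolding w0 using that F(2) by simp
      qed
      then have "stress_sum g w0 m' = 0"
        by (rule perp0)
      moreover have "stress_sum g w0 m' = stress_sum g w m' - (\<Sum>v\<in>F. pairing N w (p v) * stress_sum g (dual F v) m')"
      proof -
        have "(\<Sum>x\<in>V. \<Sum>v\<in>F. pairing N w (p v) * (pairing N (dual F v) (p x) * g (m' + xvar x))) =
            (\<Sum>v\<in>F. \<Sum>x\<in>V. pairing N w (p v) * (pairing N (dual F v) (p x) * g (m' + xvar x)))"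
          by (rule sum.swap)
        then show ?thesis
          unfolding stress_sum_def w0
          by (simp add: left_diff_distrib sum_subtractf sum_distrib_left sum_distrib_right mult.assoc)
      qed
      moreover have "stress_sum g w m' = (\<Sum>v\<in>V - F. pairing N w (p v) * g (m' + xvar v))"
      proof -
        have "g (m' + xvar v) = 0" if "v \<in> F" for v
        proof -
          have "mkeys (m' + xvar v) = F"
            using that unfolding F_def by (simp add: mkeys_add_var insert_absorb del: One_nat_def)
          then show ?thesis
            using gsupp[of "m' + xvar v"] cF by auto
        qed
        then show ?thesis
          unfolding stress_sum_def sum.subset_diff[OF F(3) finite_V] by simp
      qed
      moreover have "g' (m' + xvar v) = g (m' + xvar v)" if "v \<in> V - F" for v
      proof -
        have "card (mkeys (m' + xvar v)) = Suc k"
          using that cF F(2) unfolding mkeys_add_var F_def by simp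
        then show ?thesis
          unfolding g'_def by simp
      qed
      then have "stress_sum g' w m' = (\<Sum>v\<in>V - F. pairing N w (p v) * g (m' + xvar v)) -
          (\<Sum>v\<in>F. pairing N w (p v) * stress_sum g (dual F v) m')"
        unfolding stress_sum_def[of g'] sum.subset_diff[OF F(3) finite_V] using g'F by (simp add: sum_negf)
      ultimately show ?thesis by simp
    qed
  qed
qed

text \<open>After \<open>j\<close> rounds the equations hold for all supports of size at least
  \<open>i - j\<close>; at \<open>j = i\<close> no restriction is left.\<close>

lemma stress_extend:
  assumes s: "s \<in> sq_stress i"
  obtains g where "g \<in> stress i" "\<And>F. F \<in> faces {} i \<Longrightarrow> g (sqf F) = s F"
proof -
  have "\<exists>g. (\<forall>m. g m \<noteq> 0 \<longrightarrow> m \<in> face_monomials i \<and> i - j \<le> card (mkeys m)) \<and>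
      (\<forall>F\<in>faces {} i. g (sqf F) = s F) \<and>
      (\<forall>w m. i - j \<le> card (mkeys m) \<longrightarrow> stress_sum g w m = 0)" if "j \<le> i" for j
    using that
  proof (induction j)
    case 0
    define g where "g m = (if m \<in> face_monomials i \<and> card (mkeys m) = i then s (mkeys m) else 0)" for m
    have "g (sqf F) = s F" if F: "F \<in> faces {} i" for F
      using that finite_face unfolding g_def face_monomials_def faces_over_def
      by (simp add: mkeys_sqf mono_degree_sqf)
    \<comment> \<open>A support of size at least \<open>i\<close> forces degree at least
      \<open>i\<close>, so after multiplication by a variable the degree exceeds
      \<open>i\<close>.\<close>
    moreover have "stress_sum g w m = 0" if "i \<le> card (mkeys m)" for w m
    proof -
      have "mono_degree (m + xvar v) \<noteq> i" for v
        using card_mkeys_le[of m] that by (simp add: mono_degree_add mono_degree_var del: One_nat_def)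
      then have "g (m + xvar v) = 0" for v
        unfolding g_def face_monomials_def by simp
      then show ?thesis
        unfolding stress_sum_def by simp
    qed
    moreover have "\<forall>m. g m \<noteq> 0 \<longrightarrow> m \<in> face_monomials i \<and> i \<le> card (mkeys m)"
      unfolding g_def by auto
    ultimately show ?case by auto
  next
    case (Suc j)
    then obtain g where g: "\<And>m. g m \<noteq> 0 \<Longrightarrow> m \<in> face_monomials i \<and> i - j \<le> card (mkeys m)"
      "\<And>F. F \<in> faces {} i \<Longrightarrow> g (sqf F) = s F"
      "\<And>w m. i - j \<le> card (mkeys m) \<Longrightarrow> stress_sum g w m = 0"
      by auto
    have ij: "i - j = Suc (i - Suc j)" "i - Suc j < i"
      using Suc.prems by auto
    obtain g' where "\<And>m. g' m \<noteq> 0 \<Longrightarrow> m \<in> face_monomials i \<and> i - Suc j \<le> card (mkeys m)"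
      "\<And>F. F \<in> faces {} i \<Longrightarrow> g' (sqf F) = s F"
      "\<And>w m. i - Suc j \<le> card (mkeys m) \<Longrightarrow> stress_sum g' w m = 0"
      using stress_extend_step[OF s ij(2), of g] g unfolding ij(1) by metis
    then show ?case by blast
  qed
  from this[of i] obtain g where g: "\<And>m. g m \<noteq> 0 \<Longrightarrow> m \<in> face_monomials i"
      "\<And>F. F \<in> faces {} i \<Longrightarrow> g (sqf F) = s F" "\<And>w m. stress_sum g w m = 0"
    by auto
  then have "g \<in> stress i"
    unfolding stress_def supp_in_def by blast
  then show thesis
    using that g(2) by blast
qed

lemma dim_stress: "funs.dim (stress i) = funs.dim (sq_stress i)" "funs.findim (sq_stress i)"
proof -
  define r where "r = (\<lambda>(g :: ('v \<Rightarrow>\<^sub>0 nat) \<Rightarrow> 'k) F. if F \<in> faces {} i then g (sqf F) else 0)"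
  have lin: "Vector_Spaces.linear fun_scale fun_scale r"
    by (rule linear_funI) (auto simp: r_def fun_eq_iff fun_scale_def)
  have im: "r ` stress i = sq_stress i"
  proof
    show "r ` stress i \<subseteq> sq_stress i"
      using stress_restrict unfolding r_def by blast
    show "sq_stress i \<subseteq> r ` stress i"
    proof
      fix s assume s: "s \<in> sq_stress i"
      obtain g where g: "g \<in> stress i" "\<And>F. F \<in> faces {} i \<Longrightarrow> g (sqf F) = s F"
        using stress_extend[OF s] by blast
      have "F \<notin> faces {} i \<Longrightarrow> s F = 0" for F
        using sq_stress_outside[OF s] .
      then have "r g = s"
        unfolding r_def using g(2) by (auto simp: fun_eq_iff)
      then show "s \<in> r ` stress i"
        using g(1) by blast
    qed
  qed
  have "funs.dim (r ` stress i) = funs.dim (stress i)"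
  proof (rule funs_pair.dim_image_injective[OF lin stress_findim])
    fix g assume g: "g \<in> stress i" "r g = 0"
    have "g (sqf F) = 0" if "F \<in> faces {} i" for F
      using fun_cong[OF g(2), of F] that unfolding r_def by simp
    then show "g = 0"
      using stress_zero[OF g(1)] by blast
  qed
  then show "funs.dim (stress i) = funs.dim (sq_stress i)"
    using im by simp
  show "funs.findim (sq_stress i)"
    using funs_pair.findim_image[OF lin stress_findim[of i]] im by simp
qed

section \<open>Balanced weights as top cycles\<close>

text \<open>Both sides say that, on the coordinates in \<open>N\<close>, \<open>x\<close> is a
  combination of the vectors of \<open>G\<close>.\<close>

lemma contract_omega_zero_iff:
  assumes G: "G \<in> \<Delta>"
  shows "contract N x (omega N p G) = 0 \<longleftrightarrow>
    (\<forall>w. (\<forall>v\<in>G. pairing N w (p v) = 0) \<longrightarrow> pairing N w x = 0)"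
proof
  note finG = finite_face[OF G]
  assume "contract N x (omega N p G) = 0"
  then show "\<forall>w. (\<forall>v\<in>G. pairing N w (p v) = 0) \<longrightarrow> pairing N w x = 0"
    using pairing_zero_of_contract_omega[OF finite_N finG _ omega_nonzero[OF finite_N finG dual_basis_dual[OF G]]]
    by blast
next
  note finG = finite_face[OF G]
  assume w: "\<forall>w. (\<forall>v\<in>G. pairing N w (p v) = 0) \<longrightarrow> pairing N w x = 0"
  have xi: "x i = (\<Sum>v\<in>G. pairing N (dual G v) x * p v i)" if i: "i \<in> N" for i
  proof -
    define e where "e j = (if j = i then 1 else 0 :: 'k)" for j
    have e: "pairing N e y = y i" for y
    proof -
      have "pairing N e y = (\<Sum>j\<in>N. if j = i then y j else 0)"
        unfolding pairing_def e_def by (intro sum.cong) auto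
      then show ?thesis
        using i finite_N by simp
    qed
    \<comment> \<open>The coordinate covector minus its projection to the dual basis. It vanishes on
      the vectors of \<open>G\<close>, hence on \<open>x\<close>, which yields the
      \<open>i\<close>-th coordinate of the expansion of \<open>x\<close>.\<close>
    define w0 where "w0 = (\<lambda>j. e j - (\<Sum>v\<in>G. p v i * dual G v j))"
    have w0: "pairing N w0 y = y i - (\<Sum>v\<in>G. p v i * pairing N (dual G v) y)" for y
      unfolding w0_def pairing_diff_sum_left e ..
    have "pairing N w0 (p u) = 0" if "u \<in> G" for u
    proof -
      have "(\<Sum>v\<in>G. p v i * pairing N (dual G v) (p u)) = (\<Sum>v\<in>G. if v = u then p v i else 0)"
        using dual_basis_dual[OF G] that unfolding dual_basis_def by (intro sum.cong) auto
      then show ?thesis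
        unfolding w0 using that finG by simp
    qed
    then have "pairing N w0 x = 0"
      using w by blast
    then show ?thesis
      unfolding w0 by (simp add: mult.commute)
  qed
  have "contract N x (omega N p G) = contract N (\<lambda>i. \<Sum>v\<in>G. pairing N (dual G v) x * p v i) (omega N p G)"
    unfolding contract_def using xi by auto
  also have "\<dots> = (\<Sum>v\<in>G. fun_scale (pairing N (dual G v) x) (contract N (p v) (omega N p G)))"
    by (rule contract_sum_left)
  also have "\<dots> = 0"
    by (intro sum.neutral ballI) (simp add: contract_omega_mem[OF finite_N finG])
  finally show "contract N x (omega N p G) = 0" .
qed

text \<open>At a face of size \<open>i\<close> the coefficient space is a line spanned by
  \<open>omega N p F\<close>. By \<open>contract_omega\<close> the boundary at \<open>G\<close> is
  the form of \<open>G\<close> contracted with the weighted sum of vectors, so cycles are exactly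
  the balanced weights.\<close>

lemma dim_T_cycles_top:
  assumes i: "i \<le> card N"
  shows "fams.dim (T_cycles (card N - i) i) = funs.dim (stress i)"
proof -
  define e where "e = card N - i"
  define h where "h = (\<lambda>(s :: 'v set \<Rightarrow> 'k) F. fun_scale (s F) (omega N p F))"
  have lin: "Vector_Spaces.linear fun_scale fam_scale h"
    unfolding Vector_Spaces.linear_iff using vector_space_fun_scale vector_space_fam_scale
    by (auto simp: h_def fun_eq_iff fun_scale_def fam_scale_def algebra_simps)
  have nz: "omega N p F \<noteq> 0" if "F \<in> \<Delta>" for F
    using omega_nonzero[OF finite_N finite_face[OF that] dual_basis_dual[OF that]] .
  have fbd_h: "fbd {} (h s) G = contract N (\<lambda>i. \<Sum>v\<in>V - G. s (insert v G) * p v i) (omega N p G)"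
    if G: "finite G" for s G
  proof -
    have "fbd {} (h s) G = (\<Sum>v\<in>V - G. fun_scale (s (insert v G)) (contract N (p v) (omega N p G)))"
      unfolding fbd_def h_def
      by (auto simp: contract_omega[OF finite_N G] incidence_insert_self mult.commute intro!: sum.cong)
    then show ?thesis
      by (simp add: contract_sum_left)
  qed
  have cyc: "fbd {} (h s) = 0 \<longleftrightarrow> s \<in> sq_stress i" if s: "s \<in> supp_in (faces {} i)" for s
  proof -
    have s0: "s F = 0" if "F \<notin> \<Delta> \<or> card F \<noteq> i" for F
      using supp_inD[OF s] that unfolding faces_over_def by blast
    have triv: "fbd {} (h s) G = 0" if "\<not> (G \<in> \<Delta> \<and> Suc (card G) = i)" for G
    proof -
      have "s (insert v G) = 0" if v: "v \<in> V - G" for v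
      proof (rule s0, rule ccontr)
        assume "\<not> (insert v G \<notin> \<Delta> \<or> card (insert v G) \<noteq> i)"
        then have *: "insert v G \<in> \<Delta>" "card (insert v G) = i" by auto
        then have "G \<in> \<Delta>" "finite G"
          using face_subset finite_face by (meson finite_insert subset_insertI)+
        then show False
          using * v \<open>\<not> (G \<in> \<Delta> \<and> Suc (card G) = i)\<close> by auto
      qed
      then show ?thesis
        unfolding fbd_def h_def by simp
    qed
    have "fbd {} (h s) = 0 \<longleftrightarrow> (\<forall>G\<in>\<Delta>. Suc (card G) = i \<longrightarrow> fbd {} (h s) G = 0)"
      using triv by (auto simp: fun_eq_iff)
    also have "\<dots> \<longleftrightarrow> s \<in> sq_stress i"
      unfolding sq_stress_def using s
      by (simp add: fbd_h finite_face contract_omega_zero_iff pairing_sum_right)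
    finally show ?thesis .
  qed
  have hT: "h s \<in> T e i" if s: "s \<in> supp_in (faces {} i)" for s
    unfolding T_def
  proof (rule X_memI)
    fix F assume F: "F \<in> faces {} i"
    then have "F \<inter> V = F" "F \<in> \<Delta>" "card F = i"
      using face_subset_vertices unfolding faces_over_def by auto
    then have "omega N p F \<in> kforms N p ({} \<union> (F \<inter> V)) e"
      using omega_kforms[OF finite_N finite_face[of F] face_card[of F], of p] unfolding e_def by simp
    then show "h s F \<in> kforms N p ({} \<union> (F \<inter> V)) e"
      unfolding h_def by (rule funs.subspace_scale[OF kforms_subspace])
  next
    fix F assume "F \<notin> faces {} i"
    then show "h s F = 0"
      using supp_inD[OF s] unfolding h_def by simp
  qed
  have im: "h ` sq_stress i = T_cycles e i"
  proof
    show "h ` sq_stress i \<subseteq> T_cycles e i"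
      using hT cyc unfolding T_cycles_def sq_stress_def by blast
    show "T_cycles e i \<subseteq> h ` sq_stress i"
    proof
      fix c assume c: "c \<in> T_cycles e i"
      then have cX: "c \<in> X {} V e i" and c0: "fbd {} c = 0"
        unfolding T_cycles_def T_def by auto
      have "\<exists>r. c F = fun_scale r (omega N p F)" if F: "F \<in> faces {} i" for F
      proof -
        have F': "F \<inter> V = F" "F \<in> \<Delta>" "card F = i"
          using F face_subset_vertices unfolding faces_over_def by auto
        have "funs.dim (kforms N p F e) = 1"
          using kforms_dim[OF finite_N dual_basis_dual[OF F'(2)] finite_face[OF F'(2)] face_card[OF F'(2)], of e]
            F'(3) unfolding e_def by simp
        moreover have "omega N p F \<in> kforms N p F e"
          using omega_kforms[OF finite_N finite_face[OF F'(2)] face_card[OF F'(2)]] F'(3) unfolding e_def by simp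
        moreover have "c F \<in> kforms N p F e"
          using X_mem_kforms[OF cX F] F'(1) by simp
        ultimately show ?thesis
          using funs.dim_eq_1_multiples[OF kforms_findim[OF finite_N]] nz[OF F'(2)] by blast
      qed
      then obtain s0 where s0: "\<And>F. F \<in> faces {} i \<Longrightarrow> c F = fun_scale (s0 F) (omega N p F)"
        by metis
      define s where "s F = (if F \<in> faces {} i then s0 F else 0)" for F
      have "s \<in> supp_in (faces {} i)"
        unfolding s_def supp_in_def by simp
      moreover have "h s = c"
        unfolding h_def s_def using s0 X_mem_zero[OF cX] by (auto simp: fun_eq_iff fun_scale_def)
      ultimately show "c \<in> h ` sq_stress i"
        using cyc c0 by blast
    qed
  qed
  have "fams.dim (h ` sq_stress i) = funs.dim (sq_stress i)"
  proof (rule funs_fams.dim_image_injective[OF lin dim_stress(2)])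
    fix s assume s: "s \<in> sq_stress i" "h s = 0"
    show "s = 0"
    proof
      fix F
      show "s F = 0 F"
      proof (cases "F \<in> \<Delta>")
        case True
        have "fun_scale (s F) (omega N p F) = 0"
          using fun_cong[OF s(2), of F] unfolding h_def by simp
        then show ?thesis
          using nz[OF True] by simp
      next
        case False
        then have "F \<notin> faces {} i"
          unfolding faces_over_def by blast
        then show ?thesis
          using sq_stress_outside[OF s(1)] by simp
      qed
    qed
  qed
  then show ?thesis
    using im dim_stress(1) unfolding e_def by simp
qed

end

section \<open>Linear functionals on polynomials\<close>

interpretation polyvs: vector_space poly_scale
  by (rule vector_space_poly_scale)

interpretation polyvs_funs: vector_space_pair poly_scale fun_scale ..

lemma lookup_poly_scale: "Poly_Mapping.lookup (poly_scale c f) m = c * Poly_Mapping.lookup f m"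
  unfolding poly_scale_def mult_map_scale_conv_mult[symmetric] by (simp add: map.rep_eq when_def)

lemma lookup_linear:
  "Vector_Spaces.linear poly_scale fun_scale (Poly_Mapping.lookup :: ('x, 'k::field) mpoly \<Rightarrow> _)"
  unfolding Vector_Spaces.linear_iff using vector_space_poly_scale vector_space_fun_scale
  by (auto simp: fun_eq_iff lookup_add lookup_poly_scale fun_scale_def)

text \<open>A function on monomials extended linearly. It serves both as the pairing with stresses
  and, with monomial values, as polynomial evaluation.\<close>

definition functional :: "(('x \<Rightarrow>\<^sub>0 nat) \<Rightarrow> 'k::field) \<Rightarrow> ('x, 'k) mpoly \<Rightarrow> 'k" where
  "functional g f = (\<Sum>m\<in>Poly_Mapping.keys f. Poly_Mapping.lookup f m * g m)"

lemma functional_superset: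
  assumes "finite A" "Poly_Mapping.keys f \<subseteq> A"
  shows "functional g f = (\<Sum>m\<in>A. Poly_Mapping.lookup f m * g m)"
  unfolding functional_def by (rule sum.mono_neutral_left) (use assms in \<open>auto simp: in_keys_iff\<close>)

lemma functional_add: "functional g (f + f') = functional g f + functional g f'"
proof -
  have fin: "finite (Poly_Mapping.keys f \<union> Poly_Mapping.keys f')" by simp
  show ?thesis
    using functional_superset[OF fin, of "f + f'" g] functional_superset[OF fin, of f g]
      functional_superset[OF fin, of f' g] keys_add[of f f']
    by (simp add: lookup_add distrib_right sum.distrib)
qed

lemma functional_0: "functional g 0 = 0"
  by (simp add: functional_def)

lemma functional_sum: "functional g (\<Sum>a\<in>A. f a) = (\<Sum>a\<in>A. functional g (f a))"
  by (induction A rule: infinite_finite_induct) (auto simp: functional_add functional_0)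

lemma functional_single: "functional g (Poly_Mapping.single m c) = c * g m"
  using functional_superset[of "{m}" "Poly_Mapping.single m c" g] by simp

lemma mpoly_expand: "f = (\<Sum>m\<in>Poly_Mapping.keys f. Poly_Mapping.single m (Poly_Mapping.lookup f m))"
proof (rule poly_mapping_eqI)
  fix x
  have "(\<Sum>m\<in>Poly_Mapping.keys f. Poly_Mapping.lookup f m when m = x) =
      (\<Sum>m\<in>Poly_Mapping.keys f. if m = x then Poly_Mapping.lookup f m else 0)"
    by (simp add: when_def)
  also have "\<dots> = Poly_Mapping.lookup f x"
    by (simp add: in_keys_iff)
  finally show "Poly_Mapping.lookup f x =
      Poly_Mapping.lookup (\<Sum>m\<in>Poly_Mapping.keys f. Poly_Mapping.single m (Poly_Mapping.lookup f m)) x"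
    unfolding lookup_sum lookup_single by simp
qed

lemma functional_mult_zero:
  assumes "\<And>m c. m \<in> Poly_Mapping.keys q \<Longrightarrow> functional g (Poly_Mapping.single m c * s) = 0"
  shows "functional g (q * s) = 0"
proof -
  have "q * s = (\<Sum>m\<in>Poly_Mapping.keys q. Poly_Mapping.single m (Poly_Mapping.lookup q m) * s)"
    by (subst mpoly_expand[of q]) (simp add: sum_distrib_right)
  then show ?thesis
    using assms by (simp add: functional_sum)
qed

lemma prod_var: "finite F \<Longrightarrow> (\<Prod>v\<in>F. var v) = (Poly_Mapping.single (sqf F) 1 :: ('v, 'k::field) mpoly)"
proof (induction F rule: finite_induct)
  case empty
  then show ?case by (simp add: sqf_def)
next
  case (insert v F)
  then show ?case
    by (simp add: sqf_insert var_def mult_single add.commute)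
qed

lemma single_times_linear_form:
  "Poly_Mapping.single m c * linear_form A a = (\<Sum>v\<in>A. Poly_Mapping.single (m + xvar v) (c * a v))"
  unfolding linear_form_def poly_scale_def var_def by (simp add: sum_distrib_left mult_single)

lemma polys_add: "f \<in> polys A \<Longrightarrow> g \<in> polys A \<Longrightarrow> f + g \<in> polys A"
  unfolding polys_def using keys_add by fastforce

lemma polys_mult:
  assumes "f \<in> polys A" "g \<in> polys A"
  shows "f * g \<in> polys A"
  unfolding polys_def
proof (intro CollectI ballI)
  fix m assume "m \<in> Poly_Mapping.keys (f * g)"
  then obtain a b where "m = a + b" "a \<in> Poly_Mapping.keys f" "b \<in> Poly_Mapping.keys g"
    using keys_mult[of f g] by blast
  then show "mkeys m \<subseteq> A"
    using assms unfolding polys_def by (auto simp: mkeys_add)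
qed

lemma polys_single: "mkeys m \<subseteq> A \<Longrightarrow> Poly_Mapping.single m c \<in> polys A"
  unfolding polys_def by simp

lemma polys_0: "0 \<in> polys A"
  unfolding polys_def by simp

lemma polys_prod: "(\<And>x. x \<in> S \<Longrightarrow> f x \<in> polys A) \<Longrightarrow> (\<Prod>x\<in>S. f x) \<in> polys A"
proof (induction S rule: infinite_finite_induct)
  case (insert x F)
  then show ?case by (simp add: polys_mult)
qed (use polys_single[of 0 A 1] in auto)

section \<open>Ideals and homogeneous components\<close>

lemma ideal_gen_mult: "g \<in> G \<Longrightarrow> q \<in> polys A \<Longrightarrow> q * g \<in> ideal_gen A G"
  unfolding ideal_gen_def by (intro CollectI exI[of _ "{g}"] exI[of _ "\<lambda>_. q"]) simp

lemma ideal_gen_0: "0 \<in> ideal_gen A G"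
  unfolding ideal_gen_def by (intro CollectI exI[of _ "{}"] exI[of _ "\<lambda>_. 0"]) simp

lemma ideal_gen_add:
  assumes "f \<in> ideal_gen A G" "f' \<in> ideal_gen A G"
  shows "f + f' \<in> ideal_gen A G"
proof -
  obtain S q where S: "f = (\<Sum>g\<in>S. q g * g)" "finite S" "S \<subseteq> G" "\<forall>g\<in>S. q g \<in> polys A"
    using assms(1) unfolding ideal_gen_def by blast
  obtain S' q' where S': "f' = (\<Sum>g\<in>S'. q' g * g)" "finite S'" "S' \<subseteq> G" "\<forall>g\<in>S'. q' g \<in> polys A"
    using assms(2) unfolding ideal_gen_def by blast
  define r where "r g = (if g \<in> S then q g else 0) + (if g \<in> S' then q' g else 0)" for g
  have "(\<Sum>g\<in>S \<union> S'. (if g \<in> S then q g else 0) * g) = f"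
    unfolding S(1) by (rule sum.mono_neutral_cong_right) (use S S' in auto)
  moreover have "(\<Sum>g\<in>S \<union> S'. (if g \<in> S' then q' g else 0) * g) = f'"
    unfolding S'(1) by (rule sum.mono_neutral_cong_right) (use S S' in auto)
  ultimately have "f + f' = (\<Sum>g\<in>S \<union> S'. r g * g)"
    unfolding r_def by (simp add: distrib_right sum.distrib)
  moreover have "\<forall>g\<in>S \<union> S'. r g \<in> polys A"
    unfolding r_def using S S' polys_0 by (auto intro!: polys_add)
  ultimately show ?thesis
    unfolding ideal_gen_def using S S' by blast
qed

lemma ideal_gen_scale:
  assumes "f \<in> ideal_gen A G"
  shows "poly_scale c f \<in> ideal_gen A G"
proof -
  obtain S q where S: "f = (\<Sum>g\<in>S. q g * g)" "finite S" "S \<subseteq> G" "\<forall>g\<in>S. q g \<in> polys A"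
    using assms(1) unfolding ideal_gen_def by blast
  have "poly_scale c f = (\<Sum>g\<in>S. (Poly_Mapping.single 0 c * q g) * g)"
    unfolding poly_scale_def S(1) by (simp add: sum_distrib_left mult.assoc)
  moreover have "\<forall>g\<in>S. Poly_Mapping.single 0 c * q g \<in> polys A"
    using S(4) by (auto intro!: polys_mult polys_single)
  ultimately show ?thesis
    unfolding ideal_gen_def using S by (intro CollectI exI[of _ S] exI[of _ "\<lambda>g. Poly_Mapping.single 0 c * q g"]) simp
qed

lemma ideal_gen_sum: "(\<And>x. x \<in> S \<Longrightarrow> f x \<in> ideal_gen A G) \<Longrightarrow> (\<Sum>x\<in>S. f x) \<in> ideal_gen A G"
  by (induction S rule: infinite_finite_induct) (auto simp: ideal_gen_0 ideal_gen_add)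

lemma functional_ideal_gen:
  assumes "f \<in> ideal_gen A G"
    and "\<And>s m c. s \<in> G \<Longrightarrow> mkeys m \<subseteq> A \<Longrightarrow> functional g (Poly_Mapping.single m c * s) = 0"
  shows "functional g f = 0"
proof -
  obtain S q where S: "f = (\<Sum>s\<in>S. q s * s)" "finite S" "S \<subseteq> G" "\<forall>s\<in>S. q s \<in> polys A"
    using assms(1) unfolding ideal_gen_def by blast
  have "functional g (q s * s) = 0" if "s \<in> S" for s
  proof (rule functional_mult_zero)
    fix m c assume "m \<in> Poly_Mapping.keys (q s)"
    then have "mkeys m \<subseteq> A"
      using S(4) that unfolding polys_def by blast
    then show "functional g (Poly_Mapping.single m c * s) = 0"
      using assms(2) S(3) that by blast
  qed
  then show ?thesis
    unfolding S(1) by (simp add: functional_sum)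
qed

definition monomials :: "'x set \<Rightarrow> nat \<Rightarrow> ('x \<Rightarrow>\<^sub>0 nat) set" where
  "monomials A i = {m. mkeys m \<subseteq> A \<and> mono_degree m = i}"

lemma homogeneous_polys_iff: "f \<in> homogeneous_polys A i \<longleftrightarrow> Poly_Mapping.keys f \<subseteq> monomials A i"
  unfolding homogeneous_polys_def polys_def monomials_def by auto

lemma homogeneous_polys_dim:
  assumes "finite A"
  shows "polyvs.findim (homogeneous_polys A i :: ('x, 'k::field) mpoly set)"
    "Poly_Mapping.lookup ` (homogeneous_polys A i :: ('x, 'k) mpoly set) = supp_in (monomials A i)"
    "polyvs.dim (homogeneous_polys A i :: ('x, 'k) mpoly set) = card (monomials A i)"
proof -
  have fin: "finite (monomials A i)"
    unfolding monomials_def by (rule finite_monomials[OF assms])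
  have iff: "f \<in> homogeneous_polys A i \<longleftrightarrow> (\<forall>m. m \<notin> monomials A i \<longrightarrow> Poly_Mapping.lookup f m = 0)"
    for f :: "('x, 'k) mpoly"
    unfolding homogeneous_polys_iff subset_iff in_keys_iff by blast
  have sub: "polyvs.subspace (homogeneous_polys A i :: ('x, 'k) mpoly set)"
    unfolding polyvs.subspace_def by (auto simp: iff lookup_add lookup_poly_scale)
  have "homogeneous_polys A i \<subseteq> polyvs.span ((\<lambda>m. Poly_Mapping.single m 1) ` monomials A i :: ('x, 'k) mpoly set)"
  proof
    fix f :: "('x, 'k) mpoly" assume f: "f \<in> homogeneous_polys A i"
    have "f = (\<Sum>m\<in>Poly_Mapping.keys f. poly_scale (Poly_Mapping.lookup f m) (Poly_Mapping.single m 1))"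
      by (subst mpoly_expand) (simp add: poly_scale_def mult_single)
    also have "\<dots> \<in> polyvs.span ((\<lambda>m. Poly_Mapping.single m 1) ` monomials A i)"
      using f unfolding homogeneous_polys_iff
      by (intro polyvs.span_sum polyvs.span_scale polyvs.span_base) auto
    finally show "f \<in> polyvs.span ((\<lambda>m. Poly_Mapping.single m 1) ` monomials A i)" .
  qed
  then show fd: "polyvs.findim (homogeneous_polys A i :: ('x, 'k) mpoly set)"
    unfolding polyvs.findim_def using sub fin by blast
  show im: "Poly_Mapping.lookup ` (homogeneous_polys A i :: ('x, 'k) mpoly set) = supp_in (monomials A i)"
  proof
    show "Poly_Mapping.lookup ` (homogeneous_polys A i :: ('x, 'k) mpoly set) \<subseteq> supp_in (monomials A i)"
      unfolding supp_in_def by (auto simp: iff)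
    show "supp_in (monomials A i) \<subseteq> Poly_Mapping.lookup ` (homogeneous_polys A i :: ('x, 'k) mpoly set)"
    proof
      fix h :: "('x \<Rightarrow>\<^sub>0 nat) \<Rightarrow> 'k" assume h: "h \<in> supp_in (monomials A i)"
      then have "finite {m. h m \<noteq> 0}"
        by (intro finite_subset[OF _ fin]) (auto simp: supp_in_def)
      then have l: "Poly_Mapping.lookup (Abs_poly_mapping h) = h"
        by (simp add: Abs_poly_mapping_inverse)
      then have "Abs_poly_mapping h \<in> homogeneous_polys A i"
        using h unfolding homogeneous_polys_iff supp_in_def by (auto simp: in_keys_iff)
      then show "h \<in> Poly_Mapping.lookup ` (homogeneous_polys A i :: ('x, 'k) mpoly set)"
        using l by (metis imageI)
    qed
  qed
  have "funs.dim (Poly_Mapping.lookup ` (homogeneous_polys A i :: ('x, 'k) mpoly set)) =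
      polyvs.dim (homogeneous_polys A i :: ('x, 'k) mpoly set)"
    by (rule polyvs_funs.dim_image_injective[OF lookup_linear fd]) (auto intro: poly_mapping_eqI)
  then show "polyvs.dim (homogeneous_polys A i :: ('x, 'k) mpoly set) = card (monomials A i)"
    unfolding im supp_in_dim(2)[OF fin] by simp
qed

context face_vectors
begin

section \<open>Duality between the quotient ring and stresses\<close>

definition theta :: "'i \<Rightarrow> ('v, 'k) mpoly" where
  "theta j = linear_form V (\<lambda>v. p v j)"

abbreviation I :: "('v, 'k) mpoly set" where
  "I \<equiv> face_quotient_ideal \<Delta> (theta ` N)"

lemma I_theta: "mkeys m \<subseteq> V \<Longrightarrow> j \<in> N \<Longrightarrow> Poly_Mapping.single m c * theta j \<in> I"
  unfolding face_quotient_ideal_def by (rule ideal_gen_mult) (auto intro: polys_single)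

lemma I_nonface:
  assumes "mkeys m \<subseteq> V" "mkeys m \<notin> \<Delta>"
  shows "Poly_Mapping.single m 1 \<in> I"
proof -
  define n where "n = m - sqf (mkeys m)"
  have m: "m = n + sqf (mkeys m)"
  proof (rule poly_mapping_eqI)
    fix x
    show "mlookup m x = mlookup (n + sqf (mkeys m)) x"
      unfolding n_def lookup_add lookup_minus by (simp add: lookup_sqf in_keys_iff)
  qed
  have "(\<Prod>v\<in>mkeys m. var v :: ('v, 'k) mpoly) \<in> nonface_monomials \<Delta>"
    using assms unfolding nonface_monomials_def by blast
  moreover have "mkeys n \<subseteq> V"
    using assms(1) arg_cong[OF m, of mkeys] unfolding mkeys_add by blast
  ultimately have "Poly_Mapping.single n 1 * (\<Prod>v\<in>mkeys m. var v) \<in> I"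
    unfolding face_quotient_ideal_def by (intro ideal_gen_mult) (auto intro: polys_single)
  then show ?thesis
    by (simp add: prod_var mult_single m[symmetric])
qed

lemma functional_I:
  assumes g: "g \<in> stress i" and f: "f \<in> I"
  shows "functional g f = 0"
proof (rule functional_ideal_gen[OF f[unfolded face_quotient_ideal_def]])
  fix s :: "('v, 'k) mpoly" and m c
  assume s: "s \<in> nonface_monomials \<Delta> \<union> theta ` N" and m: "mkeys m \<subseteq> V"
  show "functional g (Poly_Mapping.single m c * s) = 0"
  proof (cases "s \<in> nonface_monomials \<Delta>")
    case True
    then obtain F where F: "s = (\<Prod>v\<in>F. var v)" "F \<subseteq> V" "F \<notin> \<Delta>"
      unfolding nonface_monomials_def by blast
    have fF: "finite F"
      using F(2) finite_V finite_subset by blast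
    have "mkeys (m + sqf F) \<notin> \<Delta>"
      using F(3) face_subset[of "mkeys m \<union> F" F] by (auto simp: mkeys_add mkeys_sqf[OF fF])
    then have "g (m + sqf F) = 0"
      by (intro stress_outside[OF g]) (simp add: face_monomials_def)
    then show ?thesis
      unfolding F(1) prod_var[OF fF] by (simp add: mult_single functional_single)
  next
    case False
    then obtain j where j: "j \<in> N" "s = theta j"
      using s by blast
    define e where "e x = (if x = j then 1 else 0 :: 'k)" for x
    have e: "pairing N e y = y j" for y
    proof -
      have "pairing N e y = (\<Sum>x\<in>N. if x = j then y x else 0)"
        unfolding pairing_def e_def by (intro sum.cong) auto
      then show ?thesis
        using j(1) finite_N by simp
    qed
    have "stress_sum g e m = 0"
      using g unfolding stress_def by simp
    then have "(\<Sum>v\<in>V. p v j * g (m + xvar v)) = 0"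
      unfolding stress_sum_def e .
    then show ?thesis
      unfolding j(2) theta_def single_times_linear_form functional_sum functional_single
      by (simp add: mult.assoc flip: sum_distrib_left)
  qed
qed

text \<open>Stresses are the degree \<open>i\<close> part of Macaulay's inverse system of
  \<open>I\<close>. Monomials act by shifting exponents and not by differentiation, so no factorials
  appear and every characteristic is allowed.\<close>

lemma stress_eq_perp:
  "stress i = perp (monomials V i) (Poly_Mapping.lookup ` (homogeneous_polys V i \<inter> I))"
proof -
  have fin: "finite (monomials V i)"
    unfolding monomials_def by (rule finite_monomials[OF finite_V])
  have fun_eq: "functional g f = (\<Sum>m\<in>monomials V i. Poly_Mapping.lookup f m * g m)"
    if "f \<in> homogeneous_polys V i" for f g
    using that functional_superset[OF fin] unfolding homogeneous_polys_iff by blast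
  show ?thesis
  proof (intro equalityI subsetI)
    fix g assume g: "g \<in> stress i"
    have "g m = 0" if "m \<notin> monomials V i" for m
      by (rule stress_outside[OF g])
        (use that face_subset_vertices in \<open>auto simp: monomials_def face_monomials_def\<close>)
    moreover have "(\<Sum>m\<in>monomials V i. Poly_Mapping.lookup f m * g m) = 0" if "f \<in> homogeneous_polys V i \<inter> I" for f
      using that fun_eq functional_I[OF g] by (metis IntE)
    ultimately show "g \<in> perp (monomials V i) (Poly_Mapping.lookup ` (homogeneous_polys V i \<inter> I))"
      unfolding perp_def supp_in_def by auto
  next
    fix g assume g: "g \<in> perp (monomials V i) (Poly_Mapping.lookup ` (homogeneous_polys V i \<inter> I))"
    then have g0: "g m = 0" if "m \<notin> monomials V i" for m
      using that unfolding perp_def supp_in_def by blast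
    have gf: "functional g f = 0" if "f \<in> homogeneous_polys V i" "f \<in> I" for f
      unfolding fun_eq[OF that(1)] using g that unfolding perp_def by blast
    have "g m = 0" if m: "m \<notin> face_monomials i" for m
    proof (cases "m \<in> monomials V i")
      case True
      then have "Poly_Mapping.single m 1 \<in> I"
        using m by (intro I_nonface) (auto simp: monomials_def face_monomials_def)
      moreover have "Poly_Mapping.single m 1 \<in> homogeneous_polys V i"
        using True unfolding homogeneous_polys_iff by simp
      ultimately have "functional g (Poly_Mapping.single m 1) = 0"
        using gf by blast
      then show ?thesis
        by (simp add: functional_single)
    qed (rule g0)
    moreover have "stress_sum g w m = 0" for w m
    proof -
      have 1: "(\<Sum>v\<in>V. p v j * g (m + xvar v)) = 0" if j: "j \<in> N" for j
      proof (cases "mkeys m \<subseteq> V \<and> Suc (mono_degree m) = i")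
        case True
        have f: "Poly_Mapping.single m 1 * theta j = (\<Sum>v\<in>V. Poly_Mapping.single (m + xvar v) (p v j))"
          unfolding theta_def single_times_linear_form by simp
        have "m + xvar v \<in> monomials V i" if "v \<in> V" for v
          using True that unfolding monomials_def by (simp add: mkeys_add_var mono_degree_add mono_degree_var del: One_nat_def)
        then have "Poly_Mapping.single m 1 * theta j \<in> homogeneous_polys V i"
          unfolding homogeneous_polys_iff f using keys_sum[of "\<lambda>v. Poly_Mapping.single (m + xvar v) (p v j)" V]
          by (auto split: if_splits)
        then have "functional g (Poly_Mapping.single m 1 * theta j) = 0"
          using gf I_theta True j by blast
        then show ?thesis
          unfolding f functional_sum functional_single .
      next
        case False
        have "g (m + xvar v) = 0" for v
          by (rule g0) (use False in \<open>auto simp: monomials_def mkeys_add_var mono_degree_add mono_degree_var simp del: One_nat_def\<close>)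
        then show ?thesis by simp
      qed
      have "stress_sum g w m = (\<Sum>v\<in>V. \<Sum>j\<in>N. w j * (p v j * g (m + xvar v)))"
        unfolding stress_sum_def pairing_def by (simp add: sum_distrib_right mult.assoc)
      also have "\<dots> = (\<Sum>j\<in>N. \<Sum>v\<in>V. w j * (p v j * g (m + xvar v)))"
        by (rule sum.swap)
      also have "\<dots> = (\<Sum>j\<in>N. w j * (\<Sum>v\<in>V. p v j * g (m + xvar v)))"
        by (simp add: sum_distrib_left)
      finally show ?thesis
        using 1 by simp
    qed
    ultimately show "g \<in> stress i"
      unfolding stress_def supp_in_def by blast
  qed
qed

lemma subspace_homogeneous_I: "polyvs.subspace (homogeneous_polys V i \<inter> I)"
proof -
  have "polyvs.subspace I"
    unfolding polyvs.subspace_def face_quotient_ideal_def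
    by (auto intro: ideal_gen_0 ideal_gen_add ideal_gen_scale)
  then show ?thesis
    using polyvs.subspace_inter polyvs.findim_subspace[OF homogeneous_polys_dim(1)[OF finite_V]] by blast
qed

lemma dim_homogeneous_I:
  "polyvs.dim (homogeneous_polys V i \<inter> I) + funs.dim (stress i) = polyvs.dim (homogeneous_polys V i :: ('v, 'k) mpoly set)"
proof -
  have fin: "finite (monomials V i)"
    unfolding monomials_def by (rule finite_monomials[OF finite_V])
  have fd: "polyvs.findim (homogeneous_polys V i \<inter> I)"
    by (rule polyvs.findim_subset[OF homogeneous_polys_dim(1)[OF finite_V] subspace_homogeneous_I]) blast
  have "funs.dim (Poly_Mapping.lookup ` (homogeneous_polys V i \<inter> I)) = polyvs.dim (homogeneous_polys V i \<inter> I)"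
    by (rule polyvs_funs.dim_image_injective[OF lookup_linear fd]) (auto intro: poly_mapping_eqI)
  moreover have "funs.subspace (Poly_Mapping.lookup ` (homogeneous_polys V i \<inter> I))"
    using polyvs_funs.findim_image[OF lookup_linear fd] funs.findim_subspace by blast
  moreover have "Poly_Mapping.lookup ` (homogeneous_polys V i \<inter> I) \<subseteq> supp_in (monomials V i)"
    using homogeneous_polys_dim(2)[OF finite_V, of i] by blast
  ultimately show ?thesis
    using perp_dim[OF fin, of "Poly_Mapping.lookup ` (homogeneous_polys V i \<inter> I)"]
      homogeneous_polys_dim(3)[OF finite_V, of i, where 'k='k] stress_eq_perp[of i] by simp
qed

lemma h_prime_eq_dim_stress: "h_prime \<Delta> (theta ` N) i = funs.dim (stress i)"
  unfolding h_prime_def quot_dim_def using dim_homogeneous_I[of i] by simp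

lemma stress_high_degree:
  assumes "card N < i"
  shows "stress i = {0}"
proof -
  have "faces {} i = {}"
    using face_card assms unfolding faces_over_def by fastforce
  then have "stress i \<subseteq> {0}"
    using stress_zero by blast
  then show ?thesis
    using funs.subspace_0[OF stress_subspace] by blast
qed

lemma I_high_degree:
  assumes "card N < i"
  shows "homogeneous_polys V i \<subseteq> I"
proof -
  have "polyvs.dim (homogeneous_polys V i \<inter> I) = polyvs.dim (homogeneous_polys V i :: ('v, 'k) mpoly set)"
    using dim_homogeneous_I[of i] stress_high_degree[OF assms] by (simp add: funs.dim_zero_subspace)
  then have "homogeneous_polys V i \<inter> I = homogeneous_polys V i"
    by (intro polyvs.eq_of_dim_le[OF homogeneous_polys_dim(1)[OF finite_V] subspace_homogeneous_I]) auto
  then show ?thesis by blast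
qed

lemma theta_homogeneous: "theta j \<in> homogeneous_polys V 1"
proof -
  have f: "theta j = (\<Sum>v\<in>V. Poly_Mapping.single (xvar v) (p v j))"
    using single_times_linear_form[of 0 1 V "\<lambda>v. p v j"] unfolding theta_def by simp
  have "xvar v \<in> monomials V 1" if "v \<in> V" for v
    using that mono_degree_var[of v] unfolding monomials_def by simp
  then show ?thesis
    unfolding homogeneous_polys_iff f using keys_sum[of "\<lambda>v. Poly_Mapping.single (xvar v) (p v j)" V]
    by (auto split: if_splits)
qed

text \<open>Everything of degree above \<open>card N\<close> lies in \<open>I\<close>, because
  stresses of that degree vanish; the monomials of smaller or equal degree therefore span the
  quotient.\<close>

lemma quotient_finite_dimensional:
  "\<exists>B. finite B \<and> B \<subseteq> polys V \<and> (\<forall>f\<in>polys V. \<exists>b\<in>module.span poly_scale B. f - b \<in> I)"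
proof (intro exI conjI ballI)
  define M where "M = (\<Union>i\<le>card N. monomials V i)"
  define B where "B = (\<lambda>m. Poly_Mapping.single m 1 :: ('v, 'k) mpoly) ` M"
  show "finite B"
    unfolding B_def M_def using finite_monomials[OF finite_V] unfolding monomials_def by blast
  show "B \<subseteq> polys V"
    unfolding B_def M_def monomials_def by (auto intro: polys_single)
  fix f :: "('v, 'k) mpoly" assume f: "f \<in> polys V"
  define s where "s = (\<lambda>m. Poly_Mapping.single m (Poly_Mapping.lookup f m))"
  define b where "b = (\<Sum>m\<in>Poly_Mapping.keys f \<inter> M. s m)"
  have "b = (\<Sum>m\<in>Poly_Mapping.keys f \<inter> M. poly_scale (Poly_Mapping.lookup f m) (Poly_Mapping.single m 1))"
    unfolding b_def s_def poly_scale_def by (simp add: mult_single)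
  also have "\<dots> \<in> polyvs.span B"
    unfolding B_def by (intro polyvs.span_sum polyvs.span_scale polyvs.span_base) auto
  finally have bB: "b \<in> polyvs.span B" .
  have "f = (\<Sum>m\<in>Poly_Mapping.keys f. s m)"
    unfolding s_def by (rule mpoly_expand)
  also have "\<dots> = (\<Sum>m\<in>Poly_Mapping.keys f - M. s m) + b"
    unfolding b_def by (subst add.commute) (rule sum.Int_Diff, simp)
  finally have "f - b = (\<Sum>m\<in>Poly_Mapping.keys f - M. s m)"
    by (metis add_diff_cancel_right')
  also have "\<dots> \<in> I"
    unfolding face_quotient_ideal_def
  proof (rule ideal_gen_sum)
    fix m assume m: "m \<in> Poly_Mapping.keys f - M"
    then have mV: "m \<in> monomials V (mono_degree m)"
      using f unfolding polys_def monomials_def by blast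
    moreover have "card N < mono_degree m"
      using m mV unfolding M_def by (meson DiffD2 UN_I atMost_iff not_less)
    moreover have "s m \<in> homogeneous_polys V (mono_degree m)"
      unfolding homogeneous_polys_iff s_def using mV by simp
    ultimately show "s m \<in> ideal_gen V (nonface_monomials \<Delta> \<union> theta ` N)"
      using I_high_degree unfolding face_quotient_ideal_def by blast
  qed
  finally show "\<exists>b\<in>polyvs.span B. f - b \<in> I"
    using bB by blast
qed

end

section \<open>Genericity\<close>

definition mono_eval :: "('x \<Rightarrow> 'k::field) \<Rightarrow> ('x \<Rightarrow>\<^sub>0 nat) \<Rightarrow> 'k" where
  "mono_eval a m = (\<Prod>x\<in>mkeys m. a x ^ mlookup m x)"

lemma poly_eval_functional: "poly_eval a = functional (mono_eval a)"
  by (simp add: poly_eval_def functional_def mono_eval_def fun_eq_iff)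

lemma mono_eval_superset:
  assumes "finite A" "mkeys m \<subseteq> A"
  shows "mono_eval a m = (\<Prod>x\<in>A. a x ^ mlookup m x)"
  unfolding mono_eval_def by (rule prod.mono_neutral_left) (use assms in \<open>auto simp: in_keys_iff\<close>)

lemma mono_eval_add: "mono_eval a (m + n) = mono_eval a m * mono_eval a n"
proof -
  have fin: "finite (mkeys m \<union> mkeys n)" by simp
  show ?thesis
    using mono_eval_superset[OF fin, of "m + n" a] mono_eval_superset[OF fin, of m a]
      mono_eval_superset[OF fin, of n a]
    by (simp add: mkeys_add lookup_add power_add prod.distrib)
qed

lemma poly_eval_mult: "poly_eval a (f * g) = poly_eval a f * poly_eval a g"
proof -
  have "f * g = (\<Sum>m\<in>Poly_Mapping.keys f. \<Sum>n\<in>Poly_Mapping.keys g.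
      Poly_Mapping.single (m + n) (Poly_Mapping.lookup f m * Poly_Mapping.lookup g n))"
    by (subst mpoly_expand[of f], subst mpoly_expand[of g]) (simp add: sum_product mult_single)
  then show ?thesis
    unfolding poly_eval_functional functional_sum functional_single mono_eval_add functional_def[of _ f] functional_def[of _ g]
    by (simp add: functional_sum functional_single mono_eval_add sum_product mult_ac)
qed

lemma poly_eval_add: "poly_eval a (f + g) = poly_eval a f + poly_eval a g"
  unfolding poly_eval_functional by (rule functional_add)

lemma poly_eval_const: "poly_eval a (Poly_Mapping.single 0 c) = c"
  unfolding poly_eval_functional functional_single by (simp add: mono_eval_def)

lemma poly_eval_0: "poly_eval a 0 = 0"
  unfolding poly_eval_functional by (rule functional_0)

lemma poly_eval_var: "poly_eval a (var x) = a x"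
  unfolding poly_eval_functional var_def functional_single by (simp add: mono_eval_def)

definition poly_fun :: "'i set \<Rightarrow> 'v set \<Rightarrow> (('i \<Rightarrow> 'v \<Rightarrow> 'k::field) \<Rightarrow> 'k) \<Rightarrow> bool" where
  "poly_fun N A f \<longleftrightarrow> (\<exists>P\<in>polys (N \<times> A). \<forall>a. poly_eval (\<lambda>(j, v). a j v) P = f a)"

lemma poly_fun_const: "poly_fun N A (\<lambda>a. c)"
  unfolding poly_fun_def by (rule bexI[of _ "Poly_Mapping.single 0 c"]) (auto simp: poly_eval_const polys_single)

lemma poly_fun_coord: "j \<in> N \<Longrightarrow> v \<in> A \<Longrightarrow> poly_fun N A (\<lambda>a. a j v)"
  unfolding poly_fun_def
  by (rule bexI[of _ "var (j, v)"]) (simp add: poly_eval_var, simp add: var_def polys_single)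

lemma poly_fun_mult: "poly_fun N A f \<Longrightarrow> poly_fun N A g \<Longrightarrow> poly_fun N A (\<lambda>a. f a * g a)"
  unfolding poly_fun_def by (metis poly_eval_mult polys_mult)

lemma poly_fun_add: "poly_fun N A f \<Longrightarrow> poly_fun N A g \<Longrightarrow> poly_fun N A (\<lambda>a. f a + g a)"
  unfolding poly_fun_def by (metis poly_eval_add polys_add)

lemma poly_fun_sum: "(\<And>x. x \<in> S \<Longrightarrow> poly_fun N A (f x)) \<Longrightarrow> poly_fun N A (\<lambda>a. \<Sum>x\<in>S. f x a)"
  by (induction S rule: infinite_finite_induct) (auto simp: poly_fun_const poly_fun_add)

lemma poly_fun_omega:
  assumes "finite F" "F \<subseteq> A"
  shows "poly_fun N A (\<lambda>a. omega N (\<lambda>v j. a j v) F J)"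
  using assms
proof (induction F arbitrary: J rule: finite_linorder_min_induct)
  case empty
  show ?case
    unfolding omega_empty by (rule poly_fun_const)
next
  case (insert b F)
  then show ?case
    unfolding omega_insert_min[OF insert.hyps(1,2)] contract_def
    by (intro poly_fun_sum poly_fun_mult poly_fun_const poly_fun_coord) auto
qed

text \<open>The product of the determinants of all faces with \<open>card N\<close> vertices. Each
  factor is a nonzero polynomial because it has a nonzero value at a suitable point, and the product
  of nonzero polynomials is nonzero.\<close>

lemma exists_generic_polynomial:
  fixes \<Delta> :: "'v::linorder set set" and N :: "'i::linorder set"
  assumes \<Delta>: "simplicial_complex \<Delta>" and N: "finite N"
  shows "\<exists>P :: ('i \<times> 'v, 'k::field) mpoly. P \<in> polys (N \<times> vertices \<Delta>) \<and> P \<noteq> 0 \<and>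
    (\<forall>a. poly_eval (\<lambda>(j, v). a j v) P \<noteq> 0 \<longrightarrow>
      (\<forall>F\<in>\<Delta>. card F = card N \<longrightarrow> (\<exists>c. dual_basis N (\<lambda>v j. a j v) F c)))"
proof -
  define S where "S = {F\<in>\<Delta>. card F = card N}"
  have finS: "finite S"
    unfolding S_def using simplicial_complexD(1)[OF \<Delta>] by simp
  have SF: "finite F" "F \<subseteq> vertices \<Delta>" "card F = card N" if "F \<in> S" for F
    using that simplicial_complexD(3)[OF \<Delta>] face_subset_vertices unfolding S_def by auto
  have "\<forall>F\<in>S. \<exists>P\<in>polys (N \<times> vertices \<Delta>). \<forall>a :: 'i \<Rightarrow> 'v \<Rightarrow> 'k.
      poly_eval (\<lambda>(j, v). a j v) P = omega N (\<lambda>v j. a j v) F {}"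
    using poly_fun_omega SF unfolding poly_fun_def by metis
  then obtain P where P: "\<And>F. F \<in> S \<Longrightarrow> P F \<in> polys (N \<times> vertices \<Delta>)"
      "\<And>F a. F \<in> S \<Longrightarrow> poly_eval (\<lambda>(j, v). a j v) (P F) = omega N (\<lambda>v j. a j v :: 'k) F {}"
    by metis
  have Pnz: "P F \<noteq> 0" if F: "F \<in> S" for F
  proof -
    obtain h where h: "bij_betw h F N"
      using finite_same_card_bij[OF SF(1)[OF F] N SF(3)[OF F]] by blast
    \<comment> \<open>The vertices of \<open>F\<close> are sent bijectively to the standard basis
      vectors, all other vertices to zero; this basis is its own dual.\<close>
    define a where "a j v = (if v \<in> F \<and> h v = j then 1 else 0 :: 'k)" for j v
    have "dual_basis N (\<lambda>v j. a j v) F (\<lambda>v j. a j v)"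
      unfolding dual_basis_def
    proof (intro ballI)
      fix u v assume uv: "u \<in> F" "v \<in> F"
      have "pairing N (\<lambda>j. a j u) (\<lambda>j. a j v) = (\<Sum>j\<in>N. if j = h u then (if h v = h u then 1 else 0) else 0)"
        unfolding pairing_def a_def using uv by (intro sum.cong) auto
      also have "\<dots> = (if h v = h u then 1 else 0)"
        using N h uv bij_betwE by (subst sum.delta) auto
      also have "h v = h u \<longleftrightarrow> u = v"
        using h uv unfolding bij_betw_def inj_on_def by metis
      finally show "pairing N (\<lambda>j. a j u) (\<lambda>j. a j v) = (if u = v then 1 else 0)" .
    qed
    then have "omega N (\<lambda>v j. a j v) F \<noteq> 0"
      by (rule omega_nonzero[OF N SF(1)[OF F]])
    then have "poly_eval (\<lambda>(j, v). a j v) (P F) \<noteq> 0"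
      using omega_empty_nonzero[OF N SF(1)[OF F] SF(3)[OF F]] P(2)[OF F] by metis
    then show ?thesis
      using poly_eval_0 by metis
  qed
  define Q where "Q = (\<Prod>F\<in>S. P F)"
  have "Q \<in> polys (N \<times> vertices \<Delta>)"
    unfolding Q_def using P(1) by (rule polys_prod)
  moreover have "Q \<noteq> 0"
    unfolding Q_def using Pnz finS by simp
  moreover have "\<exists>c. dual_basis N (\<lambda>v j. a j v) F c"
    if a: "poly_eval (\<lambda>(j, v). a j v) Q \<noteq> 0" and F: "F \<in> \<Delta>" "card F = card N" for a F
  proof -
    have FS: "F \<in> S"
      using F unfolding S_def by blast
    then have "Q = P F * (\<Prod>F\<in>S - {F}. P F)"
      unfolding Q_def using prod.remove[OF finS] by blast
    then have "poly_eval (\<lambda>(j, v). a j v) (P F) \<noteq> 0"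
      using a by (auto simp: poly_eval_mult)
    then show ?thesis
      using dual_basis_of_omega[OF N SF(1)[OF FS]] P(2)[OF FS] by metis
  qed
  ultimately show ?thesis by blast
qed

section \<open>Coboundaries\<close>

lemma coboundary_linear: "Vector_Spaces.linear fun_scale fun_scale (coboundary \<Delta>)"
  by (rule linear_funI)
    (auto simp: coboundary_def fun_eq_iff fun_scale_def sum_distrib_left distrib_left sum.distrib mult.left_commute)

lemma coboundary_supp_in:
  assumes \<Delta>: "simplicial_complex \<Delta>" and x: "x \<in> supp_in (faces_over \<Delta> G q)"
  shows "coboundary \<Delta> x \<in> supp_in (faces_over \<Delta> G (Suc q))"
  unfolding supp_in_def
proof (intro CollectI allI impI)
  fix F assume F: "F \<notin> faces_over \<Delta> G (Suc q)"
  have "x (F - {v}) = 0" if "F \<in> \<Delta>" "v \<in> F" for v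
  proof (rule supp_inD[OF x], rule notI)
    assume *: "F - {v} \<in> faces_over \<Delta> G q"
    have "card F = Suc (card (F - {v}))"
      by (rule card.remove[OF simplicial_complexD(3)[OF \<Delta>]]) (use that in auto)
    then show False
      using * F that unfolding faces_over_def by auto
  qed
  then show "coboundary \<Delta> x F = 0"
    unfolding coboundary_def by simp
qed

lemma rbd_coboundary_adjoint:
  assumes \<Delta>: "simplicial_complex \<Delta>"
    and y: "y \<in> supp_in (faces_over \<Delta> G (Suc q))" and x: "x \<in> supp_in (faces_over \<Delta> G q)"
  shows "(\<Sum>H\<in>faces_over \<Delta> G q. rbd (vertices \<Delta>) G y H * x H) =
    (\<Sum>F\<in>faces_over \<Delta> G (Suc q). y F * coboundary \<Delta> x F)"
proof -
  define V where "V = vertices \<Delta>"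
  \<comment> \<open>\<open>S1\<close> and \<open>S2\<close> list the same incident pairs of faces,
    once from the smaller and once from the larger face.\<close>
  define S1 where "S1 = {(H, v). H \<in> faces_over \<Delta> G q \<and> v \<in> V - H \<and> insert v H \<in> faces_over \<Delta> G (Suc q)}"
  define S2 where "S2 = {(F, v). F \<in> faces_over \<Delta> G (Suc q) \<and> v \<in> F \<and> F - {v} \<in> faces_over \<Delta> G q}"
  have ysupp: "F \<in> faces_over \<Delta> G (Suc q)" if "y F \<noteq> 0" for F
    using supp_inD[OF y] that by blast
  have xsupp: "F \<in> faces_over \<Delta> G q" if "x F \<noteq> 0" for F
    using supp_inD[OF x] that by blast
  have finV: "finite V"
    unfolding V_def by (rule finite_vertices[OF \<Delta>])
  have fin: "finite (faces_over \<Delta> G r)" for r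
    by (rule finite_faces_over[OF \<Delta>])
  have finF: "finite F" "F \<subseteq> V" if "F \<in> faces_over \<Delta> G r" for F r
    using that simplicial_complexD(3)[OF \<Delta>] face_subset_vertices unfolding faces_over_def V_def by auto
  have memV: "v \<in> V" if "F \<in> faces_over \<Delta> G r" "v \<in> F" for F r v
    using finF(2) that by blast
  have "(\<Sum>H\<in>faces_over \<Delta> G q. rbd V G y H * x H) =
      (\<Sum>H\<in>faces_over \<Delta> G q. \<Sum>v\<in>V - H. incidence v (insert v H) * y (insert v H) * x H)"
    unfolding rbd_def by (intro sum.cong) (auto simp: faces_over_def sum_distrib_right)
  also have "\<dots> = (\<Sum>(H, v)\<in>(SIGMA H:faces_over \<Delta> G q. V - H). incidence v (insert v H) * y (insert v H) * x H)"
    using fin finV by (intro sum.Sigma) auto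
  also have "\<dots> = (\<Sum>(H, v)\<in>S1. incidence v (insert v H) * y (insert v H) * x H)"
    by (rule sum.mono_neutral_right) (use fin finV in \<open>auto simp: S1_def intro: ysupp\<close>)
  also have "\<dots> = (\<Sum>(F, v)\<in>S2. y F * (incidence v F * x (F - {v})))"
    by (rule sum.reindex_bij_witness[where i = "\<lambda>(F, v). (F - {v}, v)" and j = "\<lambda>(H, v). (insert v H, v)"])
      (auto simp: S1_def S2_def insert_absorb dest: memV)
  also have "\<dots> = (\<Sum>(F, v)\<in>(SIGMA F:faces_over \<Delta> G (Suc q). F). y F * (incidence v F * x (F - {v})))"
  proof (rule sum.mono_neutral_left)
    show "finite (SIGMA F:faces_over \<Delta> G (Suc q). F)"
      using fin finF by blast
  qed (auto simp: S2_def intro: xsupp)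
  also have "\<dots> = (\<Sum>F\<in>faces_over \<Delta> G (Suc q). \<Sum>v\<in>F. y F * (incidence v F * x (F - {v})))"
    using fin finF by (intro sum.Sigma[symmetric]) blast+
  also have "\<dots> = (\<Sum>F\<in>faces_over \<Delta> G (Suc q). y F * coboundary \<Delta> x F)"
    unfolding coboundary_def by (intro sum.cong) (auto simp: faces_over_def sum_distrib_left)
  finally show ?thesis
    unfolding V_def .
qed

text \<open>Coboundaries become the annihilator of relative cycles, so the cohomology groups in the
  kernel term can be replaced by conditions on chains.\<close>

lemma coboundary_image_eq_perp:
  assumes \<Delta>: "simplicial_complex \<Delta>"
  shows "coboundary \<Delta> ` supp_in (faces_over \<Delta> G q) =
    perp (faces_over \<Delta> G (Suc q)) {y\<in>supp_in (faces_over \<Delta> G (Suc q)). rbd (vertices \<Delta>) G y = (0 :: _ \<Rightarrow> 'k::field)}"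
  by (rule image_adjoint_eq_perp_kernel[OF finite_faces_over[OF \<Delta>] finite_faces_over[OF \<Delta>] rbd_linear _
        coboundary_linear _ rbd_coboundary_adjoint[OF \<Delta>]])
    (use rbd_supp_in[OF \<Delta>] coboundary_supp_in[OF \<Delta>] in blast)+

lemma rel_cochains_contrastar:
  "rel_cochains \<Delta> (contrastar \<Delta> v) (int q - 1) = supp_in (faces_over \<Delta> {v} q)"
  unfolding rel_cochains_def chains_def contrastar_def supp_in_def faces_over_def by auto

lemma rel_cochains_empty: "rel_cochains \<Delta> {} (int q - 1) = supp_in (faces_over \<Delta> {} q)"
  unfolding rel_cochains_def chains_def supp_in_def faces_over_def by auto

section \<open>The kernel term\<close>

context face_vectors
begin

section \<open>One-forms and the sum of relative chain complexes\<close>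

text \<open>For one-forms every contraction is a scalar, stored at the empty index set. All vertices
  can then be treated at once: the fully constrained complex for \<open>e = 1\<close> is the kernel
  of this map, and the direct sum \<open>Y\<close> of relative chain groups is its image.\<close>

definition jota :: "('v set \<Rightarrow> 'i set \<Rightarrow> 'k) \<Rightarrow> 'v \<Rightarrow> 'v set \<Rightarrow> 'k" where
  "jota c = (\<lambda>v F. if v \<in> V then iota v c F {} else 0)"

definition Y :: "nat \<Rightarrow> ('v \<Rightarrow> 'v set \<Rightarrow> 'k) set" where
  "Y q = fam_prod V (\<lambda>v. supp_in (faces {v} q))"

lemma jota_linear: "Vector_Spaces.linear fam_scale fam_scale jota"
  unfolding Vector_Spaces.linear_iff
  by (auto simp: vector_space_fam_scale jota_def iota_def fun_eq_iff fam_scale_def contract_def distrib_left sum.distrib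
      sum_distrib_left mult.left_commute)

lemma forms_0_eq: "w \<in> forms N 0 \<Longrightarrow> J \<noteq> {} \<Longrightarrow> w J = 0"
proof (rule supp_inD[of w "{J. J \<subseteq> N \<and> card J = 0}"])
  assume "J \<noteq> {}"
  then show "J \<notin> {J. J \<subseteq> N \<and> card J = 0}"
    using finite_subset[OF _ finite_N, of J] by auto
qed (simp add: forms_def)

lemma iota_nonempty:
  assumes "c \<in> X {} S 1 q" "J \<noteq> {}"
  shows "iota v c F J = 0"
proof -
  have "iota v c \<in> X {v} S 0 q"
    using iota_mem[of c "{}" S 0 q v] assms(1) by simp
  then show ?thesis
    using X_mem_kforms[of "iota v c" "{v}" S 0 q F] X_mem_zero[of "iota v c" "{v}" S 0 q F] forms_0_eq[OF _ assms(2)]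
    unfolding kforms_def by (cases "F \<in> faces {v} q") auto
qed

lemma iota_zero_iff_jota:
  assumes "c \<in> X {} S 1 q" "v \<in> V"
  shows "iota v c = 0 \<longleftrightarrow> jota c v = 0"
proof
  assume "jota c v = 0"
  then have "iota v c F {} = 0" for F
    using assms(2) unfolding jota_def by (auto simp: fun_eq_iff)
  then have "iota v c F J = 0" for F J
    using iota_nonempty[OF assms(1)] by (cases "J = {}") auto
  then show "iota v c = 0" by (auto simp: fun_eq_iff)
qed (auto simp: jota_def)

lemma T_iff_iota: "c \<in> T e q \<longleftrightarrow> c \<in> X {} {} e q \<and> (\<forall>v\<in>V. iota v c = 0)"
proof -
  have "c \<in> X {} S e q \<longleftrightarrow> c \<in> X {} {} e q \<and> (\<forall>v\<in>S. iota v c = 0)" if "finite S" for S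
    using that
  proof (induction S rule: finite_induct)
    case empty
    show ?case by simp
  next
    case (insert x F)
    then show ?case
      unfolding X_insert_iff by blast
  qed
  then show ?thesis
    unfolding T_def using finite_V by blast
qed

lemma T_iff_jota: "c \<in> T 1 q \<longleftrightarrow> c \<in> X {} {} 1 q \<and> jota c = 0"
proof -
  have "jota c = 0 \<longleftrightarrow> (\<forall>v\<in>V. jota c v = 0)"
    unfolding jota_def by (auto simp: fun_eq_iff)
  then show ?thesis
    unfolding T_iff_iota using iota_zero_iff_jota by blast
qed

lemma jota_fbd: "v \<in> V \<Longrightarrow> jota (fbd {} c) v = rbd V {v} (jota c v)"
  unfolding jota_def by (auto simp: fun_eq_iff iota_fbd fbd_apply)

lemma jota_mem:
  assumes c: "c \<in> X {} {} 1 q"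
  shows "jota c \<in> Y q"
proof -
  have "iota v c F {} = 0" if "F \<notin> faces {v} q" for v F
  proof -
    have "iota v c \<in> X {v} {} 0 q"
      using iota_mem[of c "{}" "{}" 0 q v] c by simp
    then show ?thesis
      using X_mem_zero that by simp
  qed
  then show ?thesis
    unfolding Y_def fam_prod_def supp_in_def jota_def by (auto simp: fun_eq_iff)
qed

lemma jota_surj:
  assumes y: "y \<in> Y q"
  obtains c where "c \<in> X {} {} 1 q" "jota c = y"
proof
  \<comment> \<open>\<open>vol {}\<close> is the constant form one, so each product is just the dual
    covector of \<open>u\<close> read as a one-form; their combination has the prescribed values on
    the vectors of \<open>F\<close>.\<close>
  define c where "c F = (if F \<in> faces {} q then \<Sum>u\<in>F. fun_scale (y u F) (wedge N (dual F u) (vol {})) else 0)" for F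
  have v0: "vol {} \<in> (forms N 0 :: ('i set \<Rightarrow> 'k) set)"
    unfolding forms_def supp_in_def vol_def by auto
  have y0: "y v F = 0" if "v \<notin> V \<or> F \<notin> faces {v} q" for v F
  proof (cases "v \<in> V")
    case True
    then have "y v \<in> supp_in (faces {v} q)"
      using y unfolding Y_def fam_prod_def by (metis (mono_tags, lifting) mem_Collect_eq)
    then show ?thesis
      by (rule supp_inD) (use that True in blast)
  next
    case False
    then have "y v = 0"
      using y unfolding Y_def fam_prod_def by (metis (mono_tags, lifting) mem_Collect_eq)
    then show ?thesis by simp
  qed
  show "c \<in> X {} {} 1 q"
  proof (rule X_memI)
    fix F assume F: "F \<in> faces {} q"
    have "wedge N (dual F u) (vol {}) \<in> kforms N p ({} \<union> (F \<inter> {})) 1" for u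
      using wedge_forms[OF finite_N v0] unfolding kforms_def by simp
    then show "c F \<in> kforms N p ({} \<union> (F \<inter> {})) 1"
      unfolding c_def using F
      by (auto intro!: funs.subspace_sum[OF kforms_subspace] funs.subspace_scale[OF kforms_subspace])
  qed (simp add: c_def)
  show "jota c = y"
  proof (intro ext)
    fix v F
    show "jota c v F = y v F"
    proof (cases "v \<in> V \<and> F \<in> faces {v} q")
      case True
      then have F: "F \<in> \<Delta>" "v \<in> F" "F \<in> faces {} q" and v: "v \<in> V"
        unfolding faces_over_def by auto
      have "contract N (p v) (wedge N (dual F u) (vol {})) {} = (if u = v then 1 else 0)" if "u \<in> F" for u
        using contract_wedge_lift[OF finite_N forms_Pow[OF v0] contract_forms_0[OF finite_N v0], of "p v" "dual F u"]
          dual_basis_dual[OF F(1)] that F(2)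
        unfolding dual_basis_def by (simp add: fun_scale_def vol_def)
      then have "contract N (p v) (c F) {} = (\<Sum>u\<in>F. if u = v then y u F else 0)"
        using F(3) unfolding c_def
        by (simp add: contract_sum contract_scale sum_apply_fun) (auto intro!: sum.cong simp: fun_scale_def)
      also have "\<dots> = y v F"
        using F(2) finite_face[OF F(1)] by simp
      finally show ?thesis
        unfolding jota_def iota_def using v F(2) by simp
    next
      case False
      then have "y v F = 0"
        using y0 by blast
      moreover have "v \<in> V \<Longrightarrow> v \<in> F \<Longrightarrow> c F = 0"
        using False unfolding c_def faces_over_def by auto
      then have "jota c v F = 0"
        unfolding jota_def iota_def by (auto simp: contract_0)
      ultimately show ?thesis by simp
    qed
  qed
qed

definition Zc :: "nat \<Rightarrow> ('v set \<Rightarrow> 'i set \<Rightarrow> 'k) set" where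
  "Zc q = {c\<in>X {} {} 1 q. fbd {} c = 0}"

definition Zrel :: "nat \<Rightarrow> ('v \<Rightarrow> 'v set \<Rightarrow> 'k) set" where
  "Zrel q = {y\<in>Y q. \<forall>v\<in>V. rbd V {v} (y v) = 0}"

text \<open>A snake lemma in dimensions: the homology of the kernel complex at \<open>q\<close> has
  the dimension of the relative cycles at \<open>Suc q\<close> modulo the images of cycles with
  coefficients in one-forms.\<close>

lemma dim_connecting:
  assumes ac: "acyclic_at {} {} 1 q"
  shows "fams.dim (T_cycles 1 q) + fams.dim (jota ` Zc (Suc q)) =
    fams.dim (fbd {} ` T 1 (Suc q)) + fams.dim (Zrel (Suc q))" and "fams.findim (Zrel (Suc q))"
proof -
  \<comment> \<open>Chains with boundary in the kernel complex, equivalently with relative cycles as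
    image. Applying rank and nullity to \<open>A\<close> under \<open>fbd\<close> and under
    \<open>jota\<close> replaces the connecting homomorphism.\<close>
  define A where "A = {c\<in>X {} {} 1 (Suc q). fbd {} c \<in> T 1 q}"
  have A_iff: "c \<in> A \<longleftrightarrow> c \<in> X {} {} 1 (Suc q) \<and> (\<forall>v\<in>V. rbd V {v} (jota c v) = 0)" for c
  proof -
    have "fbd {} c \<in> T 1 q \<longleftrightarrow> (\<forall>v\<in>V. rbd V {v} (jota c v) = 0)" if c: "c \<in> X {} {} 1 (Suc q)"
      using iota_zero_iff_jota[OF fbd_mem[OF c]] fbd_mem[OF c] unfolding T_iff_iota by (auto simp: jota_fbd)
    then show ?thesis
      unfolding A_def by blast
  qed
  have TA: "T 1 (Suc q) \<subseteq> A"
    unfolding A_def using T_iff_jota fbd_mem unfolding T_def by blast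
  have "fams.subspace A"
  proof -
    have "fams.subspace (T 1 q)"
      unfolding T_def by (rule X_subspace)
    then show ?thesis
      using X_subspace[of "{}" "{}" 1 "Suc q"] unfolding A_def fams.subspace_def
      by (auto simp: fams_pair.linear_0[OF fbd_linear] fams_pair.linear_add[OF fbd_linear] fams_pair.linear_scale[OF fbd_linear])
  qed
  then have Afd: "fams.findim A"
    by (rule fams.findim_subset[OF X_findim]) (auto simp: A_def)
  have Zfd: "fams.findim (Zc (Suc q))"
    unfolding Zc_def by (rule fams_pair.findim_kernel[OF fbd_linear X_findim])
  have T0: "0 \<in> T 1 q"
    unfolding T_def using fams.subspace_0[OF X_subspace] .
  have 1: "fbd {} ` A = T_cycles 1 q"
  proof
    show "fbd {} ` A \<subseteq> T_cycles 1 q"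
      unfolding A_def T_cycles_def using fbd_fbd by auto
    show "T_cycles 1 q \<subseteq> fbd {} ` A"
    proof
      fix t assume t: "t \<in> T_cycles 1 q"
      then have "t \<in> X {} {} 1 q" "fbd {} t = 0"
        unfolding T_cycles_def using T_iff_jota by auto
      then obtain c where "c \<in> X {} {} 1 (Suc q)" "t = fbd {} c"
        using ac unfolding acyclic_at_def by blast
      then show "t \<in> fbd {} ` A"
        using t unfolding A_def T_cycles_def by blast
    qed
  qed
  have 2: "{c\<in>A. fbd {} c = 0} = Zc (Suc q)"
    unfolding A_def Zc_def using T0 by auto
  have 3: "{c\<in>A. jota c = 0} = T 1 (Suc q)"
    using TA T_iff_jota unfolding A_def by blast
  have 4: "{c\<in>Zc (Suc q). jota c = 0} = T_cycles 1 (Suc q)"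
    unfolding Zc_def T_cycles_def using T_iff_jota by blast
  have 5: "jota ` A = Zrel (Suc q)"
  proof
    show "jota ` A \<subseteq> Zrel (Suc q)"
      using A_iff jota_mem unfolding Zrel_def by blast
    show "Zrel (Suc q) \<subseteq> jota ` A"
    proof
      fix y assume y: "y \<in> Zrel (Suc q)"
      then obtain c where "c \<in> X {} {} 1 (Suc q)" "jota c = y"
        using jota_surj unfolding Zrel_def by blast
      then show "y \<in> jota ` A"
        using y A_iff unfolding Zrel_def by blast
    qed
  qed
  have "fams.dim A = fams.dim (Zc (Suc q)) + fams.dim (T_cycles 1 q)"
    using fams_pair.rank_nullity[OF fbd_linear[of "{}"] Afd] unfolding 1 2 .
  moreover have "fams.dim A = fams.dim (T 1 (Suc q)) + fams.dim (Zrel (Suc q))"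
    using fams_pair.rank_nullity[OF jota_linear Afd] unfolding 3 5 .
  moreover have "fams.dim (Zc (Suc q)) = fams.dim (T_cycles 1 (Suc q)) + fams.dim (jota ` Zc (Suc q))"
    using fams_pair.rank_nullity[OF jota_linear Zfd] unfolding 4 .
  ultimately show "fams.dim (T_cycles 1 q) + fams.dim (jota ` Zc (Suc q)) =
      fams.dim (fbd {} ` T 1 (Suc q)) + fams.dim (Zrel (Suc q))"
    using T_rank_nullity_Suc[of 1 q] by simp
  show "fams.findim (Zrel (Suc q))"
    using fams_pair.findim_image[OF jota_linear Afd] unfolding 5 .
qed

section \<open>Dualising to the intersection of kernels\<close>

definition P :: "nat \<Rightarrow> ('v \<times> 'v set) set" where
  "P q = (SIGMA v:V. faces {v} q)"

abbreviation fam_pairing :: "nat \<Rightarrow> ('v \<Rightarrow> 'v set \<Rightarrow> 'k) \<Rightarrow> ('v \<Rightarrow> 'v set \<Rightarrow> 'k) \<Rightarrow> 'k" where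
  "fam_pairing q y z \<equiv> \<Sum>v\<in>V. \<Sum>F\<in>faces {v} q. y v F * z v F"

lemma finite_P: "finite (P q)"
  unfolding P_def using finite_V finite_faces_over[OF complex] by blast

lemma sum_P: "(\<Sum>x\<in>P q. case_prod y x * case_prod z x) = fam_pairing q y z"
  unfolding P_def by (subst sum.Sigma) (auto simp: finite_V finite_faces_over[OF complex] case_prod_unfold)

lemma Y_iff: "y \<in> Y q \<longleftrightarrow> case_prod y \<in> supp_in (P q)"
  unfolding Y_def fam_prod_def supp_in_def P_def by (auto simp: fun_eq_iff)

lemma Y_mem: "y \<in> Y q \<Longrightarrow> v \<in> V \<Longrightarrow> y v \<in> supp_in (faces {v} q)"
  unfolding Y_def fam_prod_def by (metis (mono_tags, lifting) mem_Collect_eq)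

lemma Y_outside: "y \<in> Y q \<Longrightarrow> v \<notin> V \<Longrightarrow> y v = 0"
  unfolding Y_def fam_prod_def by (metis (mono_tags, lifting) mem_Collect_eq)

lemma perp_case_prod:
  "perp (P q) (case_prod ` U) = case_prod ` {z\<in>Y q. \<forall>y\<in>U. fam_pairing q y z = 0}"
proof (intro equalityI subsetI)
  fix g assume g: "g \<in> perp (P q) (case_prod ` U)"
  have "g = case_prod (curry g)" by simp
  moreover have "curry g \<in> Y q" "\<forall>y\<in>U. fam_pairing q y (curry g) = 0"
    using g unfolding perp_def Y_iff sum_P[symmetric] by auto
  ultimately show "g \<in> case_prod ` {z\<in>Y q. \<forall>y\<in>U. fam_pairing q y z = 0}"
    by blast
qed (auto simp: perp_def Y_iff sum_P)

lemma dim_perp_fams: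
  assumes "fams.findim U" "U \<subseteq> Y q"
  shows "fams.dim U + fams.dim {z\<in>Y q. \<forall>y\<in>U. fam_pairing q y z = 0} = card (P q)"
proof -
  define W where "W = {z\<in>Y q. \<forall>y\<in>U. fam_pairing q y z = 0}"
  have Yfd: "fams.findim (Y q)"
    unfolding Y_def by (rule fam_prod_dim(1)) (auto intro: finite_V supp_in_dim(1) finite_faces_over[OF complex])
  have "fams.subspace W"
  proof -
    have "(\<Sum>v\<in>V. \<Sum>F\<in>faces {v} q. y v F * (r * z v F)) =
        r * fam_pairing q y z" for y z :: "'v \<Rightarrow> 'v set \<Rightarrow> 'k" and r
      by (simp add: sum_distrib_left mult.left_commute)
    then show ?thesis
      using fams.findim_subspace[OF Yfd] unfolding W_def fams.subspace_def
      by (auto simp: fam_scale_def distrib_left sum.distrib)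
  qed
  then have Wfd: "fams.findim W"
    by (rule fams.findim_subset[OF Yfd]) (auto simp: W_def)
  have "case_prod ` U \<subseteq> supp_in (P q)"
    using assms(2) Y_iff by blast
  then have "funs.dim (case_prod ` U) + funs.dim (case_prod ` W) = card (P q)"
    using perp_dim[OF finite_P] fams_dim_uncurry(2)[OF assms(1)] funs.findim_subspace
    unfolding W_def perp_case_prod[symmetric] by blast
  then have "fams.dim U + fams.dim W = card (P q)"
    unfolding fams_dim_uncurry(1)[OF assms(1)] fams_dim_uncurry(1)[OF Wfd] .
  then show ?thesis
    unfolding W_def .
qed

text \<open>The common denominator is the annihilator of the families of relative cycles; dimension
  \<open>q\<close> corresponds to cardinality \<open>Suc q\<close>.\<close>

lemma rel_coboundary_families_eq:
  "rel_coboundary_families \<Delta> (int q) =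
    {z\<in>Y (Suc q). \<forall>y\<in>Zrel (Suc q). fam_pairing (Suc q) y z = 0}"
proof -
  have rc: "rel_coboundaries \<Delta> (contrastar \<Delta> v) (int q) =
      perp (faces {v} (Suc q)) {y\<in>supp_in (faces {v} (Suc q)). rbd V {v} y = (0 :: _ \<Rightarrow> 'k)}" for v
    unfolding rel_coboundaries_def rel_cochains_contrastar coboundary_image_eq_perp[OF complex] ..
  show ?thesis
  proof (intro equalityI subsetI)
    fix z :: "'v \<Rightarrow> 'v set \<Rightarrow> 'k" assume z: "z \<in> rel_coboundary_families \<Delta> (int q)"
    then have zp: "z v \<in> perp (faces {v} (Suc q)) {y\<in>supp_in (faces {v} (Suc q)). rbd V {v} y = 0}" if "v \<in> V" for v
      using that unfolding rel_coboundary_families_def rc by blast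
    have zV: "z v = 0" if "v \<notin> V" for v
      using z that unfolding rel_coboundary_families_def by blast
    have "z \<in> Y (Suc q)"
      using zp zV unfolding Y_def fam_prod_def perp_def by auto
    moreover have "fam_pairing (Suc q) y z = 0" if y: "y \<in> Zrel (Suc q)" for y
    proof (rule sum.neutral, rule ballI)
      fix v assume v: "v \<in> V"
      then have "y v \<in> supp_in (faces {v} (Suc q))" "rbd V {v} (y v) = 0"
        using y Y_mem unfolding Zrel_def by auto
      then show "(\<Sum>F\<in>faces {v} (Suc q). y v F * z v F) = 0"
        using zp[OF v] unfolding perp_def by blast
    qed
    ultimately show "z \<in> {z\<in>Y (Suc q). \<forall>y\<in>Zrel (Suc q). fam_pairing (Suc q) y z = 0}"
      by blast
  next
    fix z assume z: "z \<in> {z\<in>Y (Suc q). \<forall>y\<in>Zrel (Suc q). fam_pairing (Suc q) y z = 0}"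
    have "z v \<in> perp (faces {v} (Suc q)) {y\<in>supp_in (faces {v} (Suc q)). rbd V {v} y = 0}" if v: "v \<in> V" for v
    proof -
      have "(\<Sum>F\<in>faces {v} (Suc q). y F * z v F) = 0"
        if y: "y \<in> supp_in (faces {v} (Suc q))" "rbd V {v} y = 0" for y
      proof -
        \<comment> \<open>A family concentrated at one vertex isolates the condition at that
          vertex.\<close>
        define y' where "y' u = (if u = v then y else 0)" for u
        have rbd0: "rbd V {u} (0 :: 'v set \<Rightarrow> 'k) = 0" for u
          by (rule funs_pair.linear_0[OF rbd_linear])
        have "y' \<in> Y (Suc q)"
          using v y(1) funs.subspace_0[OF supp_in_subspace] unfolding y'_def Y_def fam_prod_def by auto
        then have "y' \<in> Zrel (Suc q)"
          unfolding Zrel_def using y(2) rbd0 by (auto simp: y'_def)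
        then have "0 = (\<Sum>u\<in>V. \<Sum>F\<in>faces {u} (Suc q). y' u F * z u F)"
          using z by simp
        also have "\<dots> = (\<Sum>u\<in>V. if u = v then \<Sum>F\<in>faces {u} (Suc q). y F * z u F else 0)"
          unfolding y'_def by (intro sum.cong) auto
        also have "\<dots> = (\<Sum>F\<in>faces {v} (Suc q). y F * z v F)"
          using v finite_V by simp
        finally show ?thesis by simp
      qed
      then show ?thesis
        using z v Y_mem unfolding perp_def by blast
    qed
    then show "z \<in> rel_coboundary_families \<Delta> (int q)"
      using z Y_outside unfolding rel_coboundary_families_def rc by blast
  qed
qed

text \<open>The adjoint of \<open>jota\<close> sends \<open>z\<close> to the tuple over
  \<open>j\<close> of the sums of \<open>p v j\<close> times \<open>z v\<close>. These are the maps
  whose kernels are intersected, one for each linear form.\<close>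

lemma pairing_jota:
  assumes c: "c \<in> X {} {} 1 q" and z: "z \<in> Y q"
  shows "fam_pairing q (jota c) z =
    (\<Sum>j\<in>N. \<Sum>F\<in>faces {} q. c F {j} * (\<Sum>v\<in>V. fun_scale (p v j) (z v)) F)"
proof -
  have "(\<Sum>F\<in>faces {v} q. jota c v F * z v F) =
      (\<Sum>F\<in>faces {} q. \<Sum>j\<in>N. c F {j} * (p v j * z v F))" if v: "v \<in> V" for v
  proof (rule sum.mono_neutral_cong_left)
    show "faces {v} q \<subseteq> faces {} q"
      unfolding faces_over_def by blast
    show "\<forall>F\<in>faces {} q - faces {v} q. (\<Sum>j\<in>N. c F {j} * (p v j * z v F)) = 0"
      using supp_inD[OF Y_mem[OF z v]] by simp
    fix F assume F: "F \<in> faces {v} q"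
    then have "jota c v F = (\<Sum>j\<in>N. p v j * c F {j})"
      unfolding jota_def iota_def contract_def using v
      by (simp add: faces_over_def incidence_singleton)
    then show "jota c v F * z v F = (\<Sum>j\<in>N. c F {j} * (p v j * z v F))"
      by (simp add: sum_distrib_left mult_ac)
  qed (rule finite_faces_over[OF complex])
  then have "fam_pairing q (jota c) z =
      (\<Sum>v\<in>V. \<Sum>F\<in>faces {} q. \<Sum>j\<in>N. c F {j} * (p v j * z v F))"
    by simp
  also have "\<dots> = (\<Sum>F\<in>faces {} q. \<Sum>v\<in>V. \<Sum>j\<in>N. c F {j} * (p v j * z v F))"
    by (rule sum.swap)
  also have "\<dots> = (\<Sum>F\<in>faces {} q. \<Sum>j\<in>N. \<Sum>v\<in>V. c F {j} * (p v j * z v F))"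
    by (intro sum.cong refl sum.swap)
  also have "\<dots> = (\<Sum>j\<in>N. \<Sum>F\<in>faces {} q. \<Sum>v\<in>V. c F {j} * (p v j * z v F))"
    by (rule sum.swap)
  finally show ?thesis
    by (simp add: sum_apply_fun fun_scale_def sum_distrib_left)
qed

text \<open>Annihilating images of boundaries amounts to the cocycle condition at each vertex;
  annihilating images of cycles concentrated in the coordinate \<open>j\<close> amounts to the
  coboundary condition for the form \<open>j\<close>.\<close>

lemma kernel_families_inter_eq:
  assumes N: "N \<noteq> {}"
  shows "(\<Inter>j\<in>N. kernel_families \<Delta> (int q) (\<lambda>v. p v j)) =
    {z\<in>Y (Suc q). \<forall>y\<in>jota ` Zc (Suc q). fam_pairing (Suc q) y z = 0}"
proof -
  have rcb: "rel_coboundaries \<Delta> {} (int q) =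
      perp (faces {} (Suc q)) {y\<in>supp_in (faces {} (Suc q)). rbd V {} y = (0 :: _ \<Rightarrow> 'k)}"
    unfolding rel_coboundaries_def rel_cochains_empty coboundary_image_eq_perp[OF complex] ..
  have rcoch: "rel_cochains \<Delta> (contrastar \<Delta> v) (int q) = (supp_in (faces {v} (Suc q)) :: ('v set \<Rightarrow> 'k) set)" for v
    using rel_cochains_contrastar[of \<Delta> v "Suc q"] by simp
  show ?thesis
  proof (intro equalityI subsetI)
    fix z assume z: "z \<in> (\<Inter>j\<in>N. kernel_families \<Delta> (int q) (\<lambda>v. p v j))"
    then have zv: "\<And>v. v \<in> V \<Longrightarrow> z v \<in> supp_in (faces {v} (Suc q))" and z0: "\<And>v. v \<notin> V \<Longrightarrow> z v = 0"
      using N unfolding kernel_families_def rel_cocycles_def rcoch by auto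
    have zk: "(\<Sum>v\<in>V. fun_scale (p v j) (z v)) \<in>
        perp (faces {} (Suc q)) {y\<in>supp_in (faces {} (Suc q)). rbd V {} y = 0}" if "j \<in> N" for j
      using z that unfolding kernel_families_def rcb by blast
    have zY: "z \<in> Y (Suc q)"
      using zv z0 unfolding Y_def fam_prod_def by auto
    have "fam_pairing (Suc q) (jota c) z = 0" if c: "c \<in> Zc (Suc q)" for c
    proof -
      have cX: "c \<in> X {} {} 1 (Suc q)" and c0: "fbd {} c = 0"
        using c unfolding Zc_def by auto
      have "(\<Sum>F\<in>faces {} (Suc q). c F {j} * (\<Sum>v\<in>V. fun_scale (p v j) (z v)) F) = 0" if j: "j \<in> N" for j
      proof -
        have "(\<lambda>F. c F {j}) \<in> supp_in (faces {} (Suc q))"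
          using X_mem_zero[OF cX] unfolding supp_in_def by simp
        moreover have "rbd V {} (\<lambda>F. c F {j}) = 0"
          using c0 by (auto simp: fun_eq_iff fbd_apply)
        ultimately have "(\<lambda>F. c F {j}) \<in> {y\<in>supp_in (faces {} (Suc q)). rbd V {} y = 0}"
          by blast
        moreover have "\<forall>f\<in>{y\<in>supp_in (faces {} (Suc q)). rbd V {} y = 0}.
            (\<Sum>F\<in>faces {} (Suc q). f F * (\<Sum>v\<in>V. fun_scale (p v j) (z v)) F) = 0"
          using zk[OF j] unfolding perp_def by blast
        ultimately show ?thesis
          by (rule bspec[rotated])
      qed
      then show ?thesis
        unfolding pairing_jota[OF cX zY] by simp
    qed
    then show "z \<in> {z\<in>Y (Suc q). \<forall>y\<in>jota ` Zc (Suc q). fam_pairing (Suc q) y z = 0}"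
      using zY by blast
  next
    fix z assume "z \<in> {z\<in>Y (Suc q). \<forall>y\<in>jota ` Zc (Suc q). fam_pairing (Suc q) y z = 0}"
    then have zY: "z \<in> Y (Suc q)"
      and zc: "\<And>c. c \<in> Zc (Suc q) \<Longrightarrow> fam_pairing (Suc q) (jota c) z = 0"
      by auto
    have "coboundary \<Delta> (z v) = 0" if v: "v \<in> V" for v
    proof -
      \<comment> \<open>The indicator of \<open>F0\<close> at the vertex \<open>v\<close>. Its lift
        has a boundary in \<open>Zc\<close>, and pairing with that boundary returns one value of the
        coboundary of \<open>z v\<close>.\<close>
      define y where "y F0 u = (\<lambda>F. if u = v \<and> F = F0 then 1 else 0 :: 'k)" for F0 :: "'v set" and u
      have "coboundary \<Delta> (z v) F0 = 0" if F0: "F0 \<in> faces {v} (Suc (Suc q))" for F0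
      proof -
        have yY: "y F0 \<in> Y (Suc (Suc q))"
          using v F0 unfolding Y_def fam_prod_def supp_in_def y_def by (auto simp: fun_eq_iff)
        then obtain c where c: "c \<in> X {} {} 1 (Suc (Suc q))" "jota c = y F0"
          using jota_surj by blast
        have "fbd {} c \<in> Zc (Suc q)"
          using fbd_mem[OF c(1)] fbd_fbd[OF c(1)] unfolding Zc_def by blast
        then have "0 = (\<Sum>u\<in>V. \<Sum>F\<in>faces {u} (Suc q). jota (fbd {} c) u F * z u F)"
          using zc by simp
        also have "\<dots> = (\<Sum>u\<in>V. \<Sum>F\<in>faces {u} (Suc q). rbd V {u} (y F0 u) F * z u F)"
          using jota_fbd c(2) by simp
        also have "\<dots> = (\<Sum>u\<in>V. \<Sum>F\<in>faces {u} (Suc (Suc q)). y F0 u F * coboundary \<Delta> (z u) F)"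
          by (rule sum.cong[OF refl], rule rbd_coboundary_adjoint[OF complex]) (use Y_mem yY zY in blast)+
        also have "\<dots> = (\<Sum>u\<in>V. if u = v then \<Sum>F\<in>faces {u} (Suc (Suc q)). if F = F0 then coboundary \<Delta> (z u) F else 0 else 0)"
          unfolding y_def by (intro sum.cong refl) (auto intro!: sum.cong)
        also have "\<dots> = (\<Sum>F\<in>faces {v} (Suc (Suc q)). if F = F0 then coboundary \<Delta> (z v) F else 0)"
          using v finite_V by simp
        also have "\<dots> = coboundary \<Delta> (z v) F0"
          using F0 finite_faces_over[OF complex] by simp
        finally show ?thesis by simp
      qed
      moreover have "coboundary \<Delta> (z v) F = 0" if "F \<notin> faces {v} (Suc (Suc q))" for F
        using supp_inD[OF coboundary_supp_in[OF complex Y_mem[OF zY v]]] that by blast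
      ultimately show ?thesis by (auto simp: fun_eq_iff)
    qed
    then have "z v \<in> rel_cocycles \<Delta> (contrastar \<Delta> v) (int q)" if "v \<in> V" for v
      using that Y_mem[OF zY] unfolding rel_cocycles_def rcoch by blast
    moreover have "z v = 0" if "v \<notin> V" for v
      using Y_outside[OF zY that] .
    moreover have "(\<Sum>v\<in>V. fun_scale (p v j) (z v)) \<in> rel_coboundaries \<Delta> {} (int q)" if j: "j \<in> N" for j
    proof -
      have "(\<Sum>F\<in>faces {} (Suc q). y F * (\<Sum>v\<in>V. fun_scale (p v j) (z v)) F) = 0"
        if y: "y \<in> supp_in (faces {} (Suc q))" "rbd V {} y = 0" for y
      proof -
        \<comment> \<open>The scalar cycle \<open>y\<close> placed in the coordinate
          \<open>j\<close> of the one-forms.\<close>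
        define c where "c F J = (if J = {j} then y F else 0)" for F J
        have cX: "c \<in> X {} {} 1 (Suc q)"
        proof (rule X_memI)
          fix F
          show "c F \<in> kforms N p ({} \<union> (F \<inter> {})) 1"
            using j unfolding kforms_def forms_def supp_in_def c_def by auto
        next
          fix F assume "F \<notin> faces {} (Suc q)"
          then show "c F = 0"
            using supp_inD[OF y(1)] unfolding c_def by (auto simp: fun_eq_iff)
        qed
        have "fbd {} c H J = 0" for H J
        proof (cases "J = {j}")
          case True
          then show ?thesis
            using y(2) unfolding fbd_apply c_def by (simp add: fun_eq_iff)
        next
          case False
          then show ?thesis
            unfolding fbd_apply c_def rbd_def by simp
        qed
        then have "fbd {} c = 0" by (auto simp: fun_eq_iff)
        then have "0 = (\<Sum>i\<in>N. \<Sum>F\<in>faces {} (Suc q). c F {i} * (\<Sum>v\<in>V. fun_scale (p v i) (z v)) F)"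
          using zc[of c] cX pairing_jota[OF cX zY] unfolding Zc_def by simp
        also have "\<dots> = (\<Sum>i\<in>N. if i = j then \<Sum>F\<in>faces {} (Suc q). y F * (\<Sum>v\<in>V. fun_scale (p v i) (z v)) F else 0)"
          by (intro sum.cong refl) (auto simp: c_def)
        also have "\<dots> = (\<Sum>F\<in>faces {} (Suc q). y F * (\<Sum>v\<in>V. fun_scale (p v j) (z v)) F)"
          using j finite_N by simp
        finally show ?thesis by simp
      qed
      moreover have "(\<Sum>v\<in>V. fun_scale (p v j) (z v)) \<in> supp_in (faces {} (Suc q))"
      proof (intro funs.subspace_sum[OF supp_in_subspace] funs.subspace_scale[OF supp_in_subspace])
        fix v assume "v \<in> V"
        then show "z v \<in> supp_in (faces {} (Suc q))"
          using Y_mem[OF zY] unfolding supp_in_def faces_over_def by auto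
      qed
      ultimately show ?thesis
        unfolding rcb perp_def by blast
    qed
    ultimately show "z \<in> (\<Inter>j\<in>N. kernel_families \<Delta> (int q) (\<lambda>v. p v j))"
      unfolding kernel_families_def by blast
  qed
qed

lemma dim_kernel_families:
  assumes ac: "acyclic_at {} {} 1 q" and N: "N \<noteq> {}"
  shows "int (fams.dim (T_cycles 1 q)) - int (fams.dim (fbd {} ` T 1 (Suc q))) =
    int (quot_dim fam_scale (\<Inter>j\<in>N. kernel_families \<Delta> (int q) (\<lambda>v. p v j)) (rel_coboundary_families \<Delta> (int q)))"
proof -
  have Zfd: "fams.findim (Zc (Suc q))"
    unfolding Zc_def by (rule fams_pair.findim_kernel[OF fbd_linear X_findim])
  have "jota ` Zc (Suc q) \<subseteq> Y (Suc q)"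
    using jota_mem unfolding Zc_def by blast
  then have 1: "fams.dim (jota ` Zc (Suc q)) +
      fams.dim (\<Inter>j\<in>N. kernel_families \<Delta> (int q) (\<lambda>v. p v j)) = card (P (Suc q))"
    using dim_perp_fams[OF fams_pair.findim_image[OF jota_linear Zfd]] unfolding kernel_families_inter_eq[OF N] by blast
  have "Zrel (Suc q) \<subseteq> Y (Suc q)"
    unfolding Zrel_def by blast
  then have 2: "fams.dim (Zrel (Suc q)) +
      fams.dim (rel_coboundary_families \<Delta> (int q) :: ('v \<Rightarrow> 'v set \<Rightarrow> 'k) set) = card (P (Suc q))"
    using dim_perp_fams[OF dim_connecting(2)[OF ac]] unfolding rel_coboundary_families_eq by blast
  \<comment> \<open>The resulting inequality of dimensions ensures that the truncated subtraction in
    \<open>quot_dim\<close> is a genuine difference.\<close>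
  have "jota ` Zc (Suc q) \<subseteq> Zrel (Suc q)"
  proof
    fix y assume "y \<in> jota ` Zc (Suc q)"
    then obtain c where c: "c \<in> X {} {} 1 (Suc q)" "fbd {} c = 0" "y = jota c"
      unfolding Zc_def by blast
    have "rbd V {v} (jota c v) = 0" if "v \<in> V" for v
      using jota_fbd[OF that, of c] fams_pair.linear_0[OF jota_linear] c(2) by simp
    then show "y \<in> Zrel (Suc q)"
      using jota_mem c unfolding Zrel_def by blast
  qed
  then have "fams.dim (jota ` Zc (Suc q)) \<le> fams.dim (Zrel (Suc q))"
    by (intro fams.dim_le_of_findim[OF dim_connecting(2)[OF ac]] fams.findim_subspace
        fams_pair.findim_image[OF jota_linear Zfd])
  then show ?thesis
    using 1 2 dim_connecting(1)[OF ac] unfolding quot_dim_def by linarith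
qed

text \<open>Forms of degree zero are scalars without annihilation conditions, and there are no faces
  of size \<open>d + 1\<close>, so cycles in top degree are already homology classes.\<close>

lemma dim_T_cycles_betti:
  assumes d: "card N = d"
  shows "fams.dim (T_cycles 0 d) = betti TYPE('k) \<Delta> (int d - 1)"
proof -
  define ev where "ev = (\<lambda>(c :: 'v set \<Rightarrow> 'i set \<Rightarrow> 'k) F. c F {})"
  have lin: "Vector_Spaces.linear fam_scale fun_scale ev"
    unfolding Vector_Spaces.linear_iff ev_def using vector_space_fun_scale vector_space_fam_scale
    by (auto simp: fun_eq_iff fun_scale_def fam_scale_def)
  have ch: "chains \<Delta> (int q - 1) = supp_in (faces {} q)" for q
    unfolding chains_eq_supp_in faces_over_def by (rule arg_cong[of _ _ supp_in]) auto
  have c0: "c F J = 0" if "c \<in> T 0 d" "J \<noteq> {}" for c F J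
    using X_mem_kforms[of c "{}" V 0 d F] X_mem_zero[of c "{}" V 0 d F] forms_0_eq[OF _ that(2)] that(1)
    unfolding T_def kforms_def by (cases "F \<in> faces {} d") auto
  have "fams.dim (T_cycles 0 d) = funs.dim (ev ` T_cycles 0 d)"
  proof (rule fams_funs.dim_image_injective[OF lin T_cycles_findim, symmetric])
    fix c assume c: "c \<in> T_cycles 0 d" "ev c = 0"
    have "c F J = 0" for F J
      using c0[of c J F] c fun_cong[OF c(2), of F] unfolding T_cycles_def ev_def by (cases "J = {}") auto
    then show "c = 0" by (auto simp: fun_eq_iff)
  qed
  moreover have "ev ` T_cycles 0 d = {c \<in> chains \<Delta> (int d - 1). boundary \<Delta> c = 0}"
  proof
    show "ev ` T_cycles 0 d \<subseteq> {c \<in> chains \<Delta> (int d - 1). boundary \<Delta> c = 0}"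
    proof
      fix z assume "z \<in> ev ` T_cycles 0 d"
      then obtain c where c: "c \<in> X {} V 0 d" "fbd {} c = 0" "z = ev c"
        unfolding T_cycles_def T_def by blast
      have "z \<in> supp_in (faces {} d)"
        using X_mem_zero[OF c(1)] unfolding c(3) ev_def supp_in_def by simp
      moreover have "boundary \<Delta> z = 0"
        using c(2) unfolding boundary_eq_rbd c(3) ev_def by (auto simp: fun_eq_iff fbd_apply)
      ultimately show "z \<in> {c \<in> chains \<Delta> (int d - 1). boundary \<Delta> c = 0}"
        unfolding ch by blast
    qed
    show "{c \<in> chains \<Delta> (int d - 1). boundary \<Delta> c = 0} \<subseteq> ev ` T_cycles 0 d"
    proof
      fix z :: "'v set \<Rightarrow> 'k" assume "z \<in> {c \<in> chains \<Delta> (int d - 1). boundary \<Delta> c = 0}"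
      then have z: "z \<in> supp_in (faces {} d)" "rbd V {} z = 0"
        unfolding ch boundary_eq_rbd by auto
      define c where "c F J = (if J = ({} :: 'i set) then z F else 0)" for F J
      have "c \<in> T 0 d"
        unfolding T_def
      proof (rule X_memI)
        fix F
        have "c F \<in> forms N 0"
          unfolding forms_def supp_in_def c_def by auto
        then show "c F \<in> kforms N p ({} \<union> (F \<inter> V)) 0"
          using contract_forms_0[OF finite_N] unfolding kforms_def by blast
      next
        fix F assume "F \<notin> faces {} d"
        then show "c F = 0"
          using supp_inD[OF z(1)] unfolding c_def by (auto simp: fun_eq_iff)
      qed
      moreover have "fbd {} c H J = 0" for H J
      proof (cases "J = {}")
        case True
        then show ?thesis
          using z(2) unfolding fbd_apply c_def by (simp add: fun_eq_iff)
      next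
        case False
        then show ?thesis
          unfolding fbd_apply c_def rbd_def by simp
      qed
      then have "fbd {} c = 0" by (auto simp: fun_eq_iff)
      moreover have "ev c = z"
        unfolding ev_def c_def by simp
      ultimately show "z \<in> ev ` T_cycles 0 d"
        unfolding T_cycles_def by blast
    qed
  qed
  moreover have "boundary \<Delta> ` (chains \<Delta> (int d - 1 + 1) :: ('v set \<Rightarrow> 'k) set) = {0}"
  proof -
    have "faces {} (Suc d) = {}"
      using face_card d unfolding faces_over_def by fastforce
    then have "(chains \<Delta> (int d - 1 + 1) :: ('v set \<Rightarrow> 'k) set) = {0}"
      using ch[of "Suc d"] by (simp add: supp_in_empty)
    then show ?thesis
      unfolding boundary_eq_rbd by (simp add: funs_pair.linear_0[OF rbd_linear])
  qed
  then have "funs.dim {c \<in> (chains \<Delta> (int d - 1) :: ('v set \<Rightarrow> 'k) set). boundary \<Delta> c = 0} =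
      betti TYPE('k) \<Delta> (int d - 1)"
    unfolding betti_def quot_dim_def by (simp add: funs.dim_zero_subspace)
  ultimately show ?thesis by simp
qed

end

section \<open>Acyclicity from the link conditions\<close>

lemma link_link:
  assumes \<Delta>: "simplicial_complex \<Delta>" and A: "A \<in> \<Delta>" and B: "B \<in> link \<Delta> A"
  shows "link (link \<Delta> A) B = link \<Delta> (A \<union> B)"
proof -
  have "A \<inter> B = {}"
    using B unfolding link_def by blast
  then show ?thesis
    using mem_link_iff[OF link_simplicial_complex[OF \<Delta> A], of _ B] mem_link_iff[OF \<Delta>]
    by (auto simp: Un_assoc)
qed

lemma cdim_eqI:
  assumes "finite \<Delta>" "\<And>F. F \<in> \<Delta> \<Longrightarrow> card F \<le> n" "F \<in> \<Delta>" "card F = n"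
  shows "cdim \<Delta> = int n - 1"
proof -
  have "Max (card ` \<Delta>) = n"
    by (rule Max_eqI) (use assms in auto)
  then show ?thesis
    unfolding cdim_def by simp
qed

lemma cdim_linkI:
  assumes \<Delta>: "simplicial_complex \<Delta>" and F: "F \<in> \<Delta>" "G \<subseteq> F" "card F = n"
    and n: "\<And>F. F \<in> \<Delta> \<Longrightarrow> card F \<le> n"
  shows "cdim (link \<Delta> G) = int n - 1 - int (card G)"
proof -
  have G: "G \<in> \<Delta>"
    using F simplicial_complexD(4)[OF \<Delta>] by blast
  have finF: "finite F" "finite G"
    using simplicial_complexD(3)[OF \<Delta>] F G by auto
  have "card H \<le> n - card G" if "H \<in> link \<Delta> G" for H
  proof -
    have "G \<union> H \<in> \<Delta>" "G \<inter> H = {}"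
      using that unfolding link_def by auto
    then show ?thesis
      using n[of "G \<union> H"] simplicial_complexD(3)[OF \<Delta>, of "G \<union> H"] by (simp add: card_Un_disjoint)
  qed
  moreover have "F - G \<in> link \<Delta> G"
    using F unfolding mem_link_iff[OF \<Delta>] by (simp add: Un_absorb1)
  moreover have "card (F - G) = n - card G"
    using F finF by (simp add: card_Diff_subset)
  moreover have "card G \<le> n"
    using card_mono[OF finF(1) F(2)] F(3) by simp
  ultimately show ?thesis
    using cdim_eqI[of "link \<Delta> G" "n - card G" "F - G"]
      simplicial_complexD(1)[OF link_simplicial_complex[OF \<Delta> G]] by simp
qed

lemma face_card_le_cdim:
  assumes "simplicial_complex \<Delta>" "cdim \<Delta> = int d - 1" "F \<in> \<Delta>"
  shows "card F \<le> d"
proof -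
  have "card F \<le> Max (card ` \<Delta>)"
    using assms simplicial_complexD(1) by (intro Max_ge) auto
  then show ?thesis
    using assms(2) unfolding cdim_def by simp
qed

lemma pure_face_extend:
  assumes \<Delta>: "simplicial_complex \<Delta>" and d: "cdim \<Delta> = int d - 1" and "pure \<Delta>" and G: "G \<in> \<Delta>"
  obtains F where "F \<in> \<Delta>" "G \<subseteq> F" "card F = d"
proof -
  obtain F where F: "F \<in> \<Delta>" "G \<subseteq> F" "\<forall>H\<in>\<Delta>. F \<subseteq> H \<longrightarrow> F = H"
    using finite_has_maximal2[OF simplicial_complexD(1)[OF \<Delta>] G] by blast
  then have "F \<in> facets \<Delta>"
    unfolding facets_def by blast
  then have "card F = d"
    using assms(3) d unfolding pure_def by force
  then show thesis
    using that F by blast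
qed

lemma skeleton_complex:
  assumes \<Delta>: "simplicial_complex \<Delta>" and "j \<ge> - 1"
  shows "simplicial_complex (skeleton \<Delta> j)"
proof -
  have "G \<in> skeleton \<Delta> j" if F: "F \<in> skeleton \<Delta> j" "G \<subseteq> F" for F G
  proof -
    have "F \<in> \<Delta>" "int (card F) - 1 \<le> j"
      using F(1) unfolding skeleton_def by auto
    then show ?thesis
      using card_mono[OF simplicial_complexD(3)[OF \<Delta>] F(2)] simplicial_complexD(4)[OF \<Delta> _ F(2)]
      unfolding skeleton_def by force
  qed
  moreover have "{} \<in> skeleton \<Delta> j" "skeleton \<Delta> j \<subseteq> \<Delta>"
    using simplicial_complexD(2)[OF \<Delta>] assms(2) unfolding skeleton_def by auto
  ultimately show ?thesis
    using simplicial_complexD(1,3)[OF \<Delta>] finite_subset unfolding simplicial_complex_def by blast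
qed

lemma cohen_macaulay_empty_face: "cohen_macaulay TYPE('k::field) {{} :: 'v::linorder set}"
proof -
  have link: "link {{}} {} = {{} :: 'v set}"
    unfolding link_def by auto
  have "betti TYPE('k) {{} :: 'v set} i = 0" if "i < -1" for i
  proof -
    have "{F \<in> {{} :: 'v set}. int (card F) - 1 = i} = {}"
      using that by auto
    then have ch: "(chains {{}} i :: ('v set \<Rightarrow> 'k) set) = {0}"
      using supp_in_empty unfolding chains_eq_supp_in by (rule ssubst)
    have "funs.dim {c \<in> (chains {{}} i :: ('v set \<Rightarrow> 'k) set). boundary {{}} c = 0} \<le> card ({} :: ('v set \<Rightarrow> 'k) set)"
      by (rule funs.dim_le_card) (auto simp: ch)
    then show ?thesis
      unfolding betti_def quot_dim_def by simp
  qed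
  moreover have "cdim {{} :: 'v set} = -1"
    unfolding cdim_def by simp
  ultimately show ?thesis
    unfolding cohen_macaulay_def by (auto simp: link)
qed

text \<open>The greatest element exists: \<open>j = 0\<close> qualifies, because the skeleton in
  dimension -1 contains only the empty face, and every candidate is at most
  \<open>d\<close>.\<close>

lemma complex_depth_skeleton:
  assumes \<Delta>: "simplicial_complex \<Delta>" and d: "cdim \<Delta> = int d - 1"
  shows "cohen_macaulay TYPE('k::field) (skeleton \<Delta> (int (complex_depth TYPE('k) \<Delta>) - 1))"
proof -
  define Q where "Q j \<longleftrightarrow> int j - 1 \<le> cdim \<Delta> \<and> cohen_macaulay TYPE('k) (skeleton \<Delta> (int j - 1))" for j
  have "skeleton \<Delta> (int 0 - 1) = {{}}"
    using simplicial_complexD(2,3)[OF \<Delta>] unfolding skeleton_def by auto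
  then have "Q 0"
    using cohen_macaulay_empty_face d unfolding Q_def by simp
  moreover have "j \<le> d" if "Q j" for j
    using that d unfolding Q_def by simp
  ultimately have "Q (Greatest Q)"
    by (rule GreatestI_nat) 
  then show ?thesis
    unfolding Q_def complex_depth_def by blast
qed

text \<open>For at most one vertex the Cohen-Macaulay skeleton of dimension \<open>d - 2\<close> is
  used, which costs one degree. A larger \<open>G\<close> contains two vertices \<open>v\<close> and
  \<open>u\<close>; its link is a link inside the Cohen-Macaulay link of \<open>{v, u}\<close>, and
  nothing is lost.\<close>

lemma racyclic_of_isolated_singularities:
  assumes \<Delta>: "simplicial_complex \<Delta>" and d: "cdim \<Delta> = int d - 1"
    and iso: "isolated_singularities TYPE('k::field) \<Delta>"
    and depth: "int (complex_depth TYPE('k) \<Delta>) = int d - 1"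
    and G: "G \<in> \<Delta>" and q: "q < d" "card G \<le> 1 \<Longrightarrow> Suc q < d"
  shows "racyclic TYPE('k) (vertices \<Delta>) \<Delta> G q"
proof (cases "card G \<le> 1")
  case True
  define \<Gamma> where "\<Gamma> = skeleton \<Delta> (int d - 2)"
  have qd: "Suc q < d"
    using q(2) True .
  have \<Gamma>: "simplicial_complex \<Gamma>"
    unfolding \<Gamma>_def by (rule skeleton_complex[OF \<Delta>]) (use qd in simp)
  have \<Gamma>_iff: "F \<in> \<Gamma> \<longleftrightarrow> F \<in> \<Delta> \<and> card F \<le> d - 1" for F
    unfolding \<Gamma>_def skeleton_def using qd by auto
  have CM: "cohen_macaulay TYPE('k) \<Gamma>"
  proof -
    have "int (complex_depth TYPE('k) \<Delta>) - 1 = int d - 2"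
      using depth by simp
    then show ?thesis
      using complex_depth_skeleton[OF \<Delta> d, where 'k='k] unfolding \<Gamma>_def by metis
  qed
  obtain F where F: "F \<in> \<Delta>" "G \<subseteq> F" "card F = d"
    using pure_face_extend[OF \<Delta> d _ G] iso unfolding isolated_singularities_def by blast
  \<comment> \<open>A face of maximal size of the skeleton over \<open>G\<close>, taken inside a
    facet; it fixes the dimension of the link of \<open>G\<close> in the skeleton.\<close>
  obtain F' where F': "G \<subseteq> F'" "F' \<subseteq> F" "card F' = d - 1"
  proof -
    have "card G \<le> d - 1" "d - 1 \<le> card F"
      using True qd F(3) by auto
    then show thesis
      using exists_subset_between[OF _ _ F(2) simplicial_complexD(3)[OF \<Delta> F(1)]] that by blast
  qed
  have "F' \<in> \<Gamma>"
    using F' F(1) simplicial_complexD(4)[OF \<Delta>] unfolding \<Gamma>_iff by auto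
  then have "cdim (link \<Gamma> G) = int (d - 1) - 1 - int (card G)"
    by (rule cdim_linkI[OF \<Gamma> _ F'(1,3)]) (auto simp: \<Gamma>_iff)
  moreover have G\<Gamma>: "G \<in> \<Gamma>"
    using G True qd unfolding \<Gamma>_iff by simp
  ultimately have "betti TYPE('k) (link \<Gamma> G) (int q - 1 - int (card G)) = 0"
    using CM qd unfolding cohen_macaulay_def by auto
  moreover have "vertices \<Gamma> \<subseteq> vertices \<Delta>"
    unfolding vertices_def \<Gamma>_iff[abs_def] using \<Gamma>_iff by blast
  ultimately have "racyclic TYPE('k) (vertices \<Delta>) \<Gamma> G q"
    by (intro racyclic_of_betti_link[OF \<Gamma> finite_vertices[OF \<Delta>] _ G\<Gamma>])
  \<comment> \<open>Exactness at \<open>q\<close> involves only faces of sizes \<open>q\<close> and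
    \<open>Suc q\<close>, and both are at most \<open>d - 1\<close>.\<close>
  moreover have "faces_over \<Gamma> G r = faces_over \<Delta> G r" if "r \<le> d - 1" for r
    using that unfolding faces_over_def \<Gamma>_iff by auto
  ultimately show ?thesis
    using qd unfolding racyclic_def by simp
next
  case False
  have finG: "finite G"
    using simplicial_complexD(3)[OF \<Delta> G] .
  obtain v where v: "v \<in> G"
    using False by fastforce
  obtain u where u: "u \<in> G - {v}"
  proof -
    have "card (G - {v}) > 0"
      using False v finG by (simp add: card_Diff_singleton)
    then show thesis
      using that by (metis card.empty equals0I less_irrefl)
  qed
  define B where "B = G - {u, v}"
  have vD: "{v} \<in> \<Delta>" "{v} \<union> {u} \<in> \<Delta>"
    using G u v simplicial_complexD(4)[OF \<Delta> G] by auto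
  have uL: "{u} \<in> link \<Delta> {v}"
    unfolding mem_link_iff[OF \<Delta>] using vD u by auto
  have BL: "B \<in> link \<Delta> ({v} \<union> {u})"
  proof -
    have "{v} \<union> {u} \<union> B = G"
      using u v unfolding B_def by auto
    then show ?thesis
      unfolding mem_link_iff[OF \<Delta>] using G by (auto simp: B_def)
  qed
  have "v \<in> vertices \<Delta>" "u \<in> vertices (link \<Delta> {v})"
    using vD uL unfolding vertices_def by auto
  then have "cohen_macaulay TYPE('k) (link (link \<Delta> {v}) {u})"
    using iso unfolding isolated_singularities_def buchsbaum_def by blast
  then have "cohen_macaulay TYPE('k) (link \<Delta> ({v} \<union> {u}))"
    unfolding link_link[OF \<Delta> vD(1) uL] .
  moreover have "link (link \<Delta> ({v} \<union> {u})) B = link \<Delta> G"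
  proof -
    have "{v} \<union> {u} \<union> B = G"
      using u v unfolding B_def by auto
    then show ?thesis
      using link_link[OF \<Delta> vD(2) BL] by simp
  qed
  ultimately have "\<forall>i<cdim (link \<Delta> G). betti TYPE('k) (link \<Delta> G) i = 0"
    using BL unfolding cohen_macaulay_def by metis
  moreover obtain F where "F \<in> \<Delta>" "G \<subseteq> F" "card F = d"
    using pure_face_extend[OF \<Delta> d _ G] iso unfolding isolated_singularities_def by blast
  then have "cdim (link \<Delta> G) = int d - 1 - int (card G)"
    by (rule cdim_linkI[OF \<Delta>]) (rule face_card_le_cdim[OF \<Delta> d])
  ultimately have "betti TYPE('k) (link \<Delta> G) (int q - 1 - int (card G)) = 0"
    using q(1) by simp
  then show ?thesis
    by (intro racyclic_of_betti_link[OF \<Delta> finite_vertices[OF \<Delta>] order_refl G])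
qed

text \<open>For \<open>d = 1\<close> the cohomological degree is -1, where the only cochains live on
  the empty face; it contains no vertex, so all relative cochains vanish.\<close>

lemma dim_kernel_inter_dim_0:
  fixes a :: "nat \<Rightarrow> 'v::linorder \<Rightarrow> 'k::field"
  assumes "simplicial_complex \<Delta>"
  shows "dim_kernel_inter \<Delta> (-1) 1 a = 0"
proof -
  have "(\<Inter>j\<in>{1..1}. kernel_families \<Delta> (-1) (a j)) \<subseteq> {0}"
  proof
    fix z assume "z \<in> (\<Inter>j\<in>{1..1}. kernel_families \<Delta> (-1) (a j))"
    then have z: "z \<in> kernel_families \<Delta> (-1) (a 1)"
      by simp
    have "z v = 0" for v
    proof (cases "v \<in> vertices \<Delta>")
      case True
      then have zv: "z v \<in> rel_cochains \<Delta> (contrastar \<Delta> v) (-1)"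
        using z unfolding kernel_families_def rel_cocycles_def by blast
      have "z v F = 0" for F
      proof (rule ccontr)
        assume "z v F \<noteq> 0"
        then have "F \<in> \<Delta>" "card F = 0" "F \<notin> contrastar \<Delta> v"
          using zv unfolding rel_cochains_def chains_def by auto
        then show False
          using simplicial_complexD(3)[OF assms] unfolding contrastar_def by auto
      qed
      then show ?thesis by auto
    next
      case False
      then show ?thesis
        using z unfolding kernel_families_def by blast
    qed
    then show "z \<in> {0}" by auto
  qed
  then have "fams.dim (\<Inter>j\<in>{1..1}. kernel_families \<Delta> (-1) (a j)) \<le> card ({} :: ('v \<Rightarrow> 'v set \<Rightarrow> 'k) set)"
    by (intro fams.dim_le_card) auto
  then show ?thesis
    unfolding dim_kernel_inter_def quot_dim_def by simp
qed

text \<open>Binomial symmetry turns the coefficient \<open>(d - q) choose (i - q)\<close> into the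
  dimension \<open>(d - q) choose (d - i)\<close> of the space of forms at a face.\<close>

lemma (in face_vectors) h_number_eq_euler_sum:
  assumes "card N = d" "i \<le> d"
  shows "h_number \<Delta> d i = (\<Sum>q=0..i. (-1) ^ (i - q) * int (fams.dim (T (d - i) q)))"
  unfolding h_number_def
proof (rule sum.cong[OF refl])
  fix q assume q: "q \<in> {0..i}"
  have "f_number \<Delta> (int q - 1) = card (faces_over \<Delta> {} q)"
    unfolding f_number_def faces_over_def by (rule arg_cong[of _ _ card]) auto
  moreover have "(d - q) choose (i - q) = (d - q) choose (d - i)"
    using binomial_symmetric[of "i - q" "d - q"] q assms(2) by simp
  ultimately show "(-1) ^ (i - q) * int ((d - q) choose (i - q)) * int (f_number \<Delta> (int q - 1)) =
      (-1) ^ (i - q) * int (fams.dim (T (d - i) q))"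
    unfolding T_dim assms(1) by simp
qed

theorem theorem5p1:
  fixes \<Delta> :: "'v::linorder set set" and d :: nat
  assumes "infinite (UNIV :: 'k::field set)"
    and "simplicial_complex \<Delta>"
    and "cdim \<Delta> = int d - 1"
    and "isolated_singularities TYPE('k) \<Delta>"
    and "int (complex_depth TYPE('k) \<Delta>) = int d - 1"
  shows "sufficiently_generic d (vertices \<Delta>) (\<lambda>a :: nat \<Rightarrow> 'v \<Rightarrow> 'k.
    let \<theta> = (\<lambda>j. linear_form (vertices \<Delta>) (a j)); \<Theta> = \<theta> ` {1..d} in
      lsop \<Delta> d \<theta> \<and>
      h_prime \<Delta> \<Theta> d = betti TYPE('k) \<Delta> (int d - 1) \<and>
      int (h_prime \<Delta> \<Theta> (d - 1)) =
        h_number \<Delta> d (d - 1) + int (dim_kernel_inter \<Delta> (int d - 2) d a) \<and>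
      (\<forall>i. i < d - 1 \<longrightarrow> int (h_prime \<Delta> \<Theta> i) = h_number \<Delta> d i))"
proof -
  note \<Delta> = assms(2)
  have d1: "d \<ge> 1"
    using assms(5) by simp
  obtain P :: "(nat \<times> 'v, 'k) mpoly" where P: "P \<in> polys ({1..d} \<times> vertices \<Delta>)" "P \<noteq> 0"
    "\<And>a F. poly_eval (\<lambda>(j, v). a j v) P \<noteq> 0 \<Longrightarrow> F \<in> \<Delta> \<Longrightarrow> card F = d \<Longrightarrow>
      \<exists>c. dual_basis {1..d} (\<lambda>v j. a j v) F c"
    using exists_generic_polynomial[OF \<Delta>, of "{1..d}", where 'k='k] by auto
  have main: "lsop \<Delta> d \<theta> \<and>
      h_prime \<Delta> \<Theta> d = betti TYPE('k) \<Delta> (int d - 1) \<and>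
      int (h_prime \<Delta> \<Theta> (d - 1)) =
        h_number \<Delta> d (d - 1) + int (dim_kernel_inter \<Delta> (int d - 2) d a) \<and>
      (\<forall>i. i < d - 1 \<longrightarrow> int (h_prime \<Delta> \<Theta> i) = h_number \<Delta> d i)"
    if a: "poly_eval (\<lambda>(j, v). a j v) P \<noteq> 0"
      and \<theta>: "\<theta> = (\<lambda>j. linear_form (vertices \<Delta>) (a j))" and \<Theta>: "\<Theta> = \<theta> ` {1..d}" for a \<theta> \<Theta>
  proof -
    interpret face_vectors \<Delta> "{1..d}" "\<lambda>v j. a j v"
    proof
      show "simplicial_complex \<Delta>" "finite {1..d}"
        using \<Delta> by auto
      show "card F \<le> card {1..d}" if "F \<in> \<Delta>" for F
        using face_card_le_cdim[OF \<Delta> assms(3) that] by simp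
      \<comment> \<open>By purity every face lies in one with \<open>d\<close> vertices, so
        independence on the latter is enough.\<close>
      show "\<exists>c. dual_basis {1..d} (\<lambda>v j. a j v) F c" if F: "F \<in> \<Delta>" for F
      proof -
        obtain F' where "F' \<in> \<Delta>" "F \<subseteq> F'" "card F' = d"
          using pure_face_extend[OF \<Delta> assms(3) _ F] assms(4) unfolding isolated_singularities_def by blast
        then show ?thesis
          using P(3)[OF a] dual_basis_subset by blast
      qed
    qed
    have theta: "theta = \<theta>"
      unfolding \<theta> by (rule ext) (simp add: theta_def)
    have h': "h_prime \<Delta> \<Theta> i = fams.dim (T_cycles (d - i) i)" if "i \<le> d" for i
      using h_prime_eq_dim_stress[of i] dim_T_cycles_top[of i] that unfolding \<Theta> theta by simp
    have racyclic: "racyclic TYPE('k) V \<Delta> G q"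
      if "G \<in> \<Delta>" "q < d" "card G \<le> 1 \<Longrightarrow> Suc q < d" for G q
      using racyclic_of_isolated_singularities[OF \<Delta> assms(3-5)] that by blast
    have acyclic: "acyclic_at {} V e q" if "q + e < d" "Suc q < d" "e > 0 \<Longrightarrow> q + 2 < d" for e q
      using acyclic_general[of d V "{}" q e, OF racyclic] finite_V that by simp
    have "lsop \<Delta> d \<theta>"
      using assms(3) theta_homogeneous quotient_finite_dimensional unfolding lsop_def theta by simp
    moreover have "h_prime \<Delta> \<Theta> d = betti TYPE('k) \<Delta> (int d - 1)"
      using h'[of d] dim_T_cycles_betti[of d] by simp
    moreover have "int (h_prime \<Delta> \<Theta> i) = h_number \<Delta> d i" if i: "i < d - 1" for i
    proof -
      \<comment> \<open>Here \<open>d - i \<ge> 2\<close>, so \<open>q < i\<close> already implies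
        \<open>q + 2 < d\<close>.\<close>
      have "acyclic_at {} V (d - i) q" if "q < i" for q
        using that i by (intro acyclic) auto
      then have "h_number \<Delta> d i = int (fams.dim (T_cycles (d - i) i))"
        using h_number_eq_euler_sum[of d i] euler_sum_acyclic[of i "d - i"] i by simp
      then show ?thesis
        using h'[of i] i by simp
    qed
    moreover have "int (h_prime \<Delta> \<Theta> (d - 1)) =
        h_number \<Delta> d (d - 1) + int (dim_kernel_inter \<Delta> (int d - 2) d a)"
    proof (cases "d = 1")
      case True
      have "h_number \<Delta> d 0 = int (fams.dim (T_cycles d 0))"
        using h_number_eq_euler_sum[of d 0] euler_sum_acyclic[of 0 d] by simp
      then show ?thesis
        using h'[of 0] dim_kernel_inter_dim_0[OF \<Delta>, of a] True by simp
    next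
      case False
      \<comment> \<open>The one degree below the top in which the complex for \<open>e = 1\<close>
        may have homology.\<close>
      define q where "q = d - 2"
      have q: "d = Suc (Suc q)"
        using False d1 unfolding q_def by simp
      have "acyclic_at {} V 1 r" if "r < q" for r
        using that q by (intro acyclic) auto
      then have "h_number \<Delta> d (Suc q) = int (fams.dim (T_cycles 1 (Suc q))) +
          int (fams.dim (fbd {} ` T 1 (Suc q))) - int (fams.dim (T_cycles 1 q))"
        using h_number_eq_euler_sum[of d "Suc q"] euler_sum_Suc[of q 1] q by simp
      \<comment> \<open>Without annihilation conditions exactness at \<open>d - 2\<close> is still
        provided by the depth; only the vertex conditions create the defect.\<close>
      moreover have "acyclic_at {} {} 1 q"
        using racyclic[of "{}" q] simplicial_complexD(2)[OF \<Delta>] q by (intro acyclic_base) simp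
      then have "int (fams.dim (T_cycles 1 q)) - int (fams.dim (fbd {} ` T 1 (Suc q))) =
          int (dim_kernel_inter \<Delta> (int d - 2) d a)"
        using dim_kernel_families[of q] q unfolding dim_kernel_inter_def by simp
      ultimately show ?thesis
        using h'[of "Suc q"] q by simp
    qed
    ultimately show ?thesis by blast
  qed
  show ?thesis
    unfolding sufficiently_generic_def Let_def
    using P(1,2) main by blast
qed

end
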